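(* Let $\alpha>0$. Let $\{X_t,t\ge1\}$ be a sequence of identically distributed, pairwise asymptotically independent positive random variables and let $\{\Theta_t,t\ge1\}$ be a sequence of positive random variables independent of $\{X_t\}$, such that $X_{(\infty)}=\sum_{t=1}^\infty\Theta_tX_t$ is finite with probability one and has regularly varying tail of index $-\alpha$. Suppose $\{\Theta_t\}$ satisfies the following condition, depending on the value of $\alpha$: - (RW1) if $0<\alpha<1$: for some $\epsilon\in(0,\alpha)$, $\sum_{t=1}^\infty E[\Theta_t^{\alpha+\epsilon}+\Theta_t^{\alpha-\epsilon}]<\infty$; - (RW2) if $1\le\alpha<\infty$: for some $\epsilon\in(0,\alpha)$, $\sum_{t=1}^\infty\left(E[\Theta_t^{\alpha+\epsilon}+\Theta_t^{\alpha-\epsilon}]\right)^{\frac1{\alpha+\epsilon}}<\infty$. If, further, for all $\beta\in\mathbb R$, $$\sum_{t=1}^\infty E[\Theta_t^{\alpha+i\beta}]\ne0,$$ then $X_1$ has regularly varying tail of index $-\alpha$ and, as $x\to\infty$, $$P[X_{(\infty)}>x]\sim P[X_1>x]\sum_{t=1}^\infty E[\Theta_t^\alpha].$$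
   Context: $a(x)\sim b(x)$ means $\lim_{x\to\infty}a(x)/b(x)=1$. A random variable $X$ has regularly varying tail of index $-\alpha$ if $P[X>ux]\sim u^{-\alpha}P[X>x]$ as $x\to\infty$ for every $u>0$ (in particular $P[X>x]>0$ for all $x$). Two random variables $Y_1,Y_2$ (with $P[Y_t>x]>0$ for all $x>0$) are asymptotically independent if $\lim_{x\to\infty}P[Y_1>x,Y_2>x]/P[Y_t>x]=0$ for $t=1,2$. *)

theory Defs
  imports "HOL-Probability.Probability" "HOL-Library.Landau_Symbols"
begin

(* Positivity of the tail is part of the notion, and it is needed for the asymptotic equivalence
   of the library to mean that the quotient of the two sides tends to 1: that relation also
   identifies two functions that both vanish eventually. *)
definition regularly_varying_tail :: "'a measure \<Rightarrow> real \<Rightarrow> ('a \<Rightarrow> real) \<Rightarrow> bool" where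
  "regularly_varying_tail M \<alpha> Y \<longleftrightarrow>
     (\<forall>x. \<P>(\<omega> in M. Y \<omega> > x) > 0) \<and>
     (\<forall>u>0. (\<lambda>x. \<P>(\<omega> in M. Y \<omega> > u * x))
              \<sim>[at_top] (\<lambda>x. u powr (-\<alpha>) * \<P>(\<omega> in M. Y \<omega> > x)))"

definition asymptotically_independent ::
    "'a measure \<Rightarrow> ('a \<Rightarrow> real) \<Rightarrow> ('a \<Rightarrow> real) \<Rightarrow> bool" where
  "asymptotically_independent M Y\<^sub>1 Y\<^sub>2 \<longleftrightarrow>
     (\<forall>Y\<in>{Y\<^sub>1, Y\<^sub>2}.
        (\<forall>x>0. \<P>(\<omega> in M. Y \<omega> > x) > 0) \<and>
        ((\<lambda>x. \<P>(\<omega> in M. Y\<^sub>1 \<omega> > x \<and> Y\<^sub>2 \<omega> > x) / \<P>(\<omega> in M. Y \<omega> > x))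
           \<longlongrightarrow> 0) at_top)"

(* Sequences are indexed by t \<ge> 1, so series over t run over Suc t; the values at index 0
   are irrelevant.  Finiteness of the expectations is stated as integrability because the
   Bochner integral of a non-integrable function is 0. *)
definition RW1 :: "'a measure \<Rightarrow> real \<Rightarrow> (nat \<Rightarrow> 'a \<Rightarrow> real) \<Rightarrow> bool" where
  "RW1 M \<alpha> \<Theta> \<longleftrightarrow>
     (\<exists>\<epsilon>. 0 < \<epsilon> \<and> \<epsilon> < \<alpha> \<and>
        (\<forall>t\<ge>1. integrable M (\<lambda>\<omega>. \<Theta> t \<omega> powr (\<alpha> + \<epsilon>) + \<Theta> t \<omega> powr (\<alpha> - \<epsilon>))) \<and>
        summable (\<lambda>t. \<integral>\<omega>. (\<Theta> (Suc t) \<omega> powr (\<alpha> + \<epsilon>) + \<Theta> (Suc t) \<omega> powr (\<alpha> - \<epsilon>)) \<partial>M))"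

definition RW2 :: "'a measure \<Rightarrow> real \<Rightarrow> (nat \<Rightarrow> 'a \<Rightarrow> real) \<Rightarrow> bool" where
  "RW2 M \<alpha> \<Theta> \<longleftrightarrow>
     (\<exists>\<epsilon>. 0 < \<epsilon> \<and> \<epsilon> < \<alpha> \<and>
        (\<forall>t\<ge>1. integrable M (\<lambda>\<omega>. \<Theta> t \<omega> powr (\<alpha> + \<epsilon>) + \<Theta> t \<omega> powr (\<alpha> - \<epsilon>))) \<and>
        summable (\<lambda>t. (\<integral>\<omega>. (\<Theta> (Suc t) \<omega> powr (\<alpha> + \<epsilon>) + \<Theta> (Suc t) \<omega> powr (\<alpha> - \<epsilon>)) \<partial>M)
                        powr (1 / (\<alpha> + \<epsilon>))))"

definition weighted_sum :: "(nat \<Rightarrow> 'a \<Rightarrow> real) \<Rightarrow> (nat \<Rightarrow> 'a \<Rightarrow> real) \<Rightarrow> 'a \<Rightarrow> real" where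
  "weighted_sum \<Theta> X \<omega> = (\<Sum>t. \<Theta> (Suc t) \<omega> * X (Suc t) \<omega>)"

end

theory Submission
  imports Defs
begin

text \<open>
  Write F for the common tail of the X_t, G for the tail of the infinite sum W, and Z_t = \<Theta>_t
  X_t. The proof has a probabilistic half, which turns the hypothesis on W into an equation for F,
  and an analytic half, which solves that equation.

  Probabilistic half: a sum of heavy-tailed, pairwise asymptotically independent terms is large
  because exactly one of them is large, so that the sum over t of P[Z_t > x] is asymptotic to G(x).
  The only information about F available for this is domination, F \<le> K G, which holds because
  \<Theta>_1 X_1 \<le> W and \<Theta>_1 exceeds some positive constant with positive probability
  (factor_tail_dominated). Regular variation of G enters through Potter's bound G(x/v) \<le> C
  (v^(\<alpha>+\<epsilon>) + v^(\<alpha>-\<epsilon>)) G(x), which makes every estimate uniform in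
  the random weights. It shows that two large terms together are negligible against G
  (product_pair_negligible), and that the contribution of all terms beyond the n-th is a small
  multiple of G (sum_tail_uniformly_small); the latter compares p-th moments of the truncated terms
  for some p > \<alpha>, and here the two cases of the moment condition become the single statement
  RW_common_exponents. The three facts are combined in single_big_jump.

  Analytic half: conditioning on the weights gives P[Z_t > x] = E[F(x/\<Theta>_t)]. Let \<kappa> be
  the image under the logarithm of the measure with mass the sum over t of E[\<Theta>_t^\<alpha>;
  \<Theta>_t in dv]. On the additive scale h(s) = F(e^s)/G(e^s) the asymptotic relation becomes: the
  convolution of the bounded function h with \<kappa> tends to 1. The Fourier transform of \<kappa>
  at \<beta> is the sum over t of E[\<Theta>_t^(\<alpha>+i\<beta>)], so it has no zeros, and a
  Tauberian theorem of Wiener and Pitt (Wiener_Pitt) yields h \<longlonglongrightarrow>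
  1/\<kappa>(R). This is G(x) \<sim> F(x) times the sum of the E[\<Theta>_t^\<alpha>], and F
  inherits regular variation from G.

  Wiener's theorem is elementary for this \<kappa>, because exponential moments make its Fourier
  transform \<chi> smooth: the function with transform (triangle)/\<chi> is integrable by two
  integrations by parts, and its convolution with \<kappa> is the Fejer kernel. Hence all Fejer
  averages of h converge; since F is nonincreasing and G is regularly varying, h cannot grow
  quickly, and convergence of the averages gives convergence of h itself.
\<close>



section \<open>Half-line Fourier integrals and the Fejer kernel\<close>

definition half_ft :: "real \<Rightarrow> (real \<Rightarrow> complex) \<Rightarrow> real \<Rightarrow> complex" where
  "half_ft R q x = (\<integral>\<xi>. indicator {0..R} \<xi> *\<^sub>R (q \<xi> * iexp (- (x * \<xi>))) \<partial>lborel)"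

lemma integrable_half_ft:
  assumes "continuous_on {0..R} q"
  shows "integrable lborel (\<lambda>\<xi>. indicator {0..R} \<xi> *\<^sub>R (q \<xi> * iexp (- (x * \<xi>))))"
  by (intro borel_integrable_compact compact_Icc continuous_intros assms)

lemma norm_half_ft_le:
  assumes "continuous_on {0..R} q" and "\<And>\<xi>. \<xi> \<in> {0..R} \<Longrightarrow> norm (q \<xi>) \<le> B" and "0 \<le> R"
  shows "norm (half_ft R q x) \<le> B * R"
proof -
  have "norm (half_ft R q x) \<le> (\<integral>\<xi>. indicator {0..R} \<xi> * B \<partial>(lborel :: real measure))"
    unfolding half_ft_def
  proof (rule Bochner_Integration.integral_norm_bound_integral)
    show "integrable lborel (\<lambda>\<xi>. indicator {0..R} \<xi> *\<^sub>R (q \<xi> * iexp (- (x * \<xi>))))"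
      by (rule integrable_half_ft[OF assms(1)])
    show "integrable lborel (\<lambda>\<xi>. indicator {0..R} \<xi> * B :: real)"
      by (intro integrable_mult_left integrable_real_indicator) (auto simp: emeasure_lborel_Icc_eq)
    show "norm (indicator {0..R} \<xi> *\<^sub>R (q \<xi> * iexp (- (x * \<xi>)))) \<le> indicator {0..R} \<xi> * B" for \<xi>
      using assms(2)[of \<xi>] by (auto simp: norm_mult indicator_def)
  qed
  also have "\<dots> = B * R" using assms(3) by simp
  finally show ?thesis .
qed

lemma half_ft_by_parts:
  assumes R: "0 \<le> R" and x: "x \<noteq> 0"
    and q: "\<And>\<xi>. (q has_vector_derivative q' \<xi>) (at \<xi>)"
    and q': "\<And>\<xi>. (q' has_vector_derivative q'' \<xi>) (at \<xi>)"
    and q'': "continuous_on {0..R} q''"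
  shows "half_ft R q x = \<i> / x * (q R * iexp (- (x * R)) - q 0)
    + (q' R * iexp (- (x * R)) - q' 0) / x\<^sup>2 - half_ft R q'' x / x\<^sup>2"
proof -
  define P where "P \<xi> = (\<i> / x) * (q \<xi> * iexp (- (x * \<xi>))) + (q' \<xi> * iexp (- (x * \<xi>))) / x\<^sup>2" for \<xi>
  have iexp': "((\<lambda>\<xi>. iexp (- (x * \<xi>))) has_vector_derivative (- \<i> * x * iexp (- (x * \<xi>)))) (at \<xi>)" for \<xi>
  proof -
    have "((\<lambda>z. exp (- \<i> * x * z)) has_field_derivative (- \<i> * x * exp (- \<i> * x * z))) (at z)" for z
      by (auto intro!: derivative_eq_intros)
    from has_vector_derivative_real_field[OF this[of "complex_of_real \<xi>"]]
    show ?thesis by (simp add: mult.assoc)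
  qed
  have cq: "continuous_on {0..R} q"
    by (intro continuous_at_imp_continuous_on ballI has_vector_derivative_continuous[OF q])
  have P': "(P has_vector_derivative (q \<xi> * iexp (- (x * \<xi>)) + q'' \<xi> * iexp (- (x * \<xi>)) / x\<^sup>2)) (at \<xi>)" for \<xi>
    unfolding P_def
    apply (rule derivative_eq_intros q q' iexp' has_vector_derivative_mult refl | rule has_vector_derivative_divide)+
    using x apply (simp add: field_simps power2_eq_square)
    done
  have "(\<integral>\<xi>. indicator {0..R} \<xi> *\<^sub>R (q \<xi> * iexp (- (x * \<xi>)) + q'' \<xi> * iexp (- (x * \<xi>)) / x\<^sup>2) \<partial>lborel) = P R - P 0"
    by (intro integral_FTC_Icc R has_vector_derivative_at_within[OF P'] continuous_intros cq q'')
       (use x in auto)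
  also have "(\<integral>\<xi>. indicator {0..R} \<xi> *\<^sub>R (q \<xi> * iexp (- (x * \<xi>)) + q'' \<xi> * iexp (- (x * \<xi>)) / x\<^sup>2) \<partial>lborel)
     = (\<integral>\<xi>. indicator {0..R} \<xi> *\<^sub>R (q \<xi> * iexp (- (x * \<xi>))) +
              (indicator {0..R} \<xi> *\<^sub>R (q'' \<xi> * iexp (- (x * \<xi>)))) / x\<^sup>2 \<partial>lborel)"
    by (intro Bochner_Integration.integral_cong refl) (auto simp: indicator_def)
  also have "\<dots> = half_ft R q x + half_ft R q'' x / x\<^sup>2"
    unfolding half_ft_def
    by (subst Bochner_Integration.integral_add
        [OF integrable_half_ft[OF cq] integrable_divide_zero[OF integrable_half_ft[OF q'']]])
      (simp only: integral_divide_zero)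
  finally show ?thesis
    unfolding P_def by (simp add: diff_divide_distrib add_divide_distrib algebra_simps)
qed

text \<open>
  Two integrations by parts leave the boundary term -i q(0)/x as the only one that decays more
  slowly than 1/x^2. It is purely imaginary when q(0) is real, so the real part is integrable over
  the line. This is why a weight with a corner at 0, such as the triangle, may be treated on the
  half line only.
\<close>

lemma Re_half_ft_decay:
  assumes R: "0 \<le> R"
    and q: "\<And>\<xi>. (q has_vector_derivative q' \<xi>) (at \<xi>)"
    and q': "\<And>\<xi>. (q' has_vector_derivative q'' \<xi>) (at \<xi>)"
    and q'': "continuous_on {0..R} q''"
    and "q R = 0" "Im (q 0) = 0"
  obtains C where "\<And>x. \<bar>Re (half_ft R q x)\<bar> \<le> C * inverse (1 + x\<^sup>2)"
proof -
  have cq: "continuous_on {0..R} q"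
    by (intro continuous_at_imp_continuous_on ballI has_vector_derivative_continuous[OF q])
  obtain B where B: "\<And>\<xi>. \<xi> \<in> {0..R} \<Longrightarrow> norm (q \<xi>) \<le> B"
    using compact_imp_bounded[OF compact_continuous_image[OF cq compact_Icc]]
    unfolding bounded_iff by blast
  obtain B'' where B'': "\<And>\<xi>. \<xi> \<in> {0..R} \<Longrightarrow> norm (q'' \<xi>) \<le> B''"
    using compact_imp_bounded[OF compact_continuous_image[OF q'' compact_Icc]]
    unfolding bounded_iff by blast
  define C where "C = norm (q' R) + norm (q' 0) + B'' * R"
  have "\<bar>Re (half_ft R q x)\<bar> \<le> (B * R + C) * inverse (1 + x\<^sup>2)" for x
  proof -
    have le1: "\<bar>Re (half_ft R q x)\<bar> \<le> B * R"
      using norm_half_ft_le[OF cq B R, of x] abs_Re_le_cmod[of "half_ft R q x"] by linarith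
    have le2: "\<bar>Re (half_ft R q x)\<bar> * x\<^sup>2 \<le> C"
    proof (cases "x = 0")
      case True
      have "0 \<le> B''" using R by (intro order_trans[OF norm_ge_zero B''[of 0]]) auto
      then show ?thesis using True R by (simp add: C_def)
    next
      case False
      define w where "w = q' R * iexp (- (x * R)) - q' 0 - half_ft R q'' x"
      have "half_ft R q x = - (\<i> / x * q 0) + w / complex_of_real (x\<^sup>2)"
        unfolding half_ft_by_parts[OF R False q q' q''] w_def using assms(5)
        by (simp add: diff_divide_distrib)
      then have "Re (half_ft R q x) = Re w / x\<^sup>2"
        using assms(6) by (simp add: Re_divide_of_real del: of_real_power)
      then have "\<bar>Re (half_ft R q x)\<bar> * x\<^sup>2 = \<bar>Re w\<bar>"
        using False by simp
      also have "\<dots> \<le> norm w" by (rule abs_Re_le_cmod)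
      also have "\<dots> \<le> norm (q' R * iexp (- (x * R))) + norm (q' 0) + norm (half_ft R q'' x)"
        unfolding w_def by (meson add_mono norm_triangle_ineq4 order_refl order_trans)
      also have "\<dots> \<le> C"
        unfolding C_def using norm_half_ft_le[OF q'' B'' R, of x] by (simp add: norm_mult)
      finally show ?thesis .
    qed
    have "\<bar>Re (half_ft R q x)\<bar> * (1 + x\<^sup>2) \<le> B * R + C"
      using le1 le2 by (simp add: algebra_simps)
    moreover have "1 + x\<^sup>2 > 0" by (simp add: add_pos_nonneg)
    ultimately show ?thesis by (simp add: field_simps)
  qed
  then show thesis by (rule that)
qed

lemma integrable_inverse_1_plus_square_lborel: "integrable lborel (\<lambda>x::real. inverse (1 + x\<^sup>2))"
  using integrable_inverse_1_plus_square by (simp add: set_integrable_def)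

text \<open>
  The Fejer kernel, up to a constant factor: the Fourier transform of the triangle 1 -
  \<bar>\<xi>\<bar>/R on [-R, R]. Division by zero gives the value 0 at the origin instead of the
  limit R, so identities with integrals are stated for nonzero arguments only.
\<close>

definition fejer :: "real \<Rightarrow> real \<Rightarrow> real" where
  "fejer R x = 2 * (1 - cos (R * x)) / (R * x\<^sup>2)"

lemma fejer_nonneg: "0 \<le> R \<Longrightarrow> 0 \<le> fejer R x"
  unfolding fejer_def by simp

lemma fejer_measurable[measurable]: "fejer R \<in> borel_measurable borel"
  unfolding fejer_def[abs_def] by measurable

lemma has_vector_derivative_triangle:
  "((\<lambda>\<xi>. complex_of_real (1 - \<xi> / R)) has_vector_derivative complex_of_real (- (1 / R))) (at \<xi>)"
  by (rule has_vector_derivative_of_real, cases "R = 0") (auto intro!: derivative_eq_intros)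

lemma fejer_eq_half_ft:
  assumes "0 < R" "x \<noteq> 0"
  shows "fejer R x = 2 * Re (half_ft R (\<lambda>\<xi>. complex_of_real (1 - \<xi> / R)) x)"
proof -
  have "half_ft R (\<lambda>\<xi>. complex_of_real (1 - \<xi> / R)) x =
      \<i> / x * (0 - 1) + (complex_of_real (- (1 / R)) * iexp (- (x * R)) - complex_of_real (- (1 / R))) / x\<^sup>2"
    using assms half_ft_by_parts[OF _ assms(2) has_vector_derivative_triangle has_vector_derivative_const, of R R]
    by (simp add: half_ft_def)
  also have "\<dots> = - (\<i> / x) + complex_of_real (inverse (R * x\<^sup>2)) * (1 - iexp (- (x * R)))"
    using assms by (simp add: field_simps)
  finally show ?thesis unfolding fejer_def
    by (simp add: Re_exp mult.commute[of x R] divide_inverse mult_ac del: of_real_inverse of_real_mult of_real_power)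
qed

lemma integrable_fejer:
  assumes "0 < R" shows "integrable lborel (fejer R)"
proof -
  obtain C where C: "\<And>x. \<bar>Re (half_ft R (\<lambda>\<xi>. complex_of_real (1 - \<xi> / R)) x)\<bar> \<le> C * inverse (1 + x\<^sup>2)"
    by (rule Re_half_ft_decay[OF _ has_vector_derivative_triangle has_vector_derivative_const, of R R])
       (use assms in auto)
  have AE: "AE x in lborel. x \<noteq> (0::real)"
    by (rule AE_lborel_singleton)
  have "integrable lborel (\<lambda>x::real. 2 * C * inverse (1 + x\<^sup>2))"
    by (intro integrable_mult_right integrable_inverse_1_plus_square_lborel)
  then show ?thesis
  proof (rule Bochner_Integration.integrable_bound)
    show "AE x in lborel. norm (fejer R x) \<le> norm (2 * C * inverse (1 + x\<^sup>2))"
      using AE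
    proof eventually_elim
      case (elim x)
      then show ?case
        using C[of x] fejer_eq_half_ft[OF assms elim]
          abs_ge_self[of "2 * C * inverse (1 + x\<^sup>2)"] by (simp add: abs_mult)
    qed
  qed simp
qed

lemma fejer_tail:
  assumes "0 < R" "0 < d" "d \<le> \<bar>x\<bar>"
  shows "fejer R x \<le> 4 * (1 + inverse (d\<^sup>2)) / R * inverse (1 + x\<^sup>2)"
proof -
  have x: "x\<^sup>2 > 0" and "d\<^sup>2 \<le> x\<^sup>2" using assms abs_le_square_iff[of d x] by auto
  then have "1 + x\<^sup>2 \<le> (1 + inverse (d\<^sup>2)) * x\<^sup>2" using assms by (simp add: field_simps)
  then have "inverse (x\<^sup>2) \<le> (1 + inverse (d\<^sup>2)) * inverse (1 + x\<^sup>2)"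
    using x by (simp add: field_simps add_pos_nonneg)
  then have *: "4 / R * inverse (x\<^sup>2) \<le> 4 / R * ((1 + inverse (d\<^sup>2)) * inverse (1 + x\<^sup>2))"
    using assms by (intro mult_left_mono) auto
  have "fejer R x = 2 * (1 - cos (R * x)) * inverse (R * x\<^sup>2)"
    unfolding fejer_def by (simp add: divide_inverse)
  also have "\<dots> \<le> 4 * inverse (R * x\<^sup>2)"
  proof (rule mult_right_mono)
    have "1 - cos (R * x) \<le> 2" using abs_cos_le_one[of "R * x"] by linarith
    then show "2 * (1 - cos (R * x)) \<le> 4" by argo
  qed (use assms(1) in simp)
  also have "\<dots> = 4 / R * inverse (x\<^sup>2)" by (simp add: divide_inverse)
  also note *
  finally show ?thesis by (simp only: mult.assoc times_divide_eq_left times_divide_eq_right)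
qed

text \<open>
  The kernels for different R are rescalings of each other, so the total mass is independent of R
  while, by the preceding estimate, the mass outside a neighbourhood of 0 is of order 1/R.
\<close>

lemma integral_fejer:
  assumes "0 < R" shows "integral\<^sup>L lborel (fejer R) = integral\<^sup>L lborel (fejer 1)"
proof -
  have "integral\<^sup>L lborel (fejer 1) = \<bar>R\<bar> *\<^sub>R (\<integral>x. fejer 1 (0 + R * x) \<partial>lborel)"
    using assms by (intro lborel_integral_real_affine) auto
  also have "\<dots> = (\<integral>x. R * fejer 1 (R * x) \<partial>lborel)" using assms by simp
  also have "\<dots> = integral\<^sup>L lborel (fejer R)"
    using assms by (intro Bochner_Integration.integral_cong refl) (simp add: fejer_def power2_eq_square)
  finally show ?thesis by simp
qed

lemma integral_fejer_pos: "0 < R \<Longrightarrow> 0 < integral\<^sup>L lborel (fejer R)"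
proof -
  assume R: "0 < R"
  have "integral\<^sup>L lborel (fejer 1) \<noteq> 0"
  proof
    assume "integral\<^sup>L lborel (fejer 1) = 0"
    then have "AE x in lborel. fejer 1 x = 0"
      by (subst (asm) integral_nonneg_eq_0_iff_AE) (auto intro!: integrable_fejer fejer_nonneg)
    then have "AE x in lborel. x \<notin> {0<..<1::real}"
    proof eventually_elim
      case (elim x)
      { assume "x \<in> {0<..<1::real}"
        then have x: "0 < x" "x < 1" by auto
        then have "cos x < cos 0" using pi_gt3 by (intro cos_monotone_0_pi) auto
        with elim x have False by (simp add: fejer_def) }
      then show ?case by blast
    qed
    then have "{0<..<1::real} \<in> null_sets lborel"
      by (subst AE_iff_null_sets) auto
    then show False by (simp add: null_sets_def)
  qed
  moreover have "0 \<le> integral\<^sup>L lborel (fejer 1)" by (intro Bochner_Integration.integral_nonneg fejer_nonneg) simp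
  ultimately show ?thesis using integral_fejer[OF R] by simp
qed



section \<open>The Fejer kernel as a convolution with a given measure\<close>

text \<open>
  The k-th derivative of the characteristic function, provided that sufficiently many moments exist.
\<close>

definition iexp_moment :: "real measure \<Rightarrow> nat \<Rightarrow> real \<Rightarrow> complex" where
  "iexp_moment \<kappa> k \<xi> = (\<integral>w. (\<i> * complex_of_real w) ^ k * iexp (\<xi> * w) \<partial>\<kappa>)"

lemma iexp_moment_0: "iexp_moment \<kappa> 0 = char \<kappa>"
  by (simp add: iexp_moment_def char_def fun_eq_iff)

context finite_borel_measure
begin

lemmas [measurable_cong] = M_is_borel

lemma integrable_abs_power_le_4:
  assumes "integrable M (\<lambda>w. w ^ 4)" "k \<le> 4"
  shows "integrable M (\<lambda>w. \<bar>w\<bar> ^ k)"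
proof (rule Bochner_Integration.integrable_bound)
  show "integrable M (\<lambda>w. 1 + w ^ 4)" using assms(1) by simp
  show "AE w in M. norm (\<bar>w\<bar> ^ k) \<le> norm (1 + w ^ 4)"
  proof (rule AE_I2)
    fix w :: real
    have "\<bar>w\<bar> ^ k \<le> 1 + \<bar>w\<bar> ^ 4"
    proof (cases "\<bar>w\<bar> \<le> 1")
      case True
      then have "\<bar>w\<bar> ^ k \<le> 1" by (simp add: power_le_one)
      then show ?thesis by (simp add: add_increasing2)
    next
      case False
      then have "\<bar>w\<bar> ^ k \<le> \<bar>w\<bar> ^ 4" using assms(2) by (intro power_increasing) auto
      then show ?thesis by simp
    qed
    then show "norm (\<bar>w\<bar> ^ k) \<le> norm (1 + w ^ 4)" by simp
  qed
qed simp

lemma integrable_iexp_moment: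
  assumes "integrable M (\<lambda>w. w ^ 4)" "k \<le> 4"
  shows "integrable M (\<lambda>w. (\<i> * complex_of_real w) ^ k * iexp (\<xi> * w))"
  by (rule Bochner_Integration.integrable_bound[OF integrable_abs_power_le_4[OF assms]])
     (auto simp: norm_mult norm_power)

lemma iexp_moment_has_vector_derivative:
  assumes int: "integrable M (\<lambda>w. w ^ 4)" and k: "k \<le> 2"
  shows "(iexp_moment M k has_vector_derivative iexp_moment M (Suc k) \<xi>) (at \<xi>)"
proof -
  define K where "K = (\<integral>w. \<bar>w\<bar> ^ (k + 2) / 2 \<partial>M)"
  have bound: "norm (iexp_moment M k (\<xi> + h) - iexp_moment M k \<xi> - h *\<^sub>R iexp_moment M (Suc k) \<xi>) \<le> h\<^sup>2 * K" for h
  proof -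
    let ?f = "\<lambda>w. (\<i> * complex_of_real w) ^ k * iexp ((\<xi> + h) * w) - (\<i> * complex_of_real w) ^ k * iexp (\<xi> * w)
        - h *\<^sub>R ((\<i> * complex_of_real w) ^ Suc k * iexp (\<xi> * w))"
    have i1: "integrable M (\<lambda>w. (\<i> * complex_of_real w) ^ k * iexp (\<zeta> * w))" for \<zeta>
      using k by (intro integrable_iexp_moment int) auto
    have i2: "integrable M (\<lambda>w. (\<i> * complex_of_real w) ^ Suc k * iexp (\<zeta> * w))" for \<zeta>
      using k by (intro integrable_iexp_moment int) auto
    have "iexp_moment M k (\<xi> + h) - iexp_moment M k \<xi> - h *\<^sub>R iexp_moment M (Suc k) \<xi> = (\<integral>w. ?f w \<partial>M)"
      unfolding iexp_moment_def
      by (subst Bochner_Integration.integral_diff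
          [OF Bochner_Integration.integrable_diff[OF i1 i1] integrable_scaleR_right[OF i2]])
         (simp only: Bochner_Integration.integral_diff[OF i1 i1] integral_scaleR_right)
    also have "norm \<dots> \<le> (\<integral>w. h\<^sup>2 * (\<bar>w\<bar> ^ (k + 2) / 2) \<partial>M)"
    proof (rule Bochner_Integration.integral_norm_bound_integral)
      show "integrable M ?f"
        by (intro Bochner_Integration.integrable_diff i1 integrable_scaleR_right i2)
      show "integrable M (\<lambda>w. h\<^sup>2 * (\<bar>w\<bar> ^ (k + 2) / 2))"
        using k by (intro integrable_mult_right integrable_divide_zero integrable_abs_power_le_4 int) auto
      show "norm (?f w) \<le> h\<^sup>2 * (\<bar>w\<bar> ^ (k + 2) / 2)" for w
      proof -
        have "?f w = (\<i> * complex_of_real w) ^ k * iexp (\<xi> * w) * (iexp (h * w) - (1 + \<i> * complex_of_real (h * w)))"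
          by (simp add: algebra_simps exp_add scaleR_conv_of_real)
        moreover have "norm (iexp (h * w) - (1 + \<i> * complex_of_real (h * w))) \<le> (h * w)\<^sup>2 / 2"
          using iexp_approx1[of "h * w" 1] by (simp add: power2_eq_square)
        then have "\<bar>w\<bar> ^ k * norm (iexp (h * w) - (1 + \<i> * complex_of_real (h * w))) \<le> \<bar>w\<bar> ^ k * ((h * w)\<^sup>2 / 2)"
          by (rule mult_left_mono) simp
        ultimately have "norm (?f w) \<le> \<bar>w\<bar> ^ k * ((h * w)\<^sup>2 / 2)"
          by (simp only: norm_mult norm_power norm_ii norm_of_real norm_exp_i_times mult_1_left mult_1_right)
        also have "\<dots> = h\<^sup>2 * (\<bar>w\<bar> ^ (k + 2) / 2)" by (simp add: power_add power_mult_distrib power2_eq_square)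
        finally show ?thesis .
      qed
    qed
    also have "\<dots> = h\<^sup>2 * K" unfolding K_def by (rule integral_mult_right_zero)
    finally show ?thesis .
  qed
  have "((\<lambda>h. norm (iexp_moment M k (\<xi> + h) - iexp_moment M k \<xi> - h *\<^sub>R iexp_moment M (Suc k) \<xi>) / norm h) \<longlongrightarrow> 0) (at 0)"
  proof (rule tendsto_sandwich[of "\<lambda>_. 0" _ _ "\<lambda>h. \<bar>h\<bar> * K"])
    show "\<forall>\<^sub>F h in at 0. norm (iexp_moment M k (\<xi> + h) - iexp_moment M k \<xi> - h *\<^sub>R iexp_moment M (Suc k) \<xi>) / norm h \<le> \<bar>h\<bar> * K"
    proof (rule eventually_mono[OF eventually_at_ball'[of 1 0 UNIV]])
      fix h :: real assume "h \<in> ball 0 1 \<and> h \<noteq> 0 \<and> h \<in> UNIV"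
      then have h: "\<bar>h\<bar> > 0" by auto
      have "h\<^sup>2 * K = \<bar>h\<bar> * K * \<bar>h\<bar>" by (simp add: power2_eq_square)
      with bound[of h] show "norm (iexp_moment M k (\<xi> + h) - iexp_moment M k \<xi> - h *\<^sub>R iexp_moment M (Suc k) \<xi>) / norm h \<le> \<bar>h\<bar> * K"
        using h by (simp only: real_norm_def pos_divide_le_eq)
    qed simp
    show "((\<lambda>h. \<bar>h\<bar> * K) \<longlongrightarrow> 0) (at 0)"
      by (auto intro!: tendsto_eq_intros)
  qed auto
  then show ?thesis
    unfolding has_vector_derivative_def has_derivative_at by (simp add: bounded_linear_scaleR_left)
qed

text \<open>
  This replaces the division property in Wiener's theorem. Take \<psi> with Fourier transform
  (triangle)/\<chi>, where \<chi> is the characteristic function of the measure. By Fubini,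
  convolving \<psi> with the measure multiplies the transform by \<chi> and leaves the triangle, so
  no Fourier inversion is needed. Since \<chi>(-\<xi>) is conjugate to \<chi>(\<xi>), the integral
  over [-R, R] is twice the real part of the one over [0, R], and Re_half_ft_decay makes \<psi>
  integrable. The fourth moment guarantees that the second derivative of 1/\<chi> exists and is
  continuous.
\<close>

lemma Fejer_kernel_is_convolution:
  assumes R: "0 < R" and int: "integrable M (\<lambda>w. w ^ 4)" and nz: "\<And>\<xi>. char M \<xi> \<noteq> 0"
  obtains \<psi> where "integrable lborel \<psi>" "\<And>y. y \<noteq> 0 \<Longrightarrow> (\<integral>w. \<psi> (y - w) \<partial>M) = fejer R y"
proof -
  define \<tau> where "\<tau> \<xi> = complex_of_real (1 - \<xi> / R)" for \<xi>
  define \<chi>1 where "\<chi>1 = iexp_moment M 1"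
  define \<chi>2 where "\<chi>2 = iexp_moment M 2"
  define v where "v \<xi> = inverse (char M \<xi>)" for \<xi>
  define v1 where "v1 \<xi> = - (\<chi>1 \<xi> * (v \<xi> * v \<xi>))" for \<xi>
  define v2 where "v2 \<xi> = - (\<chi>2 \<xi> * (v \<xi> * v \<xi>) + \<chi>1 \<xi> * (v1 \<xi> * v \<xi> + v \<xi> * v1 \<xi>))" for \<xi>
  define q where "q \<xi> = \<tau> \<xi> * v \<xi>" for \<xi>
  define q1 where "q1 \<xi> = \<tau> \<xi> * v1 \<xi> + complex_of_real (- (1 / R)) * v \<xi>" for \<xi>
  define q2 where "q2 \<xi> = (\<tau> \<xi> * v2 \<xi> + complex_of_real (- (1 / R)) * v1 \<xi>) + complex_of_real (- (1 / R)) * v1 \<xi>" for \<xi>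
  have d0: "(char M has_vector_derivative \<chi>1 \<xi>) (at \<xi>)" for \<xi>
    using iexp_moment_has_vector_derivative[OF int, of 0 \<xi>] by (simp add: iexp_moment_0 \<chi>1_def)
  have d1: "(\<chi>1 has_vector_derivative \<chi>2 \<xi>) (at \<xi>)" for \<xi>
    using iexp_moment_has_vector_derivative[OF int, of 1 \<xi>] by (simp add: \<chi>1_def \<chi>2_def numeral_2_eq_2)
  have d2: "(\<chi>2 has_vector_derivative iexp_moment M 3 \<xi>) (at \<xi>)" for \<xi>
    using iexp_moment_has_vector_derivative[OF int, of 2 \<xi>] by (simp add: \<chi>2_def numeral_3_eq_3 numeral_2_eq_2)
  have dv: "(v has_vector_derivative v1 \<xi>) (at \<xi>)" for \<xi>
  proof -
    have "(inverse has_field_derivative - (inverse (char M \<xi>) * 1 * inverse (char M \<xi>))) (at (char M \<xi>))"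
      by (rule DERIV_inverse' [OF DERIV_ident nz])
    from field_vector_diff_chain_at[OF d0 this]
    show ?thesis by (simp add: v1_def v_def[abs_def] o_def mult_ac)
  qed
  have dv1: "(v1 has_vector_derivative v2 \<xi>) (at \<xi>)" for \<xi>
    unfolding v1_def[abs_def] v2_def
    by (rule derivative_eq_intros has_vector_derivative_mult d1 dv refl
        | simp add: v1_def algebra_simps)+
  have dt: "(\<tau> has_vector_derivative complex_of_real (- (1 / R))) (at \<xi>)" for \<xi>
    unfolding \<tau>_def[abs_def] by (rule has_vector_derivative_triangle)
  have dq: "(q has_vector_derivative q1 \<xi>) (at \<xi>)" for \<xi>
    unfolding q_def[abs_def] q1_def by (rule has_vector_derivative_mult[OF dt dv])
  have dq1: "(q1 has_vector_derivative q2 \<xi>) (at \<xi>)" for \<xi>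
    unfolding q1_def[abs_def] q2_def
    by (intro has_vector_derivative_add has_vector_derivative_mult[OF dt dv1] has_vector_derivative_mult_right dv)
  have cont: "continuous_on A f" if "\<And>\<xi>. (f has_vector_derivative f' \<xi>) (at \<xi>)" for f f' :: "real \<Rightarrow> complex" and A
    by (intro continuous_at_imp_continuous_on ballI has_vector_derivative_continuous[OF that])
  have cq: "continuous_on A q" for A by (rule cont[OF dq])
  have cq2: "continuous_on A q2" for A
    unfolding q2_def[abs_def] v2_def
    by (intro continuous_intros cont[OF dt] cont[OF dv] cont[OF dv1] cont[OF d1] cont[OF d2])
  have [measurable]: "q \<in> borel_measurable borel" by (rule borel_measurable_continuous_onI[OF cq])
  define \<psi> where "\<psi> x = 2 * Re (half_ft R q x)" for x
  have [measurable]: "half_ft R q \<in> borel_measurable borel"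
    unfolding half_ft_def[abs_def] by measurable
  have "Im (q 0) = 0"
    unfolding q_def \<tau>_def v_def by (simp add: char_def)
  then obtain C where C: "\<And>x. \<bar>Re (half_ft R q x)\<bar> \<le> C * inverse (1 + x\<^sup>2)"
    using Re_half_ft_decay[OF less_imp_le[OF R] dq dq1 cq2] R by (auto simp: q_def \<tau>_def)
  have "integrable lborel \<psi>"
  proof (rule Bochner_Integration.integrable_bound)
    show "integrable lborel (\<lambda>x::real. 2 * C * inverse (1 + x\<^sup>2))"
      by (intro integrable_mult_right integrable_inverse_1_plus_square_lborel)
    show "AE x in lborel. norm (\<psi> x) \<le> norm (2 * C * inverse (1 + x\<^sup>2))"
    proof (rule AE_I2)
      fix x show "norm (\<psi> x) \<le> norm (2 * C * inverse (1 + x\<^sup>2))"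
        using C[of x] abs_ge_self[of "2 * C * inverse (1 + x\<^sup>2)"] by (simp add: abs_mult \<psi>_def)
    qed
  qed (simp add: \<psi>_def[abs_def])
  moreover have "(\<integral>w. \<psi> (y - w) \<partial>M) = fejer R y" if y: "y \<noteq> 0" for y
  proof -
    interpret P: pair_sigma_finite M "lborel :: real measure" ..
    let ?f = "\<lambda>w \<xi>. indicator {0..R} \<xi> *\<^sub>R (q \<xi> * iexp (- ((y - w) * \<xi>)))"
    have norm_f: "norm (?f w \<xi>) = norm (?f 0 \<xi>)" for w \<xi> by (simp add: norm_mult)
    have f_int: "integrable (M \<Otimes>\<^sub>M lborel) (case_prod ?f)"
    proof (rule P.Fubini_integrable)
      show "case_prod ?f \<in> borel_measurable (M \<Otimes>\<^sub>M lborel)" by measurable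
      define c where "c = (\<integral>\<xi>. norm (?f 0 \<xi>) \<partial>lborel)"
      have "(\<integral>\<xi>. norm (?f w \<xi>) \<partial>lborel) = c" for w
        unfolding c_def by (intro Bochner_Integration.integral_cong refl norm_f)
      then show "integrable M (\<lambda>w. \<integral>\<xi>. norm (case (w, \<xi>) of (w, \<xi>) \<Rightarrow> ?f w \<xi>) \<partial>lborel)"
        by (simp only: prod.case) simp
      show "AE w in M. integrable lborel (\<lambda>\<xi>. case (w, \<xi>) of (w, \<xi>) \<Rightarrow> ?f w \<xi>)"
        unfolding prod.case by (intro AE_I2 integrable_half_ft cq)
    qed
    have "integrable M (\<lambda>w. half_ft R q (y - w))"
      using P.integrable_fst[OF f_int] unfolding half_ft_def .
    then have "(\<integral>w. \<psi> (y - w) \<partial>M) = 2 * Re (\<integral>w. half_ft R q (y - w) \<partial>M)"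
      unfolding \<psi>_def by simp
    also have "(\<integral>w. half_ft R q (y - w) \<partial>M) = (\<integral>\<xi>. \<integral>w. ?f w \<xi> \<partial>M \<partial>lborel)"
      unfolding half_ft_def by (rule P.Fubini_integral[OF f_int, symmetric])
    also have "\<dots> = half_ft R \<tau> y"
      unfolding half_ft_def
    proof (intro Bochner_Integration.integral_cong refl)
      fix \<xi> :: real
      have "?f w \<xi> = (indicator {0..R} \<xi> *\<^sub>R (q \<xi> * iexp (- (y * \<xi>)))) * iexp (\<xi> * w)" for w
      proof -
        have "iexp (- ((y - w) * \<xi>)) = iexp (- (y * \<xi>)) * iexp (\<xi> * w)"
          by (subst exp_add[symmetric]) (simp add: algebra_simps)
        then show ?thesis by (simp only: mult.assoc mult_scaleR_left)
      qed
      then have "(\<integral>w. ?f w \<xi> \<partial>M) = (\<integral>w. (indicator {0..R} \<xi> *\<^sub>R (q \<xi> * iexp (- (y * \<xi>)))) * iexp (\<xi> * w) \<partial>M)"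
        by (simp only:)
      also have "\<dots> = (indicator {0..R} \<xi> *\<^sub>R (q \<xi> * iexp (- (y * \<xi>)))) * char M \<xi>"
        unfolding char_def by (rule integral_mult_right_zero)
      also have "\<dots> = indicator {0..R} \<xi> *\<^sub>R (\<tau> \<xi> * iexp (- (y * \<xi>)))"
        using nz[of \<xi>] by (simp add: q_def v_def)
      finally show "(\<integral>w. ?f w \<xi> \<partial>M) = indicator {0..R} \<xi> *\<^sub>R (\<tau> \<xi> * iexp (- (y * \<xi>)))" .
    qed
    also have "2 * Re (half_ft R \<tau> y) = fejer R y"
      unfolding \<tau>_def by (rule fejer_eq_half_ft[OF R y, symmetric])
    finally show ?thesis .
  qed
  ultimately show thesis by (rule that)
qed

end



section \<open>A Tauberian theorem of Wiener and Pitt\<close>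

context finite_borel_measure
begin

lemma space_eq_UNIV: "space M = UNIV"
  using sets_eq_imp_space_eq[OF M_is_borel] by simp

lemma bounded_convolution_assoc:
  fixes \<psi> h :: "real \<Rightarrow> real"
  assumes \<psi>: "integrable lborel \<psi>" and h[measurable]: "h \<in> borel_measurable borel"
    and K: "\<And>x. \<bar>h x\<bar> \<le> K"
  shows "(\<integral>x. h (s - x) * (\<integral>w. \<psi> (x - w) \<partial>M) \<partial>lborel) = (\<integral>z. \<psi> z * (\<integral>w. h (s - z - w) \<partial>M) \<partial>lborel)"
proof -
  interpret P: pair_sigma_finite M "lborel :: real measure" ..
  have [measurable]: "\<psi> \<in> borel_measurable borel" using \<psi> by auto
  have int_w: "integrable lborel (\<lambda>x. \<psi> (x - w))" for w
    using lborel_integrable_real_affine[OF \<psi>, of 1 "- w"] by simp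
  have int_hw: "integrable lborel (\<lambda>x. g x * f x)" if "integrable lborel f" "g \<in> borel_measurable borel" "\<And>x. \<bar>g x\<bar> \<le> K" for f g :: "real \<Rightarrow> real"
  proof (rule Bochner_Integration.integrable_bound)
    show "integrable lborel (\<lambda>x. K * f x)" using that by simp
    show "AE x in lborel. norm (g x * f x) \<le> norm (K * f x)"
      using that(3) by (intro AE_I2) (simp add: abs_mult mult_right_mono order_trans[OF _ abs_ge_self])
  qed (use that in measurable)
  let ?f = "\<lambda>w x. h (s - x) * \<psi> (x - w)"
  have f: "integrable (M \<Otimes>\<^sub>M lborel) (case_prod ?f)"
  proof (rule P.Fubini_integrable)
    show "case_prod ?f \<in> borel_measurable (M \<Otimes>\<^sub>M lborel)" by measurable
    show "AE w in M. integrable lborel (\<lambda>x. case (w, x) of (w, x) \<Rightarrow> ?f w x)"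
      unfolding prod.case by (intro AE_I2 int_hw int_w) (use K in auto)
    show "integrable M (\<lambda>w. \<integral>x. norm (case (w, x) of (w, x) \<Rightarrow> ?f w x) \<partial>lborel)"
      unfolding prod.case
    proof (rule integrable_const_bound)
      show "AE w in M. norm (\<integral>x. norm (?f w x) \<partial>lborel) \<le> K * (\<integral>x. norm (\<psi> x) \<partial>lborel)"
      proof (rule AE_I2)
        fix w
        have "norm (\<integral>x. norm (?f w x) \<partial>lborel) \<le> (\<integral>x. K * norm (\<psi> (x - w)) \<partial>lborel)"
        proof (rule Bochner_Integration.integral_norm_bound_integral)
          show "integrable lborel (\<lambda>x. norm (?f w x))"
            by (intro integrable_norm int_hw int_w) (use K in auto)
          show "integrable lborel (\<lambda>x. K * norm (\<psi> (x - w)))"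
            by (intro integrable_mult_right integrable_norm int_w)
          show "norm (norm (?f w x)) \<le> K * norm (\<psi> (x - w))" for x
            using K[of "s - x"] by (simp add: abs_mult mult_right_mono)
        qed
        also have "\<dots> = K * (\<integral>x. norm (\<psi> (x - w)) \<partial>lborel)" by (rule integral_mult_right_zero)
        also have "(\<integral>x. norm (\<psi> (x - w)) \<partial>lborel) = (\<integral>x. norm (\<psi> x) \<partial>lborel)"
          using lborel_integral_real_affine[of 1 "\<lambda>x. norm (\<psi> x)" "- w"] by simp
        finally show "norm (\<integral>x. norm (?f w x) \<partial>lborel) \<le> K * (\<integral>x. norm (\<psi> x) \<partial>lborel)" .
      qed
    qed measurable
  qed
  let ?g = "\<lambda>w z. \<psi> z * h (s - z - w)"
  have g: "integrable (M \<Otimes>\<^sub>M lborel) (case_prod ?g)"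
  proof (rule P.Fubini_integrable)
    show "case_prod ?g \<in> borel_measurable (M \<Otimes>\<^sub>M lborel)" by measurable
    have int_g: "integrable lborel (?g w)" for w
      using int_hw[OF \<psi>, of "\<lambda>z. h (s - z - w)"] K by (simp add: mult.commute)
    show "AE w in M. integrable lborel (\<lambda>x. case (w, x) of (w, x) \<Rightarrow> ?g w x)"
      unfolding prod.case by (intro AE_I2 int_g)
    show "integrable M (\<lambda>w. \<integral>x. norm (case (w, x) of (w, x) \<Rightarrow> ?g w x) \<partial>lborel)"
      unfolding prod.case
    proof (rule integrable_const_bound)
      show "AE w in M. norm (\<integral>x. norm (?g w x) \<partial>lborel) \<le> (\<integral>x. K * norm (\<psi> x) \<partial>lborel)"
      proof (rule AE_I2, rule Bochner_Integration.integral_norm_bound_integral)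
        show "integrable lborel (\<lambda>x. norm (?g w x))" for w by (intro integrable_norm int_g)
        show "integrable lborel (\<lambda>x. K * norm (\<psi> x))" by (intro integrable_mult_right integrable_norm \<psi>)
        show "norm (norm (?g w x)) \<le> K * norm (\<psi> x)" for w x
          using mult_left_mono[OF K[of "s - x - w"] abs_ge_zero[of "\<psi> x"]] by (simp add: abs_mult mult.commute)
      qed
    qed measurable
  qed
  have "(\<integral>x. h (s - x) * (\<integral>w. \<psi> (x - w) \<partial>M) \<partial>lborel) = (\<integral>x. (\<integral>w. ?f w x \<partial>M) \<partial>lborel)"
    by simp
  also have "\<dots> = (\<integral>w. (\<integral>x. ?f w x \<partial>lborel) \<partial>M)" by (rule P.Fubini_integral[OF f])
  also have "\<dots> = (\<integral>w. (\<integral>z. ?g w z \<partial>lborel) \<partial>M)"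
  proof (rule Bochner_Integration.integral_cong[OF refl])
    fix w
    show "(\<integral>x. ?f w x \<partial>lborel) = (\<integral>z. ?g w z \<partial>lborel)"
      using lborel_integral_real_affine[of 1 "?f w" w] by (simp add: mult.commute algebra_simps)
  qed
  also have "\<dots> = (\<integral>z. (\<integral>w. ?g w z \<partial>M) \<partial>lborel)" by (rule P.Fubini_integral[OF g, symmetric])
  also have "\<dots> = (\<integral>z. \<psi> z * (\<integral>w. h (s - z - w) \<partial>M) \<partial>lborel)" by simp
  finally show ?thesis .
qed

text \<open>
  Average the convolution of h with the measure against \<psi>, where \<psi> convolved with the
  measure is the Fejer kernel: by associativity this is the Fejer average of h. The limit follows by
  dominated convergence, and its value from the same identity for the constant function h = 1.
\<close>

lemma Fejer_average_tendsto:
  fixes h :: "real \<Rightarrow> real"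
  assumes R: "0 < R" and int: "integrable M (\<lambda>w. w ^ 4)" and nz: "\<And>\<xi>. char M \<xi> \<noteq> 0"
    and h[measurable]: "h \<in> borel_measurable borel" and K: "\<And>x. \<bar>h x\<bar> \<le> K"
    and lim: "((\<lambda>s. \<integral>w. h (s - w) \<partial>M) \<longlongrightarrow> c) at_top"
  shows "((\<lambda>s. \<integral>x. h (s - x) * fejer R x \<partial>lborel) \<longlongrightarrow> c / measure M UNIV * integral\<^sup>L lborel (fejer R)) at_top"
proof -
  obtain \<psi> where \<psi>: "integrable lborel \<psi>" and conv: "\<And>y. y \<noteq> 0 \<Longrightarrow> (\<integral>w. \<psi> (y - w) \<partial>M) = fejer R y"
    using Fejer_kernel_is_convolution[OF R int nz] by blast
  have [measurable]: "\<psi> \<in> borel_measurable borel" using \<psi> by auto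
  have *: "(\<integral>x. g (s - x) * fejer R x \<partial>lborel) = (\<integral>z. \<psi> z * (\<integral>w. g (s - z - w) \<partial>M) \<partial>lborel)"
    if [measurable]: "g \<in> borel_measurable borel" and "\<And>x. \<bar>g x\<bar> \<le> K'" for g s K'
  proof -
    have "(\<integral>x. g (s - x) * fejer R x \<partial>lborel) = (\<integral>x. g (s - x) * (\<integral>w. \<psi> (x - w) \<partial>M) \<partial>lborel)"
      using AE_lborel_singleton[of 0]
      by (intro integral_cong_AE) (measurable, auto elim!: eventually_mono simp: conv)
    then show ?thesis using bounded_convolution_assoc[OF \<psi> that] by simp
  qed
  have mass: "measure M UNIV \<noteq> 0"
    using nz[of 0] by (simp add: char_def space_eq_UNIV)
  have "integral\<^sup>L lborel (fejer R) = measure M UNIV * integral\<^sup>L lborel \<psi>"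
    using *[of "\<lambda>_. 1" 1 0] by (simp add: space_eq_UNIV mult.commute)
  then have eq: "c / measure M UNIV * integral\<^sup>L lborel (fejer R) = (\<integral>z. \<psi> z * c \<partial>lborel)"
    using mass by simp
  have "((\<lambda>s. \<integral>z. \<psi> z * (\<integral>w. h (s - z - w) \<partial>M) \<partial>lborel) \<longlongrightarrow> (\<integral>z. \<psi> z * c \<partial>lborel)) at_top"
  proof (rule integral_dominated_convergence_at_top[where w="\<lambda>z. norm (\<psi> z) * (K * measure M UNIV)"])
    show "AE z in lborel. ((\<lambda>s. \<psi> z * (\<integral>w. h (s - z - w) \<partial>M)) \<longlongrightarrow> \<psi> z * c) at_top"
    proof (intro AE_I2 tendsto_mult tendsto_const)
      fix z :: real
      have "filterlim (\<lambda>s. s - z) at_top at_top"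
        using filterlim_tendsto_add_at_top[OF tendsto_const[of "- z"] filterlim_ident] by simp
      from filterlim_compose[OF lim this] show "((\<lambda>s. \<integral>w. h (s - z - w) \<partial>M) \<longlongrightarrow> c) at_top" .
    qed
    have "norm (\<integral>w. h (s - z - w) \<partial>M) \<le> (\<integral>w. K \<partial>M)" for s z
    proof (rule Bochner_Integration.integral_norm_bound_integral)
      show "integrable M (\<lambda>w. h (s - z - w))"
        using K by (intro integrable_const_bound[where B=K]) auto
    qed (use K in auto)
    then show "\<forall>\<^sub>F s in at_top. AE z in lborel. norm (\<psi> z * (\<integral>w. h (s - z - w) \<partial>M)) \<le> norm (\<psi> z) * (K * measure M UNIV)"
      by (intro always_eventually allI AE_I2) (simp add: abs_mult space_eq_UNIV mult_left_mono mult.commute)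
    show "integrable lborel (\<lambda>z. norm (\<psi> z) * (K * measure M UNIV))"
      using \<psi> by simp
  qed measurable
  then show ?thesis using *[OF h K] by (simp only: eq)
qed

text \<open>
  The averages of h over Fejer kernels of any width converge. The assumption slow bounds the growth
  of h to the right, so the value h(s) is controlled from above by the average around a point
  slightly to the left of s, whose window lies in [s - \<delta>, s], since h is at least h(s)/\<rho>
  on that window; and it is controlled from below by the average around a point slightly to the
  right of s.
\<close>

theorem Wiener_Pitt:
  fixes h :: "real \<Rightarrow> real"
  assumes int: "integrable M (\<lambda>w. w ^ 4)" and nz: "\<And>\<xi>. char M \<xi> \<noteq> 0"
    and h[measurable]: "h \<in> borel_measurable borel" and K: "\<And>x. 0 \<le> h x" "\<And>x. h x \<le> K"
    and slow: "\<And>\<rho>. 1 < \<rho> \<Longrightarrow> \<exists>\<delta>>0. \<forall>\<^sub>F s in at_top. \<forall>x\<in>{0..\<delta>}. h (s + x) \<le> \<rho> * h s"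
    and lim: "((\<lambda>s. \<integral>w. h (s - w) \<partial>M) \<longlongrightarrow> c) at_top"
  shows "(h \<longlongrightarrow> c / measure M UNIV) at_top"
proof -
  define L where "L = c / measure M UNIV"
  define I where "I = integral\<^sup>L lborel (fejer 1)"
  have I: "0 < I" unfolding I_def by (rule integral_fejer_pos) simp
  have "0 \<le> K" using K[of 0] by linarith
  have "\<bar>h x\<bar> \<le> K" for x using K[of x] by simp
  note avg = Fejer_average_tendsto[OF _ int nz h this lim]
  \<comment> \<open>Here \<rho> absorbs the variation of h within a window and \<eta> the relative mass of the
      kernel outside that window; both errors are sent to zero only at the very end.\<close>
  have main: "\<forall>\<^sub>F s in at_top. (1 - \<eta>) * h s \<le> \<rho> * (L + \<eta>) \<and> L - \<eta> \<le> \<rho> * h s + K * \<eta>"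
    if \<rho>: "1 < \<rho>" and \<eta>: "0 < \<eta>" "\<eta> < 1" for \<rho> \<eta>
  proof -
    obtain \<delta> where \<delta>: "0 < \<delta>" and ev: "\<forall>\<^sub>F s in at_top. \<forall>x\<in>{0..\<delta>}. h (s + x) \<le> \<rho> * h s"
      using slow[OF \<rho>] by blast
    define d where "d = \<delta> / 2"
    have d: "0 < d" using \<delta> by (simp add: d_def)
    define J where "J = (\<integral>x. inverse (1 + x\<^sup>2) \<partial>(lborel :: real measure))"
    have "0 \<le> J" unfolding J_def by (intro Bochner_Integration.integral_nonneg) (simp add: add_nonneg_nonneg)
    \<comment> \<open>The scale R is chosen so that the bound of fejer_tail, integrated over the line, is at most
        the fraction \<eta> of the total mass I.\<close>
    define R where "R = 4 * (1 + inverse (d\<^sup>2)) * (J + 1) / (\<eta> * I)"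
    have R: "0 < R" unfolding R_def using \<open>0 \<le> J\<close> I \<eta> d
      by (intro divide_pos_pos mult_pos_pos add_nonneg_pos) (auto intro: add_pos_nonneg)
    let ?\<phi> = "fejer R"
    have \<phi>: "integrable lborel ?\<phi>" by (rule integrable_fejer[OF R])
    have I_R: "integral\<^sup>L lborel ?\<phi> = I" unfolding I_def by (rule integral_fejer[OF R])
    have int_ind: "integrable lborel (\<lambda>x. indicator A x * ?\<phi> x)" if "A \<in> sets borel" for A :: "real set"
      using integrable_mult_indicator[OF _ \<phi>, of A] that by simp
    define T where "T = (\<integral>x. indicator (- {-d..d}) x * ?\<phi> x \<partial>lborel)"
    have T: "T \<le> \<eta> * I"
    proof -
      have "T \<le> (\<integral>x. 4 * (1 + inverse (d\<^sup>2)) / R * inverse (1 + x\<^sup>2) \<partial>lborel)"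
        unfolding T_def
      proof (rule Bochner_Integration.integral_mono)
        show "integrable lborel (\<lambda>x. indicator (- {-d..d}) x * ?\<phi> x)" by (rule int_ind) simp
        show "integrable lborel (\<lambda>x. 4 * (1 + inverse (d\<^sup>2)) / R * inverse (1 + x\<^sup>2))"
          by (intro integrable_mult_right integrable_inverse_1_plus_square_lborel)
        show "indicator (- {-d..d}) x * ?\<phi> x \<le> 4 * (1 + inverse (d\<^sup>2)) / R * inverse (1 + x\<^sup>2)" for x
        proof (cases "x \<in> {-d..d}")
          case True
          have "0 \<le> 4 * (1 + inverse (d\<^sup>2)) / R * inverse (1 + x\<^sup>2)"
            using R by (intro mult_nonneg_nonneg divide_nonneg_nonneg) (auto intro!: add_nonneg_nonneg)
          then show ?thesis using True by simp
        next
          case False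
          then have "d \<le> \<bar>x\<bar>" by auto
          then show ?thesis using fejer_tail[OF R d] False by simp
        qed
      qed
      also have "\<dots> = 4 * (1 + inverse (d\<^sup>2)) / R * J" unfolding J_def by (rule integral_mult_right_zero)
      also have "\<dots> = \<eta> * I * (J / (J + 1))"
        unfolding R_def using I \<eta> d \<open>0 \<le> J\<close> by (simp add: divide_simps add_nonneg_eq_0_iff)
      also have "\<dots> \<le> \<eta> * I * 1"
        using I \<eta> \<open>0 \<le> J\<close> by (intro mult_left_mono) auto
      finally show ?thesis by simp
    qed
    have split: "(\<integral>x. indicator {-d..d} x * ?\<phi> x \<partial>lborel) = I - T"
    proof -
      have "I = (\<integral>x. indicator {-d..d} x * ?\<phi> x + indicator (- {-d..d}) x * ?\<phi> x \<partial>lborel)"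
        unfolding I_R[symmetric] by (intro Bochner_Integration.integral_cong refl) (auto simp: indicator_def)
      also have "\<dots> = (\<integral>x. indicator {-d..d} x * ?\<phi> x \<partial>lborel) + T"
        unfolding T_def by (intro Bochner_Integration.integral_add int_ind) auto
      finally show ?thesis by simp
    qed
    have T0: "0 \<le> T" unfolding T_def
      by (intro Bochner_Integration.integral_nonneg) (use fejer_nonneg R in \<open>auto simp: indicator_def less_imp_le\<close>)
    define A where "A s = (\<integral>x. h (s - x) * ?\<phi> x \<partial>lborel)" for s
    have int_A: "integrable lborel (\<lambda>x. h (s - x) * ?\<phi> x)" for s
    proof (rule Bochner_Integration.integrable_bound[of lborel "\<lambda>x. K * ?\<phi> x"])
      show "AE x in lborel. norm (h (s - x) * ?\<phi> x) \<le> norm (K * ?\<phi> x)"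
        using K fejer_nonneg[of R] R by (intro AE_I2) (auto simp: abs_mult intro!: mult_right_mono order_trans[OF _ abs_ge_self])
    qed (use \<phi> in auto)
    have shift: "filterlim (\<lambda>s. s - d) at_top at_top" "filterlim (\<lambda>s. s + d) at_top at_top"
      using filterlim_tendsto_add_at_top[OF tendsto_const[of "- d"] filterlim_ident]
        filterlim_tendsto_add_at_top[OF tendsto_const[of "d"] filterlim_ident] by (simp_all add: add.commute)
    have "(A \<longlongrightarrow> L * I) at_top" unfolding A_def using avg[OF R] by (simp add: L_def I_R)
    then have A: "\<forall>\<^sub>F s in at_top. L * I - \<eta> * I < A s \<and> A s < L * I + \<eta> * I"
      using \<eta> I by (intro eventually_conj order_tendstoD) auto
    from A have A1: "\<forall>\<^sub>F s in at_top. A (s - d) < L * I + \<eta> * I"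
      using eventually_compose_filterlim[OF A shift(1)] by eventually_elim simp
    from A have A2: "\<forall>\<^sub>F s in at_top. L * I - \<eta> * I < A (s + d)"
      using eventually_compose_filterlim[OF A shift(2)] by eventually_elim simp
    obtain s0 where s0: "\<And>s x. s0 \<le> s \<Longrightarrow> x \<in> {0..\<delta>} \<Longrightarrow> h (s + x) \<le> \<rho> * h s"
      using ev unfolding eventually_at_top_linorder by blast
    show ?thesis
      using A1 A2 eventually_ge_at_top[of "s0 + \<delta>"]
    proof eventually_elim
      case (elim s)
      have "h s * (I - T) = (\<integral>x. h s * (indicator {-d..d} x * ?\<phi> x) \<partial>lborel)"
        unfolding split[symmetric] by simp
      also have "\<dots> \<le> (\<integral>x. \<rho> * (h (s - d - x) * ?\<phi> x) \<partial>lborel)"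
      proof (rule Bochner_Integration.integral_mono)
        show "integrable lborel (\<lambda>x. h s * (indicator {-d..d} x * ?\<phi> x))"
          by (intro integrable_mult_right int_ind) simp
        show "integrable lborel (\<lambda>x. \<rho> * (h (s - d - x) * ?\<phi> x))" by (intro integrable_mult_right int_A)
        show "h s * (indicator {-d..d} x * ?\<phi> x) \<le> \<rho> * (h (s - d - x) * ?\<phi> x)" for x
        proof (cases "x \<in> {-d..d}")
          case True
          then have "h ((s - d - x) + (d + x)) \<le> \<rho> * h (s - d - x)"
            using elim(3) by (intro s0) (auto simp: d_def)
          then have "h s * ?\<phi> x \<le> \<rho> * h (s - d - x) * ?\<phi> x"
            using fejer_nonneg[of R x] R by (intro mult_right_mono) auto
          then show ?thesis using True by (simp add: mult.assoc)
        next
          case False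
          then show ?thesis using K(1) \<rho> fejer_nonneg[of R x] R by simp
        qed
      qed
      also have "\<dots> = \<rho> * A (s - d)" unfolding A_def by (rule integral_mult_right_zero)
      also have "\<dots> \<le> \<rho> * (L * I + \<eta> * I)" using elim(1) \<rho> by (intro mult_left_mono) auto
      finally have "h s * (I - T) \<le> \<rho> * (L + \<eta>) * I" by (simp add: algebra_simps)
      moreover have "h s * ((1 - \<eta>) * I) \<le> h s * (I - T)"
        using T K(1) by (intro mult_left_mono) (auto simp: algebra_simps)
      ultimately have "((1 - \<eta>) * h s) * I \<le> (\<rho> * (L + \<eta>)) * I" by (simp add: algebra_simps)
      then have up: "(1 - \<eta>) * h s \<le> \<rho> * (L + \<eta>)" using I by (rule mult_right_le_imp_le)
      have "A (s + d) \<le> (\<integral>x. \<rho> * h s * (indicator {-d..d} x * ?\<phi> x) + K * (indicator (- {-d..d}) x * ?\<phi> x) \<partial>lborel)"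
        unfolding A_def
      proof (rule Bochner_Integration.integral_mono)
        show "integrable lborel (\<lambda>x. h (s + d - x) * ?\<phi> x)" by (rule int_A)
        show "integrable lborel (\<lambda>x. \<rho> * h s * (indicator {-d..d} x * ?\<phi> x) + K * (indicator (- {-d..d}) x * ?\<phi> x))"
          by (intro Bochner_Integration.integrable_add integrable_mult_right int_ind) auto
        show "h (s + d - x) * ?\<phi> x \<le> \<rho> * h s * (indicator {-d..d} x * ?\<phi> x) + K * (indicator (- {-d..d}) x * ?\<phi> x)" for x
        proof (cases "x \<in> {-d..d}")
          case True
          then have "h (s + (d - x)) \<le> \<rho> * h s"
            using elim(3) \<delta> by (intro s0) (auto simp: d_def)
          then have "h (s + d - x) * ?\<phi> x \<le> \<rho> * h s * ?\<phi> x"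
            using fejer_nonneg[of R x] R by (intro mult_right_mono) (auto simp: algebra_simps)
          then show ?thesis using True by simp
        next
          case False
          then show ?thesis using K(2) fejer_nonneg[of R x] R by (simp add: mult_right_mono)
        qed
      qed
      also have "\<dots> = \<rho> * h s * (I - T) + K * T"
        unfolding split[symmetric] unfolding T_def
        by (subst Bochner_Integration.integral_add) (auto intro!: int_ind)
      also have "\<dots> \<le> \<rho> * h s * I + K * (\<eta> * I)"
        using T0 T K(1) \<rho> \<open>0 \<le> K\<close> by (intro add_mono mult_left_mono) auto
      finally have "(L - \<eta>) * I \<le> (\<rho> * h s + K * \<eta>) * I"
        using elim(2) by (simp add: algebra_simps)
      then have "L - \<eta> \<le> \<rho> * h s + K * \<eta>" using I by (rule mult_right_le_imp_le)
      with up show ?case by blast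
    qed
  qed
  show ?thesis
    unfolding L_def[symmetric]
  proof (rule tendstoI)
    fix e :: real assume e: "0 < e"
    define B where "B = 2 * K + \<bar>L\<bar> + 4"
    define \<eta> where "\<eta> = min (1/2) (e / (2 * B))"
    have B: "4 \<le> B" using \<open>0 \<le> K\<close> by (simp add: B_def)
    have \<eta>: "0 < \<eta>" "\<eta> < 1" "\<eta> \<le> 1/2" using e B by (auto simp: \<eta>_def)
    have "\<eta> * B \<le> e / (2 * B) * B" unfolding \<eta>_def using B by (intro mult_right_mono) auto
    also have "\<dots> < e" using e B by (simp add: field_simps)
    finally have \<eta>B: "\<eta> * B < e" .
    have "1 < 1 + \<eta>" using \<eta> by simp
    from main[OF this \<eta>(1,2)] show "\<forall>\<^sub>F s in at_top. dist (h s) L < e"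
    proof (rule eventually_mono)
      fix s assume s: "(1 - \<eta>) * h s \<le> (1 + \<eta>) * (L + \<eta>) \<and> L - \<eta> \<le> (1 + \<eta>) * h s + K * \<eta>"
      have a: "\<eta> * h s \<le> \<eta> * K" "0 \<le> \<eta> * h s" "\<eta> * L \<le> \<eta> * \<bar>L\<bar>" "\<eta> * \<eta> \<le> \<eta> * 1"
        using \<eta> K[of s] by (auto intro: mult_left_mono)
      have b: "h s - L \<le> \<eta> * h s + \<eta> * L + \<eta> + \<eta> * \<eta>" "L - h s \<le> \<eta> + \<eta> * h s + \<eta> * K"
        using s by (simp_all add: algebra_simps)
      have "\<eta> * B = 2 * (\<eta> * K) + \<eta> * \<bar>L\<bar> + 4 * \<eta>" by (simp add: B_def algebra_simps)
      moreover have "0 \<le> \<eta> * \<bar>L\<bar>" "0 \<le> \<eta> * K" using \<eta> \<open>0 \<le> K\<close> by auto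
      ultimately have "\<bar>h s - L\<bar> < e" using a b \<eta>B \<eta>(1) by linarith
      then show "dist (h s) L < e" by (simp add: dist_real_def)
    qed
  qed
qed

end



section \<open>Regular variation and Potter's bound\<close>

lemma dyadic_bracket:
  assumes "1 \<le> (v::real)" shows "\<exists>n. 2 ^ n \<le> v \<and> v < 2 * 2 ^ n"
proof -
  obtain n where n: "v < 2 ^ n" using real_arch_pow[of 2 v] by auto
  define m where "m = (LEAST n. v < 2 ^ n)"
  have m: "v < 2 ^ m" unfolding m_def by (rule LeastI[of _ n]) (rule n)
  have "m \<noteq> 0"
  proof
    assume "m = 0" with m assms show False by simp
  qed
  then obtain k where k: "m = Suc k" using not0_implies_Suc by blast
  have "\<not> v < 2 ^ k" using not_less_Least[of k "\<lambda>n. v < 2 ^ n"] k m_def by simp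
  then show ?thesis using m k by (intro exI[of _ k]) auto
qed

text \<open>
  The properties of the tail of the infinite sum from which all estimates start.
\<close>

locale regularly_varying_decreasing =
  fixes G :: "real \<Rightarrow> real" and \<alpha> :: real
  assumes antimono: "x \<le> y \<Longrightarrow> G y \<le> G x"
    and pos: "0 < G x" and le_one: "G x \<le> 1"
    and ratio: "0 < u \<Longrightarrow> ((\<lambda>x. G (u * x) / G x) \<longlongrightarrow> u powr (- \<alpha>)) at_top"
begin

lemma G_measurable[measurable]: "G \<in> borel_measurable borel"
proof -
  have "(\<lambda>x. - G x) \<in> borel_measurable borel"
    by (rule borel_measurable_mono) (simp add: mono_def antimono)
  then show ?thesis by simp
qed

lemma ratio_div: "0 < v \<Longrightarrow> ((\<lambda>x. G (x / v) / G x) \<longlongrightarrow> v powr \<alpha>) at_top"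
  using ratio[of "inverse v"] by (simp add: divide_inverse mult.commute powr_minus inverse_powr)

text \<open>
  Regular variation at the single factor u = 2 is iterated along powers of 2, and monotonicity fills
  the gaps at the price of the constant C. Arguments x/v below the threshold x0 are covered as well:
  there v \<ge> x/x0, so that v^(\<alpha>+\<epsilon>) G(x) is already bounded below, whereas G \<le>
  1. Hence the bound holds for all weights v > 0 at once and can be integrated over a random v.
\<close>

theorem Potter_bound:
  assumes \<epsilon>: "0 < \<epsilon>" "\<epsilon> < \<alpha>"
  obtains C x0 where "0 < C" "0 < x0"
    "\<And>x v. x0 \<le> x \<Longrightarrow> 0 < v \<Longrightarrow> G (x / v) \<le> C * (v powr (\<alpha> + \<epsilon>) + v powr (\<alpha> - \<epsilon>)) * G x"
proof -
  define A where "A = (2::real) powr (- (\<alpha> + \<epsilon>))"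
  define B where "B = (2::real) powr (- (\<alpha> - \<epsilon>))"
  have AB: "0 < A" "0 < B" by (auto simp: A_def B_def)
  have "\<forall>\<^sub>F x in at_top. A < G (2 * x) / G x \<and> G (2 * x) / G x < B"
    by (intro eventually_conj order_tendstoD[OF ratio]) (use \<epsilon> in \<open>auto simp: A_def B_def\<close>)
  then have "\<forall>\<^sub>F x in at_top. A * G x \<le> G (2 * x) \<and> G (2 * x) \<le> B * G x"
    by (rule eventually_mono) (auto simp: field_simps pos less_imp_le)
  then obtain x1 where x1: "\<And>x. x1 \<le> x \<Longrightarrow> A * G x \<le> G (2 * x) \<and> G (2 * x) \<le> B * G x"
    unfolding eventually_at_top_linorder by blast
  define x0 where "x0 = max x1 1"
  have x0: "0 < x0" "1 \<le> x0" "x1 \<le> x0" by (auto simp: x0_def)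
  have iter: "A ^ n * G x \<le> G (2 ^ n * x) \<and> G (2 ^ n * x) \<le> B ^ n * G x" if x: "x0 \<le> x" for x n
  proof (induction n)
    case (Suc n)
    have "x \<le> 2 ^ n * x" using x x0 by simp
    then have "x1 \<le> 2 ^ n * x" using x x0 by linarith
    from x1[OF this] have s: "A * G (2 ^ n * x) \<le> G (2 * (2 ^ n * x))" "G (2 * (2 ^ n * x)) \<le> B * G (2 ^ n * x)"
      by auto
    have "A * (A ^ n * G x) \<le> A * G (2 ^ n * x)" "B * G (2 ^ n * x) \<le> B * (B ^ n * G x)"
      using Suc AB by (auto intro: mult_left_mono)
    with s show ?case by (simp add: mult.assoc)
  qed simp
  have up: "G y \<le> (2 * v) powr (\<alpha> + \<epsilon>) * G (v * y)" if y: "x0 \<le> y" and v: "1 \<le> v" for v y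
  proof -
    obtain n where n: "2 ^ n \<le> v" "v \<le> 2 * 2 ^ n" using dyadic_bracket[OF v] less_imp_le by blast
    have "v * y \<le> 2 ^ Suc n * y" using n y x0 by (intro mult_right_mono) auto
    then have "A ^ Suc n * G y \<le> G (v * y)"
      using iter[OF y, of "Suc n"] antimono by (meson order_trans)
    moreover have "A ^ Suc n = (2 ^ Suc n) powr (- (\<alpha> + \<epsilon>))"
      unfolding A_def by (simp add: powr_power powr_realpow[symmetric] powr_powr mult.commute del: power_Suc)
    moreover have "(2 * v) powr (- (\<alpha> + \<epsilon>)) \<le> (2 ^ Suc n) powr (- (\<alpha> + \<epsilon>))"
      using n \<epsilon> by (intro powr_mono2') auto
    ultimately have "(2 * v) powr (- (\<alpha> + \<epsilon>)) * G y \<le> G (v * y)"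
      using pos[of y] by (metis mult_right_mono less_imp_le order_trans)
    then have "(2 * v) powr (\<alpha> + \<epsilon>) * ((2 * v) powr (- (\<alpha> + \<epsilon>)) * G y) \<le> (2 * v) powr (\<alpha> + \<epsilon>) * G (v * y)"
      by (rule mult_left_mono) simp
    then show ?thesis using v by (simp only: powr_minus mult.assoc[symmetric]) simp
  qed
  have down: "G (u * x) \<le> (u / 2) powr (- (\<alpha> - \<epsilon>)) * G x" if x: "x0 \<le> x" and u: "1 \<le> u" for u x
  proof -
    obtain n where n: "2 ^ n \<le> u" "u \<le> 2 * 2 ^ n" using dyadic_bracket[OF u] less_imp_le by blast
    have "2 ^ n * x \<le> u * x" using n x x0 by (intro mult_right_mono) auto
    then have "G (u * x) \<le> B ^ n * G x"
      using iter[OF x, of n] antimono by (meson order_trans)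
    moreover have "B ^ n = (2 ^ n) powr (- (\<alpha> - \<epsilon>))"
      unfolding B_def by (simp add: powr_power powr_realpow[symmetric] powr_powr mult.commute)
    moreover have "(2 ^ n) powr (- (\<alpha> - \<epsilon>)) \<le> (u / 2) powr (- (\<alpha> - \<epsilon>))"
      using n \<epsilon> u by (intro powr_mono2') auto
    ultimately show ?thesis using pos[of x] by (metis mult_right_mono less_imp_le order_trans)
  qed
  define C where "C = 2 powr (\<alpha> + \<epsilon>) / G x0"
  have C: "0 < C" "2 powr (\<alpha> + \<epsilon>) \<le> C"
    using pos[of x0] le_one[of x0] by (auto simp: C_def field_simps)
  have bound: "G (x / v) \<le> C * (v powr (\<alpha> + \<epsilon>) + v powr (\<alpha> - \<epsilon>)) * G x" if x: "x0 \<le> x" and v: "0 < v" for x v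
  proof -
    have enough: ?thesis if "G (x / v) \<le> C * w * G x" "w \<le> v powr (\<alpha> + \<epsilon>) + v powr (\<alpha> - \<epsilon>)" for w
      using that(1) mult_right_mono[OF mult_left_mono[OF that(2) less_imp_le[OF C(1)]] less_imp_le[OF pos[of x]]]
      by linarith
    consider "v < 1" | "1 \<le> v" "x0 \<le> x / v" | "1 \<le> v" "x / v < x0" by linarith
    then show ?thesis
    proof cases
      case 1
      have "G (x / v) \<le> (1 / v / 2) powr (- (\<alpha> - \<epsilon>)) * G x"
        using down[OF x, of "1 / v"] 1 v by simp
      also have "(1 / v / 2) powr (- (\<alpha> - \<epsilon>)) = 2 powr (\<alpha> - \<epsilon>) * v powr (\<alpha> - \<epsilon>)"
      proof -
        have *: "1 / v / 2 = (2 * v) powr (- 1)"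
          using v by (simp add: powr_minus_divide)
        show ?thesis unfolding * powr_powr using v by (simp add: powr_mult)
      qed
      also have "\<dots> * G x \<le> C * v powr (\<alpha> - \<epsilon>) * G x"
      proof (intro mult_right_mono)
        have "(2::real) powr (\<alpha> - \<epsilon>) \<le> 2 powr (\<alpha> + \<epsilon>)" using \<epsilon> by (intro powr_mono) auto
        then show "2 powr (\<alpha> - \<epsilon>) \<le> C" using C by linarith
      qed (use pos[of x] in auto)
      finally show ?thesis by (rule enough) simp
    next
      case 2
      have "G (x / v) \<le> (2 * v) powr (\<alpha> + \<epsilon>) * G x" using up[OF 2(2,1)] v by simp
      also have "\<dots> = 2 powr (\<alpha> + \<epsilon>) * v powr (\<alpha> + \<epsilon>) * G x" using v by (simp add: powr_mult)
      also have "\<dots> \<le> C * v powr (\<alpha> + \<epsilon>) * G x" using C pos[of x] by (intro mult_right_mono) auto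
      finally show ?thesis by (rule enough) simp
    next
      case 3
      have "1 \<le> x / x0" "x / x0 \<le> v" using x x0 3 v by (auto simp: field_simps)
      have "G x0 \<le> (2 * (x / x0)) powr (\<alpha> + \<epsilon>) * G x"
        using up[OF order_refl \<open>1 \<le> x / x0\<close>] x0 by simp
      also have "\<dots> \<le> (2 * v) powr (\<alpha> + \<epsilon>) * G x"
        using \<open>x / x0 \<le> v\<close> \<open>1 \<le> x / x0\<close> \<epsilon> pos[of x] by (intro mult_right_mono powr_mono2) auto
      also have "\<dots> = 2 powr (\<alpha> + \<epsilon>) * v powr (\<alpha> + \<epsilon>) * G x" using v by (simp add: powr_mult)
      finally have "1 \<le> C * v powr (\<alpha> + \<epsilon>) * G x"
        using pos[of x0] by (simp add: C_def field_simps)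
      then have "G (x / v) \<le> C * v powr (\<alpha> + \<epsilon>) * G x" using le_one[of "x / v"] by linarith
      then show ?thesis by (rule enough) simp
    qed
  qed
  show thesis by (rule that[OF C(1) x0(1) bound])
qed

end

section \<open>Tails of products and of sums\<close>

definition tail_prob :: "'a measure \<Rightarrow> ('a \<Rightarrow> real) \<Rightarrow> real \<Rightarrow> real" where
  "tail_prob M Y x = \<P>(\<omega> in M. Y \<omega> > x)"

context prob_space
begin

lemma tail_prob_nonneg: "0 \<le> tail_prob M Y x"
  by (simp add: tail_prob_def)

lemma tail_prob_le_1: "tail_prob M Y x \<le> 1"
  by (simp add: tail_prob_def)

lemma tail_prob_antimono:
  assumes [measurable]: "Y \<in> borel_measurable M" and "x \<le> y"
  shows "tail_prob M Y y \<le> tail_prob M Y x"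
  unfolding tail_prob_def using assms(2) by (intro finite_measure_mono) auto

lemma tail_prob_measurable[measurable]:
  assumes "Y \<in> borel_measurable M" shows "tail_prob M Y \<in> borel_measurable borel"
proof -
  have "(\<lambda>x. - tail_prob M Y x) \<in> borel_measurable borel"
    by (rule borel_measurable_mono) (simp add: mono_def tail_prob_antimono[OF assms])
  then show ?thesis by simp
qed

lemma tail_prob_product:
  assumes ind: "indep_var borel V borel Y" and V: "AE \<omega> in M. 0 < V \<omega>"
  shows "tail_prob M (\<lambda>\<omega>. V \<omega> * Y \<omega>) x = (\<integral>\<omega>. tail_prob M Y (x / V \<omega>) \<partial>M)"
proof -
  have [measurable]: "V \<in> borel_measurable M" "Y \<in> borel_measurable M"
    using ind by (auto dest: indep_var_rv1 indep_var_rv2)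
  interpret DY: prob_space "distr M borel Y" by (rule prob_space_distr) simp
  define S where "S = {p::real \<times> real. fst p * snd p > x}"
  have "{p \<in> space (borel \<Otimes>\<^sub>M borel). fst p * snd p > x} \<in> sets (borel \<Otimes>\<^sub>M borel)" by measurable
  then have S[measurable]: "S \<in> sets (borel \<Otimes>\<^sub>M borel)" by (simp add: S_def space_pair_measure)
  have "emeasure M {\<omega> \<in> space M. V \<omega> * Y \<omega> > x} = emeasure (distr M (borel \<Otimes>\<^sub>M borel) (\<lambda>\<omega>. (V \<omega>, Y \<omega>))) S"
    by (subst emeasure_distr[OF _ S]) (simp, auto simp: S_def intro!: arg_cong[where f="emeasure M"])
  also have "\<dots> = emeasure (distr M borel V \<Otimes>\<^sub>M distr M borel Y) S"
    using ind by (simp add: indep_var_distribution_eq)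
  also have "\<dots> = (\<integral>\<^sup>+v. emeasure (distr M borel Y) (Pair v -` S) \<partial>distr M borel V)"
    using S by (intro DY.emeasure_pair_measure_alt) (simp cong: sets_pair_measure_cong)
  also have "\<dots> = (\<integral>\<^sup>+\<omega>. emeasure (distr M borel Y) (Pair (V \<omega>) -` S) \<partial>M)"
    by (rule nn_integral_distr) (auto intro!: DY.measurable_emeasure_Pair)
  also have "\<dots> = (\<integral>\<^sup>+\<omega>. ennreal (tail_prob M Y (x / V \<omega>)) \<partial>M)"
  proof (rule nn_integral_cong_AE)
    show "AE \<omega> in M. emeasure (distr M borel Y) (Pair (V \<omega>) -` S) = ennreal (tail_prob M Y (x / V \<omega>))"
      using V
    proof eventually_elim
      case (elim \<omega>)
      then have "Pair (V \<omega>) -` S = {y. y > x / V \<omega>}" by (auto simp: S_def field_simps)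
      then show ?case
        by (simp add: emeasure_distr tail_prob_def emeasure_eq_measure vimage_def Int_def conj_commute)
    qed
  qed
  also have "\<dots> = ennreal (\<integral>\<omega>. tail_prob M Y (x / V \<omega>) \<partial>M)"
    by (intro nn_integral_eq_integral integrable_const_bound[where B=1])
       (auto simp: tail_prob_nonneg tail_prob_le_1)
  finally show ?thesis
    by (simp add: tail_prob_def emeasure_eq_measure Bochner_Integration.integral_nonneg)
qed

end


locale regularly_varying_prob = prob_space M + regularly_varying_decreasing G \<alpha>
  for M :: "'a measure" and G \<alpha>
begin

lemma product_tail_le:
  assumes ind: "indep_var borel V borel Y" and V: "AE \<omega> in M. 0 < V \<omega>"
    and int: "integrable M (\<lambda>\<omega>. V \<omega> powr (\<alpha> + \<epsilon>) + V \<omega> powr (\<alpha> - \<epsilon>))"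
    and dom: "\<And>y. tail_prob M Y y \<le> K * G y" and "0 \<le> K"
    and Potter: "\<And>v. 0 < v \<Longrightarrow> G (x / v) \<le> C * (v powr (\<alpha> + \<epsilon>) + v powr (\<alpha> - \<epsilon>)) * G x"
  shows "tail_prob M (\<lambda>\<omega>. V \<omega> * Y \<omega>) x
    \<le> K * C * (\<integral>\<omega>. V \<omega> powr (\<alpha> + \<epsilon>) + V \<omega> powr (\<alpha> - \<epsilon>) \<partial>M) * G x"
proof -
  have [measurable]: "V \<in> borel_measurable M" "Y \<in> borel_measurable M"
    using ind by (auto dest: indep_var_rv1 indep_var_rv2)
  have "tail_prob M (\<lambda>\<omega>. V \<omega> * Y \<omega>) x = (\<integral>\<omega>. tail_prob M Y (x / V \<omega>) \<partial>M)"
    by (rule tail_prob_product[OF ind V])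
  also have "\<dots> \<le> (\<integral>\<omega>. (K * C * G x) * (V \<omega> powr (\<alpha> + \<epsilon>) + V \<omega> powr (\<alpha> - \<epsilon>)) \<partial>M)"
  proof (rule integral_mono_AE)
    show "integrable M (\<lambda>\<omega>. tail_prob M Y (x / V \<omega>))"
      by (intro integrable_const_bound[where B=1]) (auto simp: tail_prob_nonneg tail_prob_le_1)
    show "integrable M (\<lambda>\<omega>. (K * C * G x) * (V \<omega> powr (\<alpha> + \<epsilon>) + V \<omega> powr (\<alpha> - \<epsilon>)))"
      by (intro integrable_mult_right int)
    show "AE \<omega> in M. tail_prob M Y (x / V \<omega>) \<le> (K * C * G x) * (V \<omega> powr (\<alpha> + \<epsilon>) + V \<omega> powr (\<alpha> - \<epsilon>))"
      using V
    proof eventually_elim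
      case (elim \<omega>)
      have "tail_prob M Y (x / V \<omega>) \<le> K * G (x / V \<omega>)" by (rule dom)
      also have "\<dots> \<le> K * (C * (V \<omega> powr (\<alpha> + \<epsilon>) + V \<omega> powr (\<alpha> - \<epsilon>)) * G x)"
        by (intro mult_left_mono Potter elim \<open>0 \<le> K\<close>)
      finally show ?case by (simp add: mult_ac)
    qed
  qed
  also have "\<dots> = (K * C * G x) * (\<integral>\<omega>. V \<omega> powr (\<alpha> + \<epsilon>) + V \<omega> powr (\<alpha> - \<epsilon>) \<partial>M)"
    by (rule integral_mult_right_zero)
  finally show ?thesis by (simp add: mult_ac)
qed

text \<open>
  Conditioning on V turns the quotient into the mean of P[Y > x/V]/G(x), which tends to 0 pointwise
  and is dominated by Potter's bound.
\<close>

lemma product_tail_negligible: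
  assumes ind: "indep_var borel V borel Y" and V: "AE \<omega> in M. 0 < V \<omega>"
    and int: "integrable M (\<lambda>\<omega>. V \<omega> powr (\<alpha> + \<epsilon>) + V \<omega> powr (\<alpha> - \<epsilon>))"
    and dom: "\<And>y. tail_prob M Y y \<le> K * G y" and "0 \<le> K"
    and Potter: "\<And>x v. x0 \<le> x \<Longrightarrow> 0 < v \<Longrightarrow> G (x / v) \<le> C * (v powr (\<alpha> + \<epsilon>) + v powr (\<alpha> - \<epsilon>)) * G x"
    and small: "((\<lambda>y. tail_prob M Y y / G y) \<longlongrightarrow> 0) at_top"
  shows "((\<lambda>x. tail_prob M (\<lambda>\<omega>. V \<omega> * Y \<omega>) x / G x) \<longlongrightarrow> 0) at_top"
proof -
  have [measurable]: "V \<in> borel_measurable M" "Y \<in> borel_measurable M"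
    using ind by (auto dest: indep_var_rv1 indep_var_rv2)
  have "((\<lambda>x. \<integral>\<omega>. tail_prob M Y (x / V \<omega>) / G x \<partial>M) \<longlongrightarrow> (\<integral>\<omega>. 0 \<partial>M)) at_top"
  proof (rule integral_dominated_convergence_at_top
      [where w="\<lambda>\<omega>. K * C * (V \<omega> powr (\<alpha> + \<epsilon>) + V \<omega> powr (\<alpha> - \<epsilon>))"])
    show "integrable M (\<lambda>\<omega>. K * C * (V \<omega> powr (\<alpha> + \<epsilon>) + V \<omega> powr (\<alpha> - \<epsilon>)))"
      by (intro integrable_mult_right int)
    show "AE \<omega> in M. ((\<lambda>x. tail_prob M Y (x / V \<omega>) / G x) \<longlongrightarrow> 0) at_top"
      using V
    proof eventually_elim
      case (elim \<omega>)
      have lim: "filterlim (\<lambda>x. x / V \<omega>) at_top at_top"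
        using filterlim_tendsto_pos_mult_at_top[OF tendsto_const[of "inverse (V \<omega>)"] _ filterlim_ident] elim
        by (simp add: divide_inverse mult.commute)
      have "((\<lambda>x. (tail_prob M Y (x / V \<omega>) / G (x / V \<omega>)) * (G (x / V \<omega>) / G x)) \<longlongrightarrow> 0 * V \<omega> powr \<alpha>) at_top"
        by (intro tendsto_mult filterlim_compose[OF small lim] ratio_div elim)
      then show ?case using pos by (simp add: less_imp_neq[THEN not_sym])
    qed
    show "\<forall>\<^sub>F x in at_top. AE \<omega> in M. norm (tail_prob M Y (x / V \<omega>) / G x)
        \<le> K * C * (V \<omega> powr (\<alpha> + \<epsilon>) + V \<omega> powr (\<alpha> - \<epsilon>))"
      using eventually_ge_at_top[of x0]
    proof eventually_elim
      fix x assume x: "x0 \<le> x"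
      show "AE \<omega> in M. norm (tail_prob M Y (x / V \<omega>) / G x)
        \<le> K * C * (V \<omega> powr (\<alpha> + \<epsilon>) + V \<omega> powr (\<alpha> - \<epsilon>))"
        using V
      proof eventually_elim
        case (elim \<omega>)
        have "tail_prob M Y (x / V \<omega>) \<le> K * G (x / V \<omega>)" by (rule dom)
        also have "\<dots> \<le> K * (C * (V \<omega> powr (\<alpha> + \<epsilon>) + V \<omega> powr (\<alpha> - \<epsilon>)) * G x)"
          by (intro mult_left_mono Potter elim x \<open>0 \<le> K\<close>)
        finally have "tail_prob M Y (x / V \<omega>) / G x \<le> K * C * (V \<omega> powr (\<alpha> + \<epsilon>) + V \<omega> powr (\<alpha> - \<epsilon>))"
          using pos[of x] by (simp add: pos_divide_le_eq mult_ac)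
        then show ?case using pos[of x] tail_prob_nonneg[of Y] by simp
      qed
    qed
  qed measurable
  then show ?thesis using tail_prob_product[OF ind V] by simp
qed

end

context prob_space
begin

lemma tail_prob_AE_mono:
  assumes [measurable]: "Y \<in> borel_measurable M" "Z \<in> borel_measurable M"
    and "AE \<omega> in M. x < Y \<omega> \<longrightarrow> y < Z \<omega>"
  shows "tail_prob M Y x \<le> tail_prob M Z y"
  unfolding tail_prob_def using assms(3) by (intro finite_measure_mono_AE) auto

text \<open>
  Fatou's lemma: since the inequality in the event is strict, it holds for the approximations as
  soon as it holds in the limit. Used to pass from finite blocks of a series to its remainder.
\<close>

lemma tail_prob_le_of_AE_limit:
  fixes b :: real
  assumes [measurable]: "\<And>n. S n \<in> borel_measurable M" "W \<in> borel_measurable M"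
    and lim: "AE \<omega> in M. (\<lambda>n. S n \<omega>) \<longlonglongrightarrow> W \<omega>"
    and b: "\<And>n. tail_prob M (S n) x \<le> b"
  shows "tail_prob M W x \<le> b"
proof -
  have "0 \<le> b" using b[of 0] tail_prob_nonneg[of "S 0" x] by linarith
  have "ennreal (tail_prob M W x) = (\<integral>\<^sup>+\<omega>. indicator {\<omega>\<in>space M. W \<omega> > x} \<omega> \<partial>M)"
    by (simp add: tail_prob_def emeasure_eq_measure)
  also have "\<dots> \<le> (\<integral>\<^sup>+\<omega>. liminf (\<lambda>n. indicator {\<omega>\<in>space M. S n \<omega> > x} \<omega>) \<partial>M)"
  proof (rule nn_integral_mono_AE)
    show "AE \<omega> in M. indicator {\<omega>\<in>space M. W \<omega> > x} \<omega> \<le> (liminf (\<lambda>n. indicator {\<omega>\<in>space M. S n \<omega> > x} \<omega>) :: ennreal)"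
      using lim AE_space
    proof eventually_elim
      case (elim \<omega>)
      show ?case
      proof (cases "W \<omega> > x")
        case True
        from order_tendstoD(1)[OF elim(1) this] have "\<forall>\<^sub>F n in sequentially. 1 \<le> (indicator {\<omega>\<in>space M. S n \<omega> > x} \<omega> :: ennreal)"
          by eventually_elim (use elim in auto)
        then have "1 \<le> liminf (\<lambda>n. indicator {\<omega>\<in>space M. S n \<omega> > x} \<omega> :: ennreal)"
          by (rule Liminf_bounded)
        moreover have "indicator {\<omega>\<in>space M. W \<omega> > x} \<omega> = (1::ennreal)" using True elim(2) by simp
        ultimately show ?thesis by (simp only:)
      qed simp
    qed
  qed
  also have "\<dots> \<le> liminf (\<lambda>n. \<integral>\<^sup>+\<omega>. indicator {\<omega>\<in>space M. S n \<omega> > x} \<omega> \<partial>M)"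
    by (intro nn_integral_liminf) measurable
  also have "\<dots> = liminf (\<lambda>n. ennreal (tail_prob M (S n) x))"
    by (simp add: tail_prob_def emeasure_eq_measure)
  also have "\<dots> \<le> liminf (\<lambda>n. ennreal b)"
    using b by (intro Liminf_mono always_eventually allI ennreal_leI)
  also have "\<dots> = ennreal b" by (simp add: Liminf_const)
  finally show ?thesis using \<open>0 \<le> b\<close> by simp
qed

text \<open>
  A crude form of Karamata's theorem. On the event that t = min(Z/x, 1) lies between 2^(-k-1) and
  2^(-k), the variable t^p is at most 2^(-pk), while Z exceeds x/2^(k+1). The tail bound lets the
  probability of that event grow by a factor 2^\<beta> per step at most, and \<beta> < p makes the
  series converge.
\<close>

lemma truncated_moment_le:
  assumes [measurable]: "Z \<in> borel_measurable M" and Z: "AE \<omega> in M. 0 < Z \<omega>" and x: "0 < x"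
    and p: "0 < p" and \<beta>: "\<beta> < p" and D: "0 \<le> D"
    and tail: "\<And>k. tail_prob M Z (x / 2 ^ k) \<le> D * (2 powr \<beta>) ^ k"
  shows "(\<integral>\<omega>. min (Z \<omega> / x) 1 powr p \<partial>M) \<le> D * (2 powr \<beta> / (1 - 2 powr (\<beta> - p)))"
proof -
  have ratio: "\<bar>2 powr (\<beta> - p)\<bar> < (1::real)" using \<beta> powr_less_mono[of "\<beta> - p" 0 2] by simp
  define c where "c = D * (2 powr \<beta> / (1 - 2 powr (\<beta> - p)))"
  have c: "(\<lambda>k. D * 2 powr \<beta> * (2 powr (\<beta> - p)) ^ k) sums c"
    using sums_mult[OF geometric_sums[of "2 powr (\<beta> - p)"], of "D * 2 powr \<beta>"] ratio by (simp add: c_def)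
  have "0 \<le> c" using ratio D by (auto simp: c_def)
  define A where "A k = {\<omega>\<in>space M. Z \<omega> > x / 2 ^ Suc k}" for k
  have [measurable]: "A k \<in> sets M" for k unfolding A_def by measurable
  have "ennreal (\<integral>\<omega>. min (Z \<omega> / x) 1 powr p \<partial>M) = (\<integral>\<^sup>+\<omega>. ennreal (min (Z \<omega> / x) 1 powr p) \<partial>M)"
  proof (rule nn_integral_eq_integral[symmetric])
    show "integrable M (\<lambda>\<omega>. min (Z \<omega> / x) 1 powr p)"
    proof (rule integrable_const_bound[where B="1"])
      show "AE \<omega> in M. norm (min (Z \<omega> / x) 1 powr p) \<le> 1"
        using Z
      proof eventually_elim
        case (elim \<omega>)
        then have "0 < min (Z \<omega> / x) 1" using x by simp
        then show ?case using p by (simp only: real_norm_def abs_of_nonneg powr_ge_zero) (intro powr_le1, auto)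
      qed
    qed measurable
  qed simp
  also have "\<dots> \<le> (\<integral>\<^sup>+\<omega>. (\<Sum>k. ennreal ((2 powr (- p)) ^ k) * indicator (A k) \<omega>) \<partial>M)"
  proof (rule nn_integral_mono_AE)
    show "AE \<omega> in M. ennreal (min (Z \<omega> / x) 1 powr p) \<le> (\<Sum>k. ennreal ((2 powr (- p)) ^ k) * indicator (A k) \<omega>)"
      using Z AE_space
    proof eventually_elim
      case (elim \<omega>)
      define t where "t = min (Z \<omega> / x) 1"
      have t: "0 < t" "t \<le> 1" using elim x by (auto simp: t_def)
      then have "1 \<le> 1 / t" by simp
      then obtain n where n: "2 ^ n \<le> 1 / t" "1 / t < 2 * 2 ^ n" using dyadic_bracket by blast
      have "t \<le> 1 / 2 ^ n" "1 / 2 ^ Suc n < t" using n t by (auto simp: field_simps)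
      have "t powr p \<le> (1 / 2 ^ n) powr p"
        using t p \<open>t \<le> 1 / 2 ^ n\<close> by (intro powr_mono2) auto
      also have "\<dots> = (2 powr (- p)) ^ n"
      proof -
        have "1 / 2 ^ n = (2::real) powr (- real n)" by (simp add: powr_minus_divide powr_realpow)
        then show ?thesis
          by (simp only: powr_powr powr_realpow[symmetric] powr_gt_zero) (simp add: powr_powr mult.commute)
      qed
      finally have le: "t powr p \<le> (2 powr (- p)) ^ n" .
      have "x / 2 ^ Suc n < x * t"
        using mult_strict_left_mono[OF \<open>1 / 2 ^ Suc n < t\<close> x] by simp
      also have "\<dots> \<le> x * (Z \<omega> / x)" unfolding t_def using x by (intro mult_left_mono) auto
      finally have "\<omega> \<in> A n" using elim x by (simp add: A_def)
      with le have "ennreal (t powr p) \<le> ennreal ((2 powr (- p)) ^ n) * indicator (A n) \<omega>"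
        by (simp add: ennreal_leI)
      also have "\<dots> \<le> (\<Sum>k. ennreal ((2 powr (- p)) ^ k) * indicator (A k) \<omega>)"
      proof -
        define f where "f = (\<lambda>k. ennreal ((2 powr (- p)) ^ k) * indicator (A k) \<omega>)"
        have "(\<Sum>k\<in>{n}. f k) \<le> (\<Sum>k. f k)" by (rule sum_le_suminf) auto
        then have "f n \<le> (\<Sum>k. f k)" by simp
        then show ?thesis by (simp only: f_def)
      qed
      finally show ?case by (simp add: t_def)
    qed
  qed
  also have "\<dots> = (\<Sum>k. \<integral>\<^sup>+\<omega>. ennreal ((2 powr (- p)) ^ k) * indicator (A k) \<omega> \<partial>M)"
    by (rule nn_integral_suminf) measurable
  also have "\<dots> = (\<Sum>k. ennreal ((2 powr (- p)) ^ k * tail_prob M Z (x / 2 ^ Suc k)))"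
    by (simp add: nn_integral_cmult A_def tail_prob_def emeasure_eq_measure ennreal_mult)
  also have "\<dots> \<le> (\<Sum>k. ennreal (D * 2 powr \<beta> * (2 powr (\<beta> - p)) ^ k))"
  proof (intro suminf_le ennreal_leI allI)
    fix k
    have "(2 powr (- p)) ^ k * tail_prob M Z (x / 2 ^ Suc k) \<le> (2 powr (- p)) ^ k * (D * (2 powr \<beta>) ^ Suc k)"
      by (intro mult_left_mono tail) auto
    also have "\<dots> = D * 2 powr \<beta> * ((2 powr (- p)) * (2 powr \<beta>)) ^ k" by (simp add: power_mult_distrib)
    also have "2 powr (- p) * 2 powr \<beta> = (2::real) powr (\<beta> - p)" by (simp add: powr_add[symmetric])
    finally show "(2 powr (- p)) ^ k * tail_prob M Z (x / 2 ^ Suc k) \<le> D * 2 powr \<beta> * (2 powr (\<beta> - p)) ^ k" .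
  qed auto
  also have "\<dots> = ennreal c"
    using c D by (subst suminf_ennreal2) (auto simp: sums_iff)
  finally show ?thesis using \<open>0 \<le> c\<close> by (simp add: c_def)
qed

text \<open>
  If the sum of the Z_t exceeds x, then the sum of the truncated variables min(Z_t/x, 1) is at least
  1; this holds also when a single term exceeds x. Markov's inequality for the p-th power of that
  sum and Jensen's inequality with weights proportional to m_t then play the part of Minkowski's
  inequality. The bound depends on the index set only through the sum of the m_t, so it survives the
  passage to infinite series.
\<close>

lemma finite_sum_tail_le:
  fixes Z :: "nat \<Rightarrow> 'a \<Rightarrow> real"
  assumes S: "finite S" and [measurable]: "\<And>t. t \<in> S \<Longrightarrow> Z t \<in> borel_measurable M"
    and Z: "\<And>t. t \<in> S \<Longrightarrow> AE \<omega> in M. 0 < Z t \<omega>" and x: "0 < x" and p: "1 \<le> p"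
    and m: "\<And>t. t \<in> S \<Longrightarrow> 0 < m t"
    and moment: "\<And>t. t \<in> S \<Longrightarrow> (\<integral>\<omega>. min (Z t \<omega> / x) 1 powr p \<partial>M) \<le> m t powr p * B"
  shows "tail_prob M (\<lambda>\<omega>. \<Sum>t\<in>S. Z t \<omega>) x \<le> (\<Sum>t\<in>S. m t) powr p * B"
proof (cases "S = {}")
  case True
  then show ?thesis using x by (simp add: tail_prob_def not_less[symmetric])
next
  case False
  define s where "s = (\<Sum>t\<in>S. m t)"
  have s: "0 < s" unfolding s_def using S False m by (intro sum_pos) auto
  define T where "T t \<omega> = min (Z t \<omega> / x) 1" for t \<omega>
  have [measurable]: "T t \<in> borel_measurable M" if "t \<in> S" for t
    unfolding T_def[abs_def] using that by measurable
  have AE_Z: "AE \<omega> in M. \<forall>t\<in>S. 0 < Z t \<omega>" using S Z by (simp add: AE_finite_all)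
  have int_T: "integrable M (\<lambda>\<omega>. T t \<omega> powr p)" if t: "t \<in> S" for t
  proof (rule integrable_const_bound[where B="1"])
    show "AE \<omega> in M. norm (T t \<omega> powr p) \<le> 1"
      using AE_Z
    proof eventually_elim
      case (elim \<omega>)
      then have "0 < T t \<omega>" "T t \<omega> \<le> 1" using x t by (auto simp: T_def)
      then show ?case using p by (simp add: powr_le1)
    qed
  qed (use t in measurable)
  define U where "U \<omega> = (\<Sum>t\<in>S. m t / s * (s / m t) powr p * T t \<omega> powr p)" for \<omega>
  have int_U: "integrable M U"
    unfolding U_def[abs_def] by (intro Bochner_Integration.integrable_sum integrable_mult_right int_T)
  have "tail_prob M (\<lambda>\<omega>. \<Sum>t\<in>S. Z t \<omega>) x = (\<integral>\<omega>. indicator {\<omega>\<in>space M. (\<Sum>t\<in>S. Z t \<omega>) > x} \<omega> \<partial>M)"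
    by (simp add: tail_prob_def)
  also have "\<dots> \<le> (\<integral>\<omega>. U \<omega> \<partial>M)"
  proof (rule integral_mono_AE[OF _ int_U])
    show "integrable M (\<lambda>\<omega>. indicator {\<omega>\<in>space M. (\<Sum>t\<in>S. Z t \<omega>) > x} \<omega> :: real)"
      by (intro integrable_real_indicator) (auto simp: emeasure_eq_measure)
    show "AE \<omega> in M. indicator {\<omega>\<in>space M. (\<Sum>t\<in>S. Z t \<omega>) > x} \<omega> \<le> U \<omega>"
      using AE_Z
    proof eventually_elim
      case (elim \<omega>)
      have T: "0 < T t \<omega>" "T t \<omega> \<le> 1" if "t \<in> S" for t using elim that x by (auto simp: T_def)
      have U0: "0 \<le> U \<omega>" unfolding U_def using m s by (intro sum_nonneg mult_nonneg_nonneg) (auto simp: less_imp_le)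
      show ?case
      proof (cases "(\<Sum>t\<in>S. Z t \<omega>) > x")
        case True
        have "1 \<le> (\<Sum>t\<in>S. T t \<omega>)"
        proof (cases "\<exists>t\<in>S. 1 \<le> Z t \<omega> / x")
          case True
          then obtain t where t: "t \<in> S" "1 \<le> Z t \<omega> / x" by blast
          then have "1 = T t \<omega>" by (simp add: T_def)
          also have "\<dots> \<le> (\<Sum>t\<in>S. T t \<omega>)" using t S T by (intro member_le_sum) (auto simp: less_imp_le)
          finally show ?thesis .
        next
          case False
          then have "(\<Sum>t\<in>S. T t \<omega>) = (\<Sum>t\<in>S. Z t \<omega>) / x"
            unfolding sum_divide_distrib by (intro sum.cong refl) (auto simp: T_def)
          then show ?thesis using True x by simp
        qed
        then have "1 \<le> (\<Sum>t\<in>S. T t \<omega>) powr p" using p by (intro ge_one_powr_ge_zero) auto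
        also have "(\<Sum>t\<in>S. T t \<omega>) = (\<Sum>t\<in>S. (m t / s) *\<^sub>R (s / m t * T t \<omega>))"
          using m s by (intro sum.cong refl) (simp add: less_imp_neq[THEN not_sym])
        also have "\<dots> powr p \<le> (\<Sum>t\<in>S. m t / s * (s / m t * T t \<omega>) powr p)"
        proof (rule convex_on_sum[OF S False])
          show "convex_on {0<..} (\<lambda>x. x powr p)" by (rule powr_convex[OF p])
          show "(\<Sum>t\<in>S. m t / s) = 1" using s by (simp add: sum_divide_distrib[symmetric] s_def)
        qed (use m s T in \<open>auto simp: less_imp_le\<close>)
        also have "\<dots> = U \<omega>"
          unfolding U_def using m s T by (intro sum.cong refl) (simp add: powr_mult powr_divide less_imp_le)
        finally show ?thesis by (simp add: indicator_def)
      qed (use U0 in simp)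
    qed
  qed
  also have "(\<integral>\<omega>. U \<omega> \<partial>M) = (\<Sum>t\<in>S. m t / s * (s / m t) powr p * (\<integral>\<omega>. T t \<omega> powr p \<partial>M))"
    unfolding U_def using int_T by (subst Bochner_Integration.integral_sum) auto
  also have "\<dots> \<le> (\<Sum>t\<in>S. m t / s * (s / m t) powr p * (m t powr p * B))"
    using moment m s unfolding T_def by (intro sum_mono mult_left_mono) (auto simp: less_imp_le)
  also have "\<dots> = (\<Sum>t\<in>S. m t * (s powr p * B / s))"
    using m s by (intro sum.cong refl) (simp add: powr_divide less_imp_le less_imp_neq[THEN not_sym])
  also have "\<dots> = s powr p * B"
    unfolding sum_distrib_right[symmetric] s_def[symmetric] using s by simp
  finally show ?thesis by (simp add: s_def)
qed

end


section \<open>One big jump\<close>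

context prob_space
begin

lemma Bonferroni_lower:
  fixes A :: "nat \<Rightarrow> 'a set"
  assumes [measurable]: "\<And>t. A t \<in> sets M"
  shows "(\<Sum>t<n. prob (A t)) \<le> prob (\<Union>t<n. A t) + (\<Sum>t<n. \<Sum>s<t. prob (A s \<inter> A t))"
proof (induction n)
  case (Suc n)
  have "prob ((\<Union>t<n. A t) \<inter> A n) = prob (\<Union>s<n. A s \<inter> A n)"
    by (intro arg_cong[where f=prob]) auto
  also have "\<dots> \<le> (\<Sum>s<n. prob (A s \<inter> A n))"
    by (rule finite_measure_subadditive_finite) auto
  finally have "prob (\<Union>t<n. A t) + prob (A n) \<le> prob ((\<Union>t<n. A t) \<union> A n) + (\<Sum>s<n. prob (A s \<inter> A n))"
    by (subst measure_Un3) (auto simp: emeasure_eq_measure fmeasurable_def)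
  moreover have "(\<Union>t<n. A t) \<union> A n = (\<Union>t<Suc n. A t)" by (auto simp: less_Suc_eq)
  ultimately show ?case using Suc by simp
qed simp

text \<open>
  If no two terms exceed \<delta>x/n simultaneously, then all terms but one add up to at most
  \<delta>x; so a sum larger than (1 - \<delta>)x forces the remaining term above (1 - 2\<delta>)x.
\<close>

lemma finite_sum_large_split:
  fixes Z :: "nat \<Rightarrow> 'a \<Rightarrow> real"
  assumes [measurable]: "\<And>t. Z t \<in> borel_measurable M"
    and x: "0 < x" and \<delta>: "0 < \<delta>" and n: "0 < n"
  shows "tail_prob M (\<lambda>\<omega>. \<Sum>t<n. Z t \<omega>) ((1 - \<delta>) * x)
    \<le> (\<Sum>t<n. tail_prob M (Z t) ((1 - 2 * \<delta>) * x))
      + (\<Sum>t<n. \<Sum>s<t. prob {\<omega>\<in>space M. Z s \<omega> > \<delta> / n * x \<and> Z t \<omega> > \<delta> / n * x})"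
proof -
  define \<theta> where "\<theta> = \<delta> / n * x"
  define A where "A t = {\<omega>\<in>space M. Z t \<omega> > (1 - 2 * \<delta>) * x}" for t
  define B where "B s t = {\<omega>\<in>space M. Z s \<omega> > \<theta> \<and> Z t \<omega> > \<theta>}" for s t
  have [measurable]: "A t \<in> sets M" "B s t \<in> sets M" for s t unfolding A_def B_def by measurable
  have "{\<omega>\<in>space M. (\<Sum>t<n. Z t \<omega>) > (1 - \<delta>) * x} \<subseteq> (\<Union>t<n. A t) \<union> (\<Union>t<n. \<Union>s<t. B s t)"
  proof
    fix \<omega> assume \<omega>: "\<omega> \<in> {\<omega>\<in>space M. (\<Sum>t<n. Z t \<omega>) > (1 - \<delta>) * x}"
    show "\<omega> \<in> (\<Union>t<n. A t) \<union> (\<Union>t<n. \<Union>s<t. B s t)"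
    proof (rule ccontr)
      assume neg: "\<omega> \<notin> (\<Union>t<n. A t) \<union> (\<Union>t<n. \<Union>s<t. B s t)"
      have noA: "Z t \<omega> \<le> (1 - 2 * \<delta>) * x" if "t < n" for t
        using neg \<omega> that unfolding A_def by (auto simp: not_less)
      have noB: "\<not> (Z s \<omega> > \<theta> \<and> Z t \<omega> > \<theta>)" if "t < n" "s < t" for s t
        using neg \<omega> that unfolding B_def by auto
      have "\<exists>r<n. \<forall>t<n. t \<noteq> r \<longrightarrow> Z t \<omega> \<le> \<theta>"
      proof (cases "\<exists>r<n. Z r \<omega> > \<theta>")
        case True
        then obtain r where r: "r < n" "Z r \<omega> > \<theta>" by blast
        have "Z t \<omega> \<le> \<theta>" if "t < n" "t \<noteq> r" for t
          using noB[of r t] noB[of t r] that r by (metis linorder_neqE_nat not_less)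
        with r(1) show ?thesis by blast
      next
        case False
        then have "\<forall>t<n. Z t \<omega> \<le> \<theta>" by (meson not_less)
        then show ?thesis using n by blast
      qed
      then obtain r where r: "r < n" "\<And>t. t < n \<Longrightarrow> t \<noteq> r \<Longrightarrow> Z t \<omega> \<le> \<theta>" by blast
      have "(\<Sum>t<n. Z t \<omega>) = Z r \<omega> + (\<Sum>t\<in>{..<n} - {r}. Z t \<omega>)"
        using r(1) by (intro sum.remove) auto
      also have "\<dots> \<le> (1 - 2 * \<delta>) * x + (\<Sum>t\<in>{..<n} - {r}. \<theta>)"
        using r noA by (intro add_mono sum_mono) auto
      also have "(\<Sum>t\<in>{..<n} - {r}. \<theta>) \<le> (\<Sum>t<n. \<theta>)"
        using x \<delta> by (intro sum_mono2) (auto simp: \<theta>_def)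
      also have "(\<Sum>t<n. \<theta>) = n * \<theta>" by simp
      also have "n * \<theta> = \<delta> * x" using n by (simp add: \<theta>_def)
      finally have "(\<Sum>t<n. Z t \<omega>) \<le> (1 - \<delta>) * x" by (simp add: algebra_simps)
      with \<omega> show False by simp
    qed
  qed
  then have "tail_prob M (\<lambda>\<omega>. \<Sum>t<n. Z t \<omega>) ((1 - \<delta>) * x) \<le> prob ((\<Union>t<n. A t) \<union> (\<Union>t<n. \<Union>s<t. B s t))"
    unfolding tail_prob_def by (intro finite_measure_mono) auto
  also have "\<dots> \<le> prob (\<Union>t<n. A t) + prob (\<Union>t<n. \<Union>s<t. B s t)"
    by (rule measure_Un_le) auto
  also have "prob (\<Union>t<n. A t) \<le> (\<Sum>t<n. prob (A t))"
    by (rule finite_measure_subadditive_finite) auto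
  also have "prob (\<Union>t<n. \<Union>s<t. B s t) \<le> (\<Sum>t<n. prob (\<Union>s<t. B s t))"
    by (rule finite_measure_subadditive_finite) auto
  also have "\<dots> \<le> (\<Sum>t<n. \<Sum>s<t. prob (B s t))"
    by (intro sum_mono finite_measure_subadditive_finite) auto
  finally show ?thesis by (simp add: A_def B_def \<theta>_def tail_prob_def)
qed

end

context regularly_varying_prob
begin

text \<open>
  The lower bound for G comes from the Bonferroni inequality for the events that one of the first n
  terms exceeds x; the summable bounds b_t dispose of the other terms. For the upper bound, W > x
  forces either the first n terms to exceed (1 - \<delta>)x or the remainder to exceed \<delta>x;
  the former is split by finite_sum_large_split. The loss of the factor 1 - 2\<delta> in the
  argument is undone by regular variation of G, and \<delta> is sent to 0 at the end.
\<close>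

theorem single_big_jump:
  fixes Z :: "nat \<Rightarrow> 'a \<Rightarrow> real"
  assumes [measurable]: "\<And>t. Z t \<in> borel_measurable M" and W[measurable]: "W \<in> borel_measurable M"
    and Z: "\<And>t. AE \<omega> in M. 0 < Z t \<omega>"
    and W_sums: "AE \<omega> in M. (\<lambda>t. Z t \<omega>) sums W \<omega>"
    and G: "G = tail_prob M W"
    and pairs: "\<And>s t. s < t \<Longrightarrow> ((\<lambda>x. prob {\<omega>\<in>space M. Z s \<omega> > x \<and> Z t \<omega> > x} / G x) \<longlongrightarrow> 0) at_top"
    and b: "summable b" "\<And>x t. x1 \<le> x \<Longrightarrow> tail_prob M (Z t) x \<le> b t * G x"
    and tails: "\<And>\<eta>. 0 < \<eta> \<Longrightarrow> \<exists>n. \<forall>\<^sub>F x in at_top. tail_prob M (\<lambda>\<omega>. W \<omega> - (\<Sum>t<n. Z t \<omega>)) x \<le> \<eta> * G x"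
  shows "((\<lambda>x. (\<Sum>t. tail_prob M (Z t) x) / G x) \<longlongrightarrow> 1) at_top"
proof -
  define S where "S x = (\<Sum>t. tail_prob M (Z t) x)" for x
  define P where "P n x = (\<Sum>t<n. \<Sum>s<t. prob {\<omega>\<in>space M. Z s \<omega> > x \<and> Z t \<omega> > x})" for n x
  have P: "((\<lambda>x. P n x / G x) \<longlongrightarrow> 0) at_top" for n
    unfolding P_def sum_divide_distrib by (intro tendsto_null_sum pairs) auto
  have Sn: "summable (\<lambda>t. tail_prob M (Z t) x)" if "x1 \<le> x" for x
  proof (rule summable_comparison_test)
    show "summable (\<lambda>t. b t * G x)" by (intro summable_mult2 b)
  qed (use b(2)[OF that] in \<open>auto simp: tail_prob_nonneg\<close>)
  have upper: "\<forall>\<^sub>F x in at_top. S x / G x < r" if r: "1 < r" for r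
  proof -
    have "(\<lambda>n. \<Sum>t. b (t + n)) \<longlonglongrightarrow> 0" by (rule suminf_exist_split2[OF b(1)])
    then have "\<forall>\<^sub>F n in sequentially. (\<Sum>t. b (t + n)) < (r - 1) / 2"
      using r by (intro order_tendstoD) auto
    then obtain n where n: "(\<Sum>t. b (t + n)) < (r - 1) / 2" by (auto simp: eventually_sequentially)
    have "\<forall>\<^sub>F x in at_top. P n x / G x < (r - 1) / 2"
      using r by (intro order_tendstoD(2)[OF P]) auto
    with eventually_ge_at_top[of "max x1 0"] show ?thesis
    proof eventually_elim
      case (elim x)
      then have x: "x1 \<le> x" "0 \<le> x" by auto
      have "(\<Sum>t. tail_prob M (Z (t + n)) x) \<le> (\<Sum>t. b (t + n) * G x)"
        using b(2)[OF x(1)]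
        by (intro suminf_le summable_mult2 summable_ignore_initial_segment[OF Sn[OF x(1)]]
            summable_ignore_initial_segment[OF b(1)])
      also have "\<dots> = (\<Sum>t. b (t + n)) * G x"
        by (rule suminf_mult2[symmetric, OF summable_ignore_initial_segment[OF b(1)]])
      also have "\<dots> \<le> (r - 1) / 2 * G x" using n pos[of x] by (intro mult_right_mono) auto
      finally have 1: "(\<Sum>t. tail_prob M (Z (t + n)) x) \<le> (r - 1) / 2 * G x" .
      have "(\<Sum>t<n. tail_prob M (Z t) x)
          \<le> prob (\<Union>t<n. {\<omega>\<in>space M. Z t \<omega> > x}) + (\<Sum>t<n. \<Sum>s<t. prob ({\<omega>\<in>space M. Z s \<omega> > x} \<inter> {\<omega>\<in>space M. Z t \<omega> > x}))"
        unfolding tail_prob_def by (rule Bonferroni_lower) measurable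
      also have "(\<Sum>t<n. \<Sum>s<t. prob ({\<omega>\<in>space M. Z s \<omega> > x} \<inter> {\<omega>\<in>space M. Z t \<omega> > x})) = P n x"
        unfolding P_def by (intro sum.cong refl arg_cong[where f=prob]) auto
      also have "prob (\<Union>t<n. {\<omega>\<in>space M. Z t \<omega> > x}) \<le> G x"
        unfolding G tail_prob_def
      proof (rule finite_measure_mono_AE)
        have "AE \<omega> in M. \<forall>t. 0 < Z t \<omega>" using Z by (simp add: AE_all_countable)
        with W_sums show "AE \<omega> in M. \<omega> \<in> (\<Union>t<n. {\<omega>\<in>space M. Z t \<omega> > x}) \<longrightarrow> \<omega> \<in> {\<omega>\<in>space M. W \<omega> > x}"
        proof eventually_elim
          case (elim \<omega>)
          have "Z t \<omega> \<le> W \<omega>" for t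
            using sum_le_suminf[of "\<lambda>t. Z t \<omega>" "{t}"] elim by (auto simp: sums_iff less_imp_le)
          then show ?case by (auto intro: less_le_trans)
        qed
      qed measurable
      finally have 2: "(\<Sum>t<n. tail_prob M (Z t) x) \<le> G x + P n x" by simp
      have "S x = (\<Sum>t. tail_prob M (Z (t + n)) x) + (\<Sum>t<n. tail_prob M (Z t) x)"
        unfolding S_def by (rule suminf_split_initial_segment[OF Sn[OF x(1)]])
      also have "\<dots> \<le> (r - 1) / 2 * G x + (G x + P n x)" by (intro add_mono 1 2)
      also have "\<dots> < (r - 1) / 2 * G x + (G x + (r - 1) / 2 * G x)"
      proof -
        have "P n x < (r - 1) / 2 * G x" using elim pos[of x] by (simp only: pos_divide_less_eq)
        then show ?thesis by (intro add_strict_left_mono)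
      qed
      also have "\<dots> = r * G x" by (simp add: field_simps)
      finally show ?case using pos[of x] by (simp add: pos_divide_less_eq)
    qed
  qed
  have lower: "\<forall>\<^sub>F x in at_top. r < S x / G x" if r: "r < 1" for r
  proof -
    have "((\<lambda>\<delta>. (1 - \<delta>) * (1 - 2 * \<delta>) powr \<alpha>) \<longlongrightarrow> (1 - 0) * (1 - 2 * 0) powr \<alpha>) (at_right 0)"
      by (intro tendsto_intros) auto
    then have "\<forall>\<^sub>F \<delta> in at_right 0. r < (1 - \<delta>) * (1 - 2 * \<delta>) powr \<alpha>"
      using r by (intro order_tendstoD(1)) auto
    moreover have "\<forall>\<^sub>F \<delta> in at_right 0. \<delta> \<in> {0<..<1/2::real}" by (rule eventually_at_right_real) simp
    ultimately have "\<forall>\<^sub>F \<delta> in at_right (0::real). r < (1 - \<delta>) * (1 - 2 * \<delta>) powr \<alpha> \<and> \<delta> \<in> {0<..<1/2}"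
      by (rule eventually_conj)
    then obtain \<delta> where \<delta>': "r < (1 - \<delta>) * (1 - 2 * \<delta>) powr \<alpha>" "\<delta> \<in> {0<..<1/2}"
      using eventually_happens'[OF trivial_limit_at_right_real] by blast
    then have \<delta>: "0 < \<delta>" "\<delta> < 1/2" by auto
    define l where "l = 1 - 2 * \<delta>"
    have l: "0 < l" using \<delta> by (simp add: l_def)
    define \<eta> where "\<eta> = \<delta> powr \<alpha> * \<delta> / 4"
    have "0 < \<eta>" using \<delta> by (simp add: \<eta>_def)
    then obtain n0 where n0: "\<forall>\<^sub>F x in at_top. tail_prob M (\<lambda>\<omega>. W \<omega> - (\<Sum>t<n0. Z t \<omega>)) x \<le> \<eta> * G x"
      using tails by blast
    \<comment> \<open>One extra term guarantees that n is positive, as \<delta>/n requires.\<close>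
    define n where "n = Suc n0"
    have n: "0 < n" by (simp add: n_def)
    have scale: "filterlim (\<lambda>x. c * x) at_top at_top" if "0 < c" for c :: real
      using filterlim_tendsto_pos_mult_at_top[OF tendsto_const[of c] that filterlim_ident] by simp
    \<comment> \<open>The remainder is evaluated at \<delta>x rather than x, which costs the factor \<delta>^(-\<alpha>); the choice
        of \<eta> compensates for it.\<close>
    have "((\<lambda>x. \<eta> * (G (\<delta> * x) / G x)) \<longlongrightarrow> \<eta> * \<delta> powr (- \<alpha>)) at_top"
      by (intro tendsto_intros ratio \<delta>)
    moreover have "\<eta> * \<delta> powr (- \<alpha>) < \<delta> / 2"
      using \<delta> by (simp add: \<eta>_def powr_minus field_simps)
    ultimately have E1: "\<forall>\<^sub>F x in at_top. \<eta> * (G (\<delta> * x) / G x) < \<delta> / 2" by (rule order_tendstoD)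
    have E2: "\<forall>\<^sub>F x in at_top. tail_prob M (\<lambda>\<omega>. W \<omega> - (\<Sum>t<n0. Z t \<omega>)) (\<delta> * x) \<le> \<eta> * G (\<delta> * x)"
      by (rule eventually_compose_filterlim[OF n0 scale[OF \<delta>(1)]])
    have \<theta>: "0 < \<delta> / n" using \<delta> n by simp
    have "((\<lambda>x. (P n (\<delta> / n * x) / G (\<delta> / n * x)) * (G (\<delta> / n * x) / G x)) \<longlongrightarrow> 0 * (\<delta> / n) powr (- \<alpha>)) at_top"
      by (intro tendsto_mult filterlim_compose[OF P scale[OF \<theta>]] ratio \<theta>)
    then have "((\<lambda>x. P n (\<delta> / n * x) / G x) \<longlongrightarrow> 0) at_top"
      using pos by (simp add: less_imp_neq[THEN not_sym])
    then have E3: "\<forall>\<^sub>F x in at_top. P n (\<delta> / n * x) / G x < \<delta> / 2"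
      using \<delta> by (intro order_tendstoD) auto
    have E4: "\<forall>\<^sub>F x in at_top. x1 \<le> l * x"
      using scale[OF l] by (simp add: filterlim_at_top)
    have "\<forall>\<^sub>F x in at_top. (1 - \<delta>) * G x \<le> S (l * x)"
      using E1 E2 E3 E4 eventually_gt_at_top[of 0]
    proof eventually_elim
      case (elim x)
      have "G x \<le> prob ({\<omega>\<in>space M. (\<Sum>t<n. Z t \<omega>) > (1 - \<delta>) * x} \<union> {\<omega>\<in>space M. W \<omega> - (\<Sum>t<n0. Z t \<omega>) > \<delta> * x})"
        unfolding G tail_prob_def
      proof (rule finite_measure_mono_AE)
        show "AE \<omega> in M. \<omega> \<in> {\<omega>\<in>space M. W \<omega> > x} \<longrightarrow> \<omega> \<in> {\<omega>\<in>space M. (\<Sum>t<n. Z t \<omega>) > (1 - \<delta>) * x} \<union> {\<omega>\<in>space M. W \<omega> - (\<Sum>t<n0. Z t \<omega>) > \<delta> * x}"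
          using Z[of n0]
        proof eventually_elim
          case (elim \<omega>)
          have "x = (1 - \<delta>) * x + \<delta> * x" by (simp add: algebra_simps)
          moreover have "(\<Sum>t<n. Z t \<omega>) = (\<Sum>t<n0. Z t \<omega>) + Z n0 \<omega>" by (simp add: n_def)
          ultimately show ?case using elim by auto
        qed
      qed measurable
      also have "\<dots> \<le> tail_prob M (\<lambda>\<omega>. \<Sum>t<n. Z t \<omega>) ((1 - \<delta>) * x) + tail_prob M (\<lambda>\<omega>. W \<omega> - (\<Sum>t<n0. Z t \<omega>)) (\<delta> * x)"
        unfolding tail_prob_def by (rule measure_Un_le) measurable
      also have "tail_prob M (\<lambda>\<omega>. \<Sum>t<n. Z t \<omega>) ((1 - \<delta>) * x) \<le> (\<Sum>t<n. tail_prob M (Z t) (l * x)) + P n (\<delta> / n * x)"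
        unfolding P_def l_def by (rule finite_sum_large_split) (use elim \<delta> n in auto)
      also have "(\<Sum>t<n. tail_prob M (Z t) (l * x)) \<le> S (l * x)"
        unfolding S_def by (rule sum_le_suminf[OF Sn]) (use elim in \<open>auto simp: tail_prob_nonneg\<close>)
      also have "P n (\<delta> / n * x) \<le> \<delta> / 2 * G x"
        using elim(3) pos[of x] by (simp add: pos_divide_less_eq less_imp_le)
      also have "tail_prob M (\<lambda>\<omega>. W \<omega> - (\<Sum>t<n0. Z t \<omega>)) (\<delta> * x) \<le> \<delta> / 2 * G x"
        using elim(1,2) pos[of x] by (simp add: pos_divide_less_eq)
      finally show ?case by (simp add: algebra_simps)
    qed
    then have E5: "\<forall>\<^sub>F y in at_top. (1 - \<delta>) * G (inverse l * y) \<le> S (l * (inverse l * y))"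
      using l by (intro eventually_compose_filterlim[OF _ scale]) auto
    have "((\<lambda>y. (1 - \<delta>) * (G (inverse l * y) / G y)) \<longlongrightarrow> (1 - \<delta>) * inverse l powr (- \<alpha>)) at_top"
      using l by (intro tendsto_intros ratio) auto
    moreover have "r < (1 - \<delta>) * inverse l powr (- \<alpha>)"
      using \<delta>' l by (simp add: l_def[symmetric] powr_minus inverse_powr)
    ultimately have "\<forall>\<^sub>F y in at_top. r < (1 - \<delta>) * (G (inverse l * y) / G y)" by (rule order_tendstoD)
    with E5 show ?thesis
    proof eventually_elim
      case (elim y)
      have "(1 - \<delta>) * (G (inverse l * y) / G y) \<le> S y / G y"
      proof -
        have "l * (inverse l * y) = y" using l by simp
        from elim(1)[unfolded this] show ?thesis
          using divide_right_mono[OF _ less_imp_le[OF pos[of y]]] by fastforce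
      qed
      with elim(2) show ?case by linarith
    qed
  qed
  show ?thesis
    unfolding S_def[symmetric] by (rule order_tendstoI) (auto intro: upper lower)
qed

end


section \<open>The mixing measure of the weights\<close>

text \<open>
  The measure \<kappa> that gives a Borel set B the mass of the sum over t of E[V_t^\<alpha>; ln V_t
  \<in> B]. It is built as an image of a measure on pairs (t, \<omega>), so that sums over t and
  expectations together become single integrals.
\<close>

definition log_mixture :: "'a measure \<Rightarrow> real \<Rightarrow> (nat \<Rightarrow> 'a \<Rightarrow> real) \<Rightarrow> real measure" where
  "log_mixture M \<alpha> V = distr (density (count_space UNIV \<Otimes>\<^sub>M M) (\<lambda>(t, \<omega>). ennreal (V t \<omega> powr \<alpha>)))
     borel (\<lambda>(t, \<omega>). ln (V t \<omega>))"

text \<open>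
  The principal power function jumps across the negative real axis, but restricted to the real line
  it is given by an elementary formula on each side of 0.
\<close>

lemma borel_measurable_of_real_powr [measurable]:
  "(\<lambda>x. complex_of_real x powr c) \<in> borel_measurable borel"
proof -
  have "(\<lambda>x. complex_of_real x powr c) =
      (\<lambda>x. if x = 0 then 0 else exp (c * (complex_of_real (ln \<bar>x\<bar>) + (if x < 0 then \<i> * complex_of_real pi else 0))))"
  proof
    fix x :: real
    show "complex_of_real x powr c = (if x = 0 then 0 else exp (c * (complex_of_real (ln \<bar>x\<bar>) + (if x < 0 then \<i> * complex_of_real pi else 0))))"
    proof (cases x "0 :: real" rule: linorder_cases)
      case less
      then have "Ln (complex_of_real x) = complex_of_real (ln \<bar>x\<bar>) + \<i> * complex_of_real pi"
        using Ln_minus[of "complex_of_real (- x)"] Ln_of_real[of "- x"] by simp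
      with less show ?thesis by (simp add: powr_def)
    next
      case greater
      then show ?thesis by (simp add: powr_def Ln_of_real)
    qed simp
  qed
  also have "\<dots> \<in> borel_measurable borel" by measurable
  finally show ?thesis .
qed

context prob_space
begin

lemma measurable_case_prod_count_space:
  assumes "\<And>t. f t \<in> borel_measurable M"
  shows "case_prod f \<in> borel_measurable (count_space (UNIV :: nat set) \<Otimes>\<^sub>M M)"
  using assms by (intro measurable_pair_measure_countable1) auto

lemma nn_integral_log_mixture:
  fixes V :: "nat \<Rightarrow> 'a \<Rightarrow> real"
  assumes V[measurable]: "\<And>t. V t \<in> borel_measurable M" and [measurable]: "g \<in> borel_measurable borel"
  shows "(\<integral>\<^sup>+w. g w \<partial>log_mixture M \<alpha> V) = (\<Sum>t. \<integral>\<^sup>+\<omega>. ennreal (V t \<omega> powr \<alpha>) * g (ln (V t \<omega>)) \<partial>M)"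
proof -
  interpret N: pair_sigma_finite "count_space (UNIV :: nat set)" M
    by (intro pair_sigma_finite.intro sigma_finite_measure_count_space sigma_finite_measure_axioms)
  have [measurable]: "case_prod V \<in> borel_measurable (count_space (UNIV :: nat set) \<Otimes>\<^sub>M M)"
    by (rule measurable_case_prod_count_space) measurable
  have *: "(\<lambda>(t, \<omega>). f (V t \<omega>)) = (\<lambda>z. f (case_prod V z))" for f :: "real \<Rightarrow> 'c" by auto
  have [measurable]: "(\<lambda>(t, \<omega>). ln (V t \<omega>)) \<in> borel_measurable (count_space (UNIV :: nat set) \<Otimes>\<^sub>M M)"
    "(\<lambda>(t, \<omega>). ennreal (V t \<omega> powr \<alpha>)) \<in> borel_measurable (count_space (UNIV :: nat set) \<Otimes>\<^sub>M M)"
    unfolding * by measurable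
  have "(\<integral>\<^sup>+w. g w \<partial>log_mixture M \<alpha> V) = (\<integral>\<^sup>+z. (case z of (t, \<omega>) \<Rightarrow> ennreal (V t \<omega> powr \<alpha>)) * g (case z of (t, \<omega>) \<Rightarrow> ln (V t \<omega>)) \<partial>(count_space UNIV \<Otimes>\<^sub>M M))"
    unfolding log_mixture_def by (simp add: nn_integral_distr nn_integral_density)
  also have "\<dots> = (\<integral>\<^sup>+t. \<integral>\<^sup>+\<omega>. ennreal (V t \<omega> powr \<alpha>) * g (ln (V t \<omega>)) \<partial>M \<partial>count_space UNIV)"
    by (subst nn_integral_fst[symmetric]) (auto simp: split_beta)
  finally show ?thesis by (simp add: nn_integral_count_space_nat)
qed

lemma sums_integral_log_mixture:
  fixes V :: "nat \<Rightarrow> 'a \<Rightarrow> real" and g :: "real \<Rightarrow> 'b::{banach, second_countable_topology}"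
  assumes V[measurable]: "\<And>t. V t \<in> borel_measurable M" and g: "integrable (log_mixture M \<alpha> V) g"
  shows "(\<lambda>t. \<integral>\<omega>. V t \<omega> powr \<alpha> *\<^sub>R g (ln (V t \<omega>)) \<partial>M) sums (\<integral>w. g w \<partial>log_mixture M \<alpha> V)"
proof -
  interpret N: pair_sigma_finite "count_space (UNIV :: nat set)" M
    by (intro pair_sigma_finite.intro sigma_finite_measure_count_space sigma_finite_measure_axioms)
  let ?N = "count_space (UNIV :: nat set) \<Otimes>\<^sub>M M"
  have [measurable]: "case_prod V \<in> borel_measurable ?N"
    by (rule measurable_case_prod_count_space) measurable
  have *: "(\<lambda>(t, \<omega>). f (V t \<omega>)) = (\<lambda>z. f (case_prod V z))" for f :: "real \<Rightarrow> 'c" by auto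
  have L[measurable]: "(\<lambda>(t, \<omega>). ln (V t \<omega>)) \<in> borel_measurable ?N"
    and D[measurable]: "(\<lambda>(t, \<omega>). V t \<omega> powr \<alpha>) \<in> borel_measurable ?N"
    unfolding * by measurable
  have dens: "(\<lambda>(t, \<omega>). ennreal (V t \<omega> powr \<alpha>)) = (\<lambda>z. ennreal (case z of (t, \<omega>) \<Rightarrow> V t \<omega> powr \<alpha>))"
    by auto
  have [measurable]: "g \<in> borel_measurable borel"
    using borel_measurable_integrable[OF g] by (simp add: log_mixture_def)
  define f where "f = (\<lambda>(t, \<omega>). V t \<omega> powr \<alpha> *\<^sub>R g (ln (V t \<omega>)))"
  have f: "f = (\<lambda>z. (case z of (t, \<omega>) \<Rightarrow> V t \<omega> powr \<alpha>) *\<^sub>R g (case z of (t, \<omega>) \<Rightarrow> ln (V t \<omega>)))"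
    by (auto simp: f_def)
  have nonneg: "AE z in ?N. 0 \<le> (case z of (t, \<omega>) \<Rightarrow> V t \<omega> powr \<alpha>)" by (auto split: prod.split)
  have int: "integrable ?N f"
    using g unfolding log_mixture_def dens f
    by (simp add: integrable_distr_eq integrable_density[OF _ D nonneg])
  have "(\<integral>w. g w \<partial>log_mixture M \<alpha> V) = integral\<^sup>L ?N f"
    unfolding log_mixture_def dens f
    by (simp add: integral_distr integral_density[OF _ D nonneg])
  also have "\<dots> = (\<integral>t. (\<integral>\<omega>. f (t, \<omega>) \<partial>M) \<partial>count_space UNIV)"
    by (rule N.integral_fst'[OF int, symmetric])
  finally show ?thesis
    using sums_integral_count_space_nat[OF N.integrable_fst'[OF int]] by (simp add: f_def)
qed

text \<open>
  The factor V_t^\<alpha> in the density shifts the exponents: exp(\<plusminus>\<epsilon>w)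
  integrates to the sum over t of the moments of order \<alpha>\<plusminus>\<epsilon>.
\<close>

lemma integrable_log_mixture:
  fixes V :: "nat \<Rightarrow> 'a \<Rightarrow> real" and g :: "real \<Rightarrow> 'b::{banach, second_countable_topology}"
  assumes V[measurable]: "\<And>t. V t \<in> borel_measurable M" and pos: "\<And>t. AE \<omega> in M. 0 < V t \<omega>"
    and int: "\<And>t. integrable M (\<lambda>\<omega>. V t \<omega> powr (\<alpha> + \<epsilon>) + V t \<omega> powr (\<alpha> - \<epsilon>))"
    and sum: "summable (\<lambda>t. \<integral>\<omega>. V t \<omega> powr (\<alpha> + \<epsilon>) + V t \<omega> powr (\<alpha> - \<epsilon>) \<partial>M)"
    and g[measurable]: "g \<in> borel_measurable borel"
    and bound: "\<And>w. norm (g w) \<le> B * (exp (\<epsilon> * w) + exp (- (\<epsilon> * w)))"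
  shows "integrable (log_mixture M \<alpha> V) g"
proof (rule integrableI_bounded)
  show "g \<in> borel_measurable (log_mixture M \<alpha> V)" by (simp add: log_mixture_def)
  let ?a = "\<lambda>t. \<integral>\<omega>. V t \<omega> powr (\<alpha> + \<epsilon>) + V t \<omega> powr (\<alpha> - \<epsilon>) \<partial>M"
  have "0 \<le> B" using order_trans[OF norm_ge_zero bound[of 0]] by simp
  have "(\<integral>\<^sup>+w. ennreal (norm (g w)) \<partial>log_mixture M \<alpha> V) = (\<Sum>t. \<integral>\<^sup>+\<omega>. ennreal (V t \<omega> powr \<alpha>) * ennreal (norm (g (ln (V t \<omega>)))) \<partial>M)"
    by (rule nn_integral_log_mixture) measurable
  also have "\<dots> \<le> (\<Sum>t. ennreal (B * ?a t))"
  proof (intro suminf_le allI)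
    fix t
    have "(\<integral>\<^sup>+\<omega>. ennreal (V t \<omega> powr \<alpha>) * ennreal (norm (g (ln (V t \<omega>)))) \<partial>M)
      \<le> (\<integral>\<^sup>+\<omega>. ennreal (B * (V t \<omega> powr (\<alpha> + \<epsilon>) + V t \<omega> powr (\<alpha> - \<epsilon>))) \<partial>M)"
    proof (rule nn_integral_mono_AE)
      show "AE \<omega> in M. ennreal (V t \<omega> powr \<alpha>) * ennreal (norm (g (ln (V t \<omega>))))
          \<le> ennreal (B * (V t \<omega> powr (\<alpha> + \<epsilon>) + V t \<omega> powr (\<alpha> - \<epsilon>)))"
        using pos[of t]
      proof eventually_elim
        case (elim \<omega>)
        have "V t \<omega> powr \<alpha> * norm (g (ln (V t \<omega>))) \<le> V t \<omega> powr \<alpha> * (B * (exp (\<epsilon> * ln (V t \<omega>)) + exp (- (\<epsilon> * ln (V t \<omega>)))))"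
          by (intro mult_left_mono bound) auto
        also have "\<dots> = B * (V t \<omega> powr (\<alpha> + \<epsilon>) + V t \<omega> powr (\<alpha> - \<epsilon>))"
          using elim by (simp add: powr_def exp_add[symmetric] algebra_simps)
        finally show ?case by (simp add: ennreal_mult[symmetric] ennreal_leI)
      qed
    qed
    also have "\<dots> = ennreal (\<integral>\<omega>. B * (V t \<omega> powr (\<alpha> + \<epsilon>) + V t \<omega> powr (\<alpha> - \<epsilon>)) \<partial>M)"
      using \<open>0 \<le> B\<close> int by (intro nn_integral_eq_integral integrable_mult_right) auto
    finally show "(\<integral>\<^sup>+\<omega>. ennreal (V t \<omega> powr \<alpha>) * ennreal (norm (g (ln (V t \<omega>)))) \<partial>M) \<le> ennreal (B * ?a t)"
      by (simp only: integral_mult_right_zero)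
  qed auto
  also have "\<dots> = ennreal (\<Sum>t. B * ?a t)"
    using \<open>0 \<le> B\<close> by (intro suminf_ennreal2 summable_mult sum mult_nonneg_nonneg Bochner_Integration.integral_nonneg) auto
  finally show "(\<integral>\<^sup>+w. ennreal (norm (g w)) \<partial>log_mixture M \<alpha> V) < \<infinity>"
    by (rule le_less_trans) simp
qed

lemma finite_borel_measure_log_mixture:
  fixes V :: "nat \<Rightarrow> 'a \<Rightarrow> real"
  assumes V: "\<And>t. V t \<in> borel_measurable M" and pos: "\<And>t. AE \<omega> in M. 0 < V t \<omega>"
    and int: "\<And>t. integrable M (\<lambda>\<omega>. V t \<omega> powr (\<alpha> + \<epsilon>) + V t \<omega> powr (\<alpha> - \<epsilon>))"
    and sum: "summable (\<lambda>t. \<integral>\<omega>. V t \<omega> powr (\<alpha> + \<epsilon>) + V t \<omega> powr (\<alpha> - \<epsilon>) \<partial>M)"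
  shows "finite_borel_measure (log_mixture M \<alpha> V)"
proof (intro finite_borel_measure.intro finite_borel_measure_axioms.intro)
  have "integrable (log_mixture M \<alpha> V) (\<lambda>_. 1 :: real)"
  proof (rule integrable_log_mixture[OF V pos int sum])
    show "norm (1::real) \<le> 1 * (exp (\<epsilon> * w) + exp (- (\<epsilon> * w)))" for w
      by (cases "0 \<le> \<epsilon> * w") (auto intro: add_increasing add_increasing2)
  qed simp
  then show "finite_measure (log_mixture M \<alpha> V)"
    by (intro finite_measureI) (simp add: integrable_iff_bounded top.not_eq_extremum)
  show "sets (log_mixture M \<alpha> V) = sets borel" by (simp add: log_mixture_def)
qed

lemma integrable_power_log_mixture:
  fixes V :: "nat \<Rightarrow> 'a \<Rightarrow> real"
  assumes V: "\<And>t. V t \<in> borel_measurable M" and pos: "\<And>t. AE \<omega> in M. 0 < V t \<omega>"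
    and int: "\<And>t. integrable M (\<lambda>\<omega>. V t \<omega> powr (\<alpha> + \<epsilon>) + V t \<omega> powr (\<alpha> - \<epsilon>))"
    and sum: "summable (\<lambda>t. \<integral>\<omega>. V t \<omega> powr (\<alpha> + \<epsilon>) + V t \<omega> powr (\<alpha> - \<epsilon>) \<partial>M)"
    and \<epsilon>: "0 < \<epsilon>"
  shows "integrable (log_mixture M \<alpha> V) (\<lambda>w. w ^ 4)"
proof (rule integrable_log_mixture[OF V pos int sum])
  show "norm (w ^ 4) \<le> (4 / \<epsilon>) ^ 4 * (exp (\<epsilon> * w) + exp (- (\<epsilon> * w)))" for w :: real
  proof -
    have "(\<epsilon> * \<bar>w\<bar> / 4) ^ 4 \<le> (1 + \<epsilon> * \<bar>w\<bar> / real 4) ^ 4"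
      using \<epsilon> by (intro power_mono) auto
    also have "\<dots> \<le> exp (\<epsilon> * \<bar>w\<bar>)"
      using \<epsilon> exp_ge_one_plus_x_over_n_power_n[of 4 "\<epsilon> * \<bar>w\<bar>"] by (simp add: order_trans[OF _ mult_nonneg_nonneg])
    also have "\<dots> \<le> exp (\<epsilon> * w) + exp (- (\<epsilon> * w))" by (cases "0 \<le> w") auto
    finally have "(4 / \<epsilon>) ^ 4 * (\<epsilon> * \<bar>w\<bar> / 4) ^ 4 \<le> (4 / \<epsilon>) ^ 4 * (exp (\<epsilon> * w) + exp (- (\<epsilon> * w)))"
      by (rule mult_left_mono) simp
    moreover have "(4 / \<epsilon>) ^ 4 * (\<epsilon> * \<bar>w\<bar> / 4) ^ 4 = \<bar>w\<bar> ^ 4"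
      using \<epsilon> by (simp add: power_mult_distrib[symmetric])
    ultimately show ?thesis by simp
  qed
qed simp

lemma char_log_mixture:
  fixes V :: "nat \<Rightarrow> 'a \<Rightarrow> real"
  assumes V[measurable]: "\<And>t. V t \<in> borel_measurable M" and pos: "\<And>t. AE \<omega> in M. 0 < V t \<omega>"
    and "finite_borel_measure (log_mixture M \<alpha> V)"
  shows "char (log_mixture M \<alpha> V) \<beta> = (\<Sum>t. \<integral>\<omega>. complex_of_real (V t \<omega>) powr Complex \<alpha> \<beta> \<partial>M)"
proof -
  interpret K: finite_borel_measure "log_mixture M \<alpha> V" by fact
  have "integrable (log_mixture M \<alpha> V) (\<lambda>w. iexp (\<beta> * w))"
    by (rule K.integrable_const_bound[where B=1]) auto
  from sums_integral_log_mixture[OF V this]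
  have "char (log_mixture M \<alpha> V) \<beta> = (\<Sum>t. \<integral>\<omega>. V t \<omega> powr \<alpha> *\<^sub>R iexp (\<beta> * ln (V t \<omega>)) \<partial>M)"
    by (simp add: char_def sums_iff)
  also have "(\<lambda>t. \<integral>\<omega>. V t \<omega> powr \<alpha> *\<^sub>R iexp (\<beta> * ln (V t \<omega>)) \<partial>M)
      = (\<lambda>t. \<integral>\<omega>. complex_of_real (V t \<omega>) powr Complex \<alpha> \<beta> \<partial>M)"
  proof
    fix t
    show "(\<integral>\<omega>. V t \<omega> powr \<alpha> *\<^sub>R iexp (\<beta> * ln (V t \<omega>)) \<partial>M) = (\<integral>\<omega>. complex_of_real (V t \<omega>) powr Complex \<alpha> \<beta> \<partial>M)"
    proof (rule integral_cong_AE)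
      show "AE \<omega> in M. V t \<omega> powr \<alpha> *\<^sub>R iexp (\<beta> * ln (V t \<omega>)) = complex_of_real (V t \<omega>) powr Complex \<alpha> \<beta>"
        using pos[of t]
      proof eventually_elim
        case (elim \<omega>)
        have "complex_of_real (V t \<omega>) powr Complex \<alpha> \<beta> = exp (Complex \<alpha> \<beta> * of_real (ln (V t \<omega>)))"
          using elim by (simp add: powr_def Ln_of_real)
        also have "\<dots> = exp (of_real (\<alpha> * ln (V t \<omega>))) * iexp (\<beta> * ln (V t \<omega>))"
          by (simp add: Complex_eq algebra_simps exp_add)
        also have "exp (of_real (\<alpha> * ln (V t \<omega>))) = complex_of_real (V t \<omega> powr \<alpha>)"
          using elim by (simp add: powr_def exp_of_real[symmetric])
        finally show ?case by (simp add: scaleR_conv_of_real)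
      qed
    qed measurable
  qed
  finally show ?thesis .
qed

end


section \<open>Estimates for randomly weighted sums\<close>

context regularly_varying_prob
begin

text \<open>
  There is c > 0 with P[V > c] > 0. On V > c and Y > y one has W > cy, so independence gives P[V >
  c] P[Y > y] \<le> G(cy), and G(cy) is of the order of G(y). For small y the bound is trivial
  because G stays away from 0 there; having it for every y removes case distinctions in the sequel.
\<close>

lemma factor_tail_dominated:
  assumes ind: "indep_var borel V borel Y" and V: "AE \<omega> in M. 0 < V \<omega>"
    and W[measurable]: "W \<in> borel_measurable M" and G: "G = tail_prob M W"
    and le: "AE \<omega> in M. V \<omega> * Y \<omega> \<le> W \<omega>"
  obtains K where "0 < K" "\<And>y. tail_prob M Y y \<le> K * G y"
proof -
  have [measurable]: "V \<in> borel_measurable M" "Y \<in> borel_measurable M"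
    using ind by (auto dest: indep_var_rv1 indep_var_rv2)
  obtain c where c: "0 < c" "0 < tail_prob M V c"
  proof (rule ccontr)
    assume "\<not> thesis"
    then have "\<not> 0 < tail_prob M V c" if "0 < c" for c using that \<open>\<And>c. 0 < c \<Longrightarrow> 0 < tail_prob M V c \<Longrightarrow> thesis\<close> by blast
    then have "tail_prob M V (1 / real (Suc n)) = 0" for n
      using tail_prob_nonneg[of V "1 / real (Suc n)"] by (simp add: not_less eq_iff)
    then have "AE \<omega> in M. \<not> 1 / real (Suc n) < V \<omega>" for n
      unfolding tail_prob_def by (subst (asm) prob_eq_0) auto
    then have "AE \<omega> in M. \<forall>n. \<not> 1 / real (Suc n) < V \<omega>" by (simp add: AE_all_countable)
    with V have "AE \<omega> in M. False"
    proof eventually_elim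
      case (elim \<omega>)
      then show ?case using reals_Archimedean[of "V \<omega>"] by (simp add: inverse_eq_divide)
    qed
    then show False by simp
  qed
  define q where "q = tail_prob M V c"
  have q: "0 < q" using c by (simp add: q_def)
  have prod_le: "q * tail_prob M Y y \<le> G (c * y)" if y: "0 \<le> y" for y
  proof -
    have "q * tail_prob M Y y = prob ((\<lambda>\<omega>. (V \<omega>, Y \<omega>)) -` ({c<..} \<times> {y<..}) \<inter> space M)"
      unfolding q_def tail_prob_def
      by (subst indep_varD[OF ind]) (auto intro!: arg_cong2[where f="(*)"] arg_cong[where f=prob])
    also have "\<dots> \<le> G (c * y)"
      unfolding G tail_prob_def
    proof (rule finite_measure_mono_AE)
      show "AE \<omega> in M. \<omega> \<in> (\<lambda>\<omega>. (V \<omega>, Y \<omega>)) -` ({c<..} \<times> {y<..}) \<inter> space M \<longrightarrow> \<omega> \<in> {\<omega>\<in>space M. W \<omega> > c * y}"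
        using le
      proof eventually_elim
        case (elim \<omega>)
        have "c * y < V \<omega> * Y \<omega>" if "c < V \<omega>" "y < Y \<omega>"
          using that c y by (intro mult_strict_mono) auto
        with elim show ?case by auto
      qed
    qed measurable
    finally show ?thesis .
  qed
  have "\<forall>\<^sub>F y in at_top. G (c * y) / G y < c powr (- \<alpha>) + 1"
    by (intro order_tendstoD(2)[OF ratio]) (use c in auto)
  then obtain y0 where y0: "\<And>y. y0 \<le> y \<Longrightarrow> G (c * y) / G y < c powr (- \<alpha>) + 1"
    unfolding eventually_at_top_linorder by blast
  define y1 where "y1 = max y0 0"
  define K where "K = max ((c powr (- \<alpha>) + 1) / q) (1 / G y1)"
  have "0 < K" unfolding K_def using pos[of y1] by (simp add: less_max_iff_disj)
  moreover have "tail_prob M Y y \<le> K * G y" for y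
  proof (cases "y1 \<le> y")
    case True
    then have y: "y0 \<le> y" "0 \<le> y" by (auto simp: y1_def)
    have "q * tail_prob M Y y \<le> G (c * y)" by (rule prod_le[OF y(2)])
    also have "\<dots> \<le> (c powr (- \<alpha>) + 1) * G y"
      using y0[OF y(1)] pos[of y] by (simp only: pos_divide_less_eq less_imp_le)
    finally have "tail_prob M Y y \<le> (c powr (- \<alpha>) + 1) / q * G y"
      using q by (simp add: field_simps)
    also have "\<dots> \<le> K * G y" using pos[of y] by (intro mult_right_mono) (auto simp: K_def)
    finally show ?thesis .
  next
    case False
    have "tail_prob M Y y \<le> 1" by (rule tail_prob_le_1)
    also have "1 \<le> 1 / G y1 * G y" using antimono[of y y1] pos[of y1] False by (simp add: field_simps)
    also have "\<dots> \<le> K * G y" using pos[of y] by (intro mult_right_mono) (auto simp: K_def)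
    finally show ?thesis .
  qed
  ultimately show thesis by (rule that)
qed

text \<open>
  Both products exceed x only if max(V1, V2) min(Y1, Y2) does. The two factors are independent, and
  the tail of the minimum is negligible against the tail of Y1, hence against G.
\<close>

lemma product_pair_negligible:
  assumes [measurable]: "V1 \<in> borel_measurable M" "V2 \<in> borel_measurable M"
      "Y1 \<in> borel_measurable M" "Y2 \<in> borel_measurable M"
    and ind: "indep_var borel (\<lambda>\<omega>. max (V1 \<omega>) (V2 \<omega>)) borel (\<lambda>\<omega>. min (Y1 \<omega>) (Y2 \<omega>))"
    and V: "AE \<omega> in M. 0 < V1 \<omega>"
    and Y: "AE \<omega> in M. 0 < Y1 \<omega>" "AE \<omega> in M. 0 < Y2 \<omega>"
    and int: "integrable M (\<lambda>\<omega>. V1 \<omega> powr (\<alpha> + \<epsilon>) + V1 \<omega> powr (\<alpha> - \<epsilon>))"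
      "integrable M (\<lambda>\<omega>. V2 \<omega> powr (\<alpha> + \<epsilon>) + V2 \<omega> powr (\<alpha> - \<epsilon>))"
    and dom: "\<And>y. tail_prob M Y1 y \<le> K * G y" and K: "0 < K" and F_pos: "\<And>y. 0 < y \<Longrightarrow> 0 < tail_prob M Y1 y"
    and Potter: "\<And>x v. x0 \<le> x \<Longrightarrow> 0 < v \<Longrightarrow> G (x / v) \<le> C * (v powr (\<alpha> + \<epsilon>) + v powr (\<alpha> - \<epsilon>)) * G x"
    and asym: "((\<lambda>x. prob {\<omega>\<in>space M. Y1 \<omega> > x \<and> Y2 \<omega> > x} / tail_prob M Y1 x) \<longlongrightarrow> 0) at_top"
  shows "((\<lambda>x. prob {\<omega>\<in>space M. V1 \<omega> * Y1 \<omega> > x \<and> V2 \<omega> * Y2 \<omega> > x} / G x) \<longlongrightarrow> 0) at_top"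
proof -
  let ?V = "\<lambda>\<omega>. max (V1 \<omega>) (V2 \<omega>)" and ?Y = "\<lambda>\<omega>. min (Y1 \<omega>) (Y2 \<omega>)"
  have tail_Y: "tail_prob M ?Y x = prob {\<omega>\<in>space M. Y1 \<omega> > x \<and> Y2 \<omega> > x}" for x
    by (simp add: tail_prob_def)
  have "((\<lambda>x. tail_prob M (\<lambda>\<omega>. ?V \<omega> * ?Y \<omega>) x / G x) \<longlongrightarrow> 0) at_top"
  proof (rule product_tail_negligible[OF ind])
    show "AE \<omega> in M. 0 < ?V \<omega>" using V by eventually_elim auto
    show "integrable M (\<lambda>\<omega>. ?V \<omega> powr (\<alpha> + \<epsilon>) + ?V \<omega> powr (\<alpha> - \<epsilon>))"
    proof (rule Bochner_Integration.integrable_bound[OF Bochner_Integration.integrable_add[OF int]])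
      show "AE \<omega> in M. norm (?V \<omega> powr (\<alpha> + \<epsilon>) + ?V \<omega> powr (\<alpha> - \<epsilon>))
          \<le> norm ((V1 \<omega> powr (\<alpha> + \<epsilon>) + V1 \<omega> powr (\<alpha> - \<epsilon>)) + (V2 \<omega> powr (\<alpha> + \<epsilon>) + V2 \<omega> powr (\<alpha> - \<epsilon>)))"
        by (intro AE_I2) (auto simp: max_def)
    qed measurable
    show "tail_prob M ?Y y \<le> K * G y" for y
      by (rule order_trans[OF tail_prob_AE_mono dom]) auto
    show "((\<lambda>y. tail_prob M ?Y y / G y) \<longlongrightarrow> 0) at_top"
    proof (rule tendsto_sandwich[of "\<lambda>_. 0"])
      show "\<forall>\<^sub>F y in at_top. tail_prob M ?Y y / G y
          \<le> K * (prob {\<omega>\<in>space M. Y1 \<omega> > y \<and> Y2 \<omega> > y} / tail_prob M Y1 y)"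
        using eventually_gt_at_top[of 0]
      proof eventually_elim
        case (elim y)
        have "tail_prob M ?Y y * tail_prob M Y1 y \<le> tail_prob M ?Y y * (K * G y)"
          by (intro mult_left_mono dom tail_prob_nonneg)
        then show ?case unfolding tail_Y[symmetric] using F_pos[OF elim] pos[of y] by (simp add: field_simps)
      qed
      show "((\<lambda>y. K * (prob {\<omega>\<in>space M. Y1 \<omega> > y \<and> Y2 \<omega> > y} / tail_prob M Y1 y)) \<longlongrightarrow> 0) at_top"
        using tendsto_mult_right_zero[OF asym] .
      show "\<forall>\<^sub>F y in at_top. 0 \<le> tail_prob M ?Y y / G y"
        using pos by (simp add: tail_prob_nonneg less_imp_le)
    qed simp
  qed (use K Potter in auto)
  note lim = this
  show ?thesis
  proof (rule tendsto_sandwich[OF _ _ tendsto_const lim])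
    show "\<forall>\<^sub>F x in at_top. 0 \<le> prob {\<omega>\<in>space M. V1 \<omega> * Y1 \<omega> > x \<and> V2 \<omega> * Y2 \<omega> > x} / G x"
      using pos by (intro always_eventually allI divide_nonneg_pos) auto
    show "\<forall>\<^sub>F x in at_top. prob {\<omega>\<in>space M. V1 \<omega> * Y1 \<omega> > x \<and> V2 \<omega> * Y2 \<omega> > x} / G x
        \<le> tail_prob M (\<lambda>\<omega>. ?V \<omega> * ?Y \<omega>) x / G x"
    proof (intro always_eventually allI divide_right_mono)
      fix x
      show "prob {\<omega>\<in>space M. V1 \<omega> * Y1 \<omega> > x \<and> V2 \<omega> * Y2 \<omega> > x} \<le> tail_prob M (\<lambda>\<omega>. ?V \<omega> * ?Y \<omega>) x"
        unfolding tail_prob_def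
      proof (rule finite_measure_mono_AE)
        show "AE \<omega> in M. \<omega> \<in> {\<omega>\<in>space M. V1 \<omega> * Y1 \<omega> > x \<and> V2 \<omega> * Y2 \<omega> > x} \<longrightarrow> \<omega> \<in> {\<omega>\<in>space M. ?V \<omega> * ?Y \<omega> > x}"
          using Y
        proof eventually_elim
          case (elim \<omega>)
          have "V1 \<omega> * Y1 \<omega> \<le> ?V \<omega> * Y1 \<omega>" "V2 \<omega> * Y2 \<omega> \<le> ?V \<omega> * Y2 \<omega>"
            using elim by (auto intro: mult_right_mono)
          then show ?case by (auto simp: min_def)
        qed
      qed measurable
    qed (use pos less_imp_le in auto)
  qed
qed

text \<open>
  With a_t the sum of the moments of V_t of orders \<alpha>+\<epsilon> and \<alpha>-\<epsilon>,
  Potter's bound makes the truncated p-th moment of V_t Y_t at level x at most a constant times a_t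
  G(x). Hence finite_sum_tail_le, with m_t the p-th root of a_t, bounds the tail of every block of
  terms by a constant times G(x) and the p-th power of the sum of the m_t over the block.
\<close>

lemma sum_tail_uniformly_small:
  fixes V Y :: "nat \<Rightarrow> 'a \<Rightarrow> real"
  assumes ind: "\<And>t. indep_var borel (V t) borel (Y t)"
    and V: "\<And>t. AE \<omega> in M. 0 < V t \<omega>" and Y: "\<And>t. AE \<omega> in M. 0 < Y t \<omega>"
    and W[measurable]: "W \<in> borel_measurable M" and sums: "AE \<omega> in M. (\<lambda>t. V t \<omega> * Y t \<omega>) sums W \<omega>"
    and int: "\<And>t. integrable M (\<lambda>\<omega>. V t \<omega> powr (\<alpha> + \<epsilon>) + V t \<omega> powr (\<alpha> - \<epsilon>))"
    and dom: "\<And>t y. tail_prob M (Y t) y \<le> K * G y" and K: "0 < K" and C: "0 < C" and x0: "0 < x0"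
    and Potter: "\<And>x v. x0 \<le> x \<Longrightarrow> 0 < v \<Longrightarrow> G (x / v) \<le> C * (v powr (\<alpha> + \<epsilon>) + v powr (\<alpha> - \<epsilon>)) * G x"
    and p: "1 \<le> p" "\<alpha> + \<epsilon> < p" and \<epsilon>: "0 < \<epsilon>" "\<epsilon> < \<alpha>"
    and m: "summable (\<lambda>t. (\<integral>\<omega>. V t \<omega> powr (\<alpha> + \<epsilon>) + V t \<omega> powr (\<alpha> - \<epsilon>) \<partial>M) powr (1 / p))"
    and \<eta>: "0 < \<eta>"
  shows "\<exists>n. \<forall>\<^sub>F x in at_top. tail_prob M (\<lambda>\<omega>. W \<omega> - (\<Sum>t<n. V t \<omega> * Y t \<omega>)) x \<le> \<eta> * G x"
proof -
  have [measurable]: "V t \<in> borel_measurable M" "Y t \<in> borel_measurable M" for t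
    using ind[of t] by (auto dest: indep_var_rv1 indep_var_rv2)
  define a where "a t = (\<integral>\<omega>. V t \<omega> powr (\<alpha> + \<epsilon>) + V t \<omega> powr (\<alpha> - \<epsilon>) \<partial>M)" for t
  define m where "m t = a t powr (1 / p)" for t
  have a: "0 < a t" for t
  proof -
    have "0 \<le> a t" unfolding a_def by (intro Bochner_Integration.integral_nonneg) auto
    moreover have "a t \<noteq> 0"
    proof
      assume "a t = 0"
      then have "AE \<omega> in M. V t \<omega> powr (\<alpha> + \<epsilon>) + V t \<omega> powr (\<alpha> - \<epsilon>) = 0"
        unfolding a_def by (subst (asm) integral_nonneg_eq_0_iff_AE[OF int]) auto
      with V[of t] have "AE \<omega> in M. False"
      proof eventually_elim
        case (elim \<omega>)
        then have "0 < V t \<omega> powr (\<alpha> + \<epsilon>)" "0 < V t \<omega> powr (\<alpha> - \<epsilon>)" by auto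
        with elim(2) show ?case by linarith
      qed
      then show False by simp
    qed
    ultimately show ?thesis by simp
  qed
  have m_pos: "0 < m t" and m_p: "m t powr p = a t" for t
    using a[of t] p by (auto simp: m_def powr_powr)
  have m_sum: "summable m" using m unfolding m_def a_def .
  define c where "c = 2 powr (\<alpha> + \<epsilon>) / (1 - 2 powr (\<alpha> + \<epsilon> - p))"
  have c: "0 < c"
    unfolding c_def using p powr_less_mono[of "\<alpha> + \<epsilon> - p" 0 2] by simp
  define D where "D = K * C * c"
  have D: "0 < D" using K C c by (simp add: D_def)
  have block: "tail_prob M (\<lambda>\<omega>. \<Sum>t\<in>S. V t \<omega> * Y t \<omega>) x \<le> (\<Sum>t\<in>S. m t) powr p * (D * G x)"
    if x: "x0 \<le> x" and S: "finite S" for S x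
  proof (rule finite_sum_tail_le[OF S _ _ _ p(1) m_pos])
    show x_pos: "0 < x" using x x0 by simp
    show pos_Z: "AE \<omega> in M. 0 < V t \<omega> * Y t \<omega>" for t
      using V[of t] Y[of t] by eventually_elim simp
    show "(\<integral>\<omega>. min (V t \<omega> * Y t \<omega> / x) 1 powr p \<partial>M) \<le> m t powr p * (D * G x)" for t
    proof -
      have "(\<integral>\<omega>. min (V t \<omega> * Y t \<omega> / x) 1 powr p \<partial>M) \<le> (K * C * a t * G x) * (2 powr (\<alpha> + \<epsilon>) / (1 - 2 powr (\<alpha> + \<epsilon> - p)))"
      proof (rule truncated_moment_le[OF _ pos_Z x_pos _ p(2)])
        show "0 \<le> K * C * a t * G x" using K C a[of t] pos[of x] by simp
        show "tail_prob M (\<lambda>\<omega>. V t \<omega> * Y t \<omega>) (x / 2 ^ k) \<le> K * C * a t * G x * (2 powr (\<alpha> + \<epsilon>)) ^ k" for k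
        proof -
          \<comment> \<open>The level x/2^k may be too low for Potter's bound; moving the factor 2^k to the weight
              keeps the argument of G at x.\<close>
          define V' where "V' \<omega> = 2 ^ k * V t \<omega>" for \<omega>
          have [measurable]: "V' \<in> borel_measurable M" unfolding V'_def[abs_def] by measurable
          have V'_powr: "V' \<omega> powr (\<alpha> + \<epsilon>) + V' \<omega> powr (\<alpha> - \<epsilon>)
              \<le> (2 powr (\<alpha> + \<epsilon>)) ^ k * (V t \<omega> powr (\<alpha> + \<epsilon>) + V t \<omega> powr (\<alpha> - \<epsilon>))" if "0 < V t \<omega>" for \<omega>
          proof -
            have "(2 ^ k) powr (\<alpha> - \<epsilon>) \<le> ((2::real) ^ k) powr (\<alpha> + \<epsilon>)"
              using \<epsilon> by (intro powr_mono) auto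
            moreover have "((2::real) ^ k) powr (\<alpha> + \<epsilon>) = (2 powr (\<alpha> + \<epsilon>)) ^ k"
              by (simp add: powr_realpow[symmetric] powr_powr mult.commute)
            ultimately show ?thesis using that
              by (simp add: V'_def powr_mult distrib_left mult_right_mono)
          qed
          have int': "integrable M (\<lambda>\<omega>. V' \<omega> powr (\<alpha> + \<epsilon>) + V' \<omega> powr (\<alpha> - \<epsilon>))"
          proof (rule Bochner_Integration.integrable_bound[OF integrable_mult_right[OF int[of t], of "(2 powr (\<alpha> + \<epsilon>)) ^ k"]])
            show "AE \<omega> in M. norm (V' \<omega> powr (\<alpha> + \<epsilon>) + V' \<omega> powr (\<alpha> - \<epsilon>))
                \<le> norm ((2 powr (\<alpha> + \<epsilon>)) ^ k * (V t \<omega> powr (\<alpha> + \<epsilon>) + V t \<omega> powr (\<alpha> - \<epsilon>)))"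
              using V[of t]
            proof eventually_elim
              case (elim \<omega>)
              from V'_powr[OF this] show ?case by (simp add: abs_mult)
            qed
          qed measurable
          have "tail_prob M (\<lambda>\<omega>. V t \<omega> * Y t \<omega>) (x / 2 ^ k) = tail_prob M (\<lambda>\<omega>. V' \<omega> * Y t \<omega>) x"
            unfolding tail_prob_def V'_def by (intro arg_cong[where f=prob]) (auto simp: field_simps)
          also have "\<dots> \<le> K * C * (\<integral>\<omega>. V' \<omega> powr (\<alpha> + \<epsilon>) + V' \<omega> powr (\<alpha> - \<epsilon>) \<partial>M) * G x"
          proof (rule product_tail_le[OF _ _ int' dom])
            have "indep_var borel ((\<lambda>v. 2 ^ k * v) \<circ> V t) borel (id \<circ> Y t)"
              by (rule indep_var_compose[OF ind]) auto
            then show "indep_var borel V' borel (Y t)" by (simp add: V'_def[abs_def] o_def)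
            show "AE \<omega> in M. 0 < V' \<omega>" using V[of t] by eventually_elim (simp add: V'_def)
          qed (use K Potter[OF x] in auto)
          also have "\<dots> \<le> K * C * ((2 powr (\<alpha> + \<epsilon>)) ^ k * a t) * G x"
          proof (intro mult_right_mono mult_left_mono)
            have "(\<integral>\<omega>. V' \<omega> powr (\<alpha> + \<epsilon>) + V' \<omega> powr (\<alpha> - \<epsilon>) \<partial>M)
                \<le> (\<integral>\<omega>. (2 powr (\<alpha> + \<epsilon>)) ^ k * (V t \<omega> powr (\<alpha> + \<epsilon>) + V t \<omega> powr (\<alpha> - \<epsilon>)) \<partial>M)"
            proof (rule integral_mono_AE[OF int' integrable_mult_right[OF int]])
              show "AE \<omega> in M. V' \<omega> powr (\<alpha> + \<epsilon>) + V' \<omega> powr (\<alpha> - \<epsilon>) \<le> (2 powr (\<alpha> + \<epsilon>)) ^ k * (V t \<omega> powr (\<alpha> + \<epsilon>) + V t \<omega> powr (\<alpha> - \<epsilon>))"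
                using V[of t] by eventually_elim (rule V'_powr)
            qed
            also have "\<dots> = (2 powr (\<alpha> + \<epsilon>)) ^ k * a t" unfolding a_def by (rule integral_mult_right_zero)
            finally show "(\<integral>\<omega>. V' \<omega> powr (\<alpha> + \<epsilon>) + V' \<omega> powr (\<alpha> - \<epsilon>) \<partial>M) \<le> (2 powr (\<alpha> + \<epsilon>)) ^ k * a t" .
          qed (use K C pos[of x] in auto)
          finally show ?thesis by (simp add: mult_ac)
        qed
      qed (use p in auto)
      also have "\<dots> = m t powr p * (D * G x)" by (simp add: m_p D_def c_def mult_ac)
      finally show ?thesis .
    qed
  qed measurable
  have "(\<lambda>n. (\<Sum>t. m (t + n)) powr p) \<longlonglongrightarrow> 0 powr p"
    using p by (intro tendsto_powr' suminf_exist_split2[OF m_sum] tendsto_const)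
      (auto intro!: always_eventually suminf_nonneg summable_ignore_initial_segment[OF m_sum] less_imp_le[OF m_pos])
  then have "\<forall>\<^sub>F n in sequentially. (\<Sum>t. m (t + n)) powr p < \<eta> / D"
    using p \<eta> D by (intro order_tendstoD) auto
  then obtain n where n: "(\<Sum>t. m (t + n)) powr p < \<eta> / D" by (auto simp: eventually_sequentially)
  have "\<forall>\<^sub>F x in at_top. tail_prob M (\<lambda>\<omega>. W \<omega> - (\<Sum>t<n. V t \<omega> * Y t \<omega>)) x \<le> \<eta> * G x"
    using eventually_ge_at_top[of x0]
  proof eventually_elim
    case (elim x)
    show ?case
    proof (rule tail_prob_le_of_AE_limit[where S="\<lambda>N \<omega>. \<Sum>t\<in>{n..<N + n}. V t \<omega> * Y t \<omega>"])
      show "AE \<omega> in M. (\<lambda>N. \<Sum>t\<in>{n..<N + n}. V t \<omega> * Y t \<omega>) \<longlonglongrightarrow> W \<omega> - (\<Sum>t<n. V t \<omega> * Y t \<omega>)"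
        using sums
      proof eventually_elim
        case (elim \<omega>)
        then have "(\<lambda>t. V (t + n) \<omega> * Y (t + n) \<omega>) sums (W \<omega> - (\<Sum>t<n. V t \<omega> * Y t \<omega>))"
          by (rule sums_split_initial_segment)
        then show ?case
          unfolding sums_def using sum.shift_bounds_nat_ivl[of "\<lambda>t. V t \<omega> * Y t \<omega>" 0 n]
          by (simp add: lessThan_atLeast0)
      qed
      show "tail_prob M (\<lambda>\<omega>. \<Sum>t\<in>{n..<N + n}. V t \<omega> * Y t \<omega>) x \<le> \<eta> * G x" for N
      proof -
        have "tail_prob M (\<lambda>\<omega>. \<Sum>t\<in>{n..<N + n}. V t \<omega> * Y t \<omega>) x \<le> (\<Sum>t\<in>{n..<N + n}. m t) powr p * (D * G x)"
          by (rule block[OF elim]) simp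
        also have "(\<Sum>t\<in>{n..<N + n}. m t) = (\<Sum>t<N. m (t + n))"
          using sum.shift_bounds_nat_ivl[of m 0 n N] by (simp add: lessThan_atLeast0)
        also have "\<dots> powr p * (D * G x) \<le> (\<Sum>t. m (t + n)) powr p * (D * G x)"
          using p D pos[of x] m_pos
          by (intro mult_right_mono powr_mono2 sum_le_suminf summable_ignore_initial_segment[OF m_sum] sum_nonneg)
             (auto simp: less_imp_le)
        also have "\<dots> \<le> \<eta> / D * (D * G x)"
          using n D pos[of x] by (intro mult_right_mono) auto
        also have "\<dots> = \<eta> * G x" using D by simp
        finally show ?thesis .
      qed
    qed measurable
  qed
  then show ?thesis by blast
qed

end


section \<open>Recovering the tail of a factor\<close>

context regularly_varying_decreasing
begin

text \<open>
  Dividing by G(e^s) instead of G(e^(s-w)) under the integral makes no difference in the limit: the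
  ratio of the two, corrected by exp(-\<alpha>w), tends to 1 by regular variation and is dominated
  by Potter's bound. After this exchange the function in the convolution is bounded, as Wiener_Pitt
  requires.
\<close>

lemma normalized_convolution_tendsto:
  assumes "finite_borel_measure \<kappa>" and int: "integrable \<kappa> (\<lambda>w. exp (\<epsilon> * w) + exp (- (\<epsilon> * w)))"
    and F[measurable]: "F \<in> borel_measurable borel" and F0: "\<And>y. 0 \<le> F y" and dom: "\<And>y. F y \<le> K * G y"
    and K: "0 < K"
    and Potter: "\<And>x v. x0 \<le> x \<Longrightarrow> 0 < v \<Longrightarrow> G (x / v) \<le> C * (v powr (\<alpha> + \<epsilon>) + v powr (\<alpha> - \<epsilon>)) * G x"
    and lim: "((\<lambda>x. (\<integral>w. exp (- (\<alpha> * w)) * F (x / exp w) \<partial>\<kappa>) / G x) \<longlongrightarrow> c) at_top"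
  shows "((\<lambda>s. \<integral>w. F (exp (s - w)) / G (exp (s - w)) \<partial>\<kappa>) \<longlongrightarrow> c) at_top"
proof -
  interpret \<kappa>: finite_borel_measure \<kappa> by fact
  define h where "h s = F (exp s) / G (exp s)" for s
  have [measurable]: "h \<in> borel_measurable borel" unfolding h_def[abs_def] by measurable
  have h: "0 \<le> h s" "h s \<le> K" for s
    using F0 dom[of "exp s"] pos[of "exp s"] by (auto simp: h_def pos_divide_le_eq less_imp_le)
  define r where "r s w = exp (- (\<alpha> * w)) * G (exp s / exp w) / G (exp s)" for s w
  define E where "E w = exp (\<epsilon> * w) + exp (- (\<epsilon> * w))" for w :: real
  have [measurable]: "r s \<in> borel_measurable borel" for s unfolding r_def[abs_def] by measurable
  have [measurable]: "E \<in> borel_measurable borel" unfolding E_def[abs_def] by measurable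
  have int_E: "integrable \<kappa> E" using int by (simp add: E_def[abs_def])
  have E1: "1 \<le> E w" for w
    unfolding E_def by (cases "0 \<le> \<epsilon> * w") (auto intro: add_increasing add_increasing2)
  have r0: "0 \<le> r s w" for s w unfolding r_def using pos less_imp_le by (auto intro!: mult_nonneg_nonneg divide_nonneg_pos)
  have r_le: "r s w \<le> C * E w" if "x0 \<le> exp s" for s w
  proof -
    have "G (exp s / exp w) \<le> C * (exp w powr (\<alpha> + \<epsilon>) + exp w powr (\<alpha> - \<epsilon>)) * G (exp s)"
      by (rule Potter[OF that]) simp
    then have "G (exp s / exp w) / G (exp s) \<le> C * (exp w powr (\<alpha> + \<epsilon>) + exp w powr (\<alpha> - \<epsilon>))"
      using pos[of "exp s"] by (simp only: pos_divide_le_eq)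
    then have "exp (- (\<alpha> * w)) * (G (exp s / exp w) / G (exp s))
        \<le> exp (- (\<alpha> * w)) * (C * (exp w powr (\<alpha> + \<epsilon>) + exp w powr (\<alpha> - \<epsilon>)))"
      by (rule mult_left_mono) simp
    also have "\<dots> = C * E w"
      by (simp add: E_def powr_def exp_add[symmetric] algebra_simps)
    finally show ?thesis by (simp add: r_def)
  qed
  have r_lim: "((\<lambda>s. r s w) \<longlongrightarrow> 1) at_top" for w
  proof -
    have "((\<lambda>x. exp (- (\<alpha> * w)) * (G (x / exp w) / G x)) \<longlongrightarrow> exp (- (\<alpha> * w)) * exp w powr \<alpha>) at_top"
      by (intro tendsto_intros ratio_div) auto
    from filterlim_compose[OF this exp_at_top] show ?thesis
      by (simp add: r_def powr_def exp_add[symmetric])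
  qed
  have "((\<lambda>s. \<integral>w. h (s - w) * (1 - r s w) \<partial>\<kappa>) \<longlongrightarrow> (\<integral>w. 0 \<partial>\<kappa>)) at_top"
  proof (rule integral_dominated_convergence_at_top[where w="\<lambda>w. K * (1 + C) * E w"])
    show "integrable \<kappa> (\<lambda>w. K * (1 + C) * E w)" by (intro integrable_mult_right int_E)
    show "AE w in \<kappa>. ((\<lambda>s. h (s - w) * (1 - r s w)) \<longlongrightarrow> 0) at_top"
    proof (rule AE_I2, rule Lim_null_comparison)
      fix w
      show "\<forall>\<^sub>F s in at_top. norm (h (s - w) * (1 - r s w)) \<le> K * \<bar>1 - r s w\<bar>"
        using h by (intro always_eventually allI) (simp add: abs_mult mult_right_mono)
      have "((\<lambda>s. K * \<bar>1 - r s w\<bar>) \<longlongrightarrow> K * \<bar>1 - 1\<bar>) at_top" by (intro tendsto_intros r_lim)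
      then show "((\<lambda>s. K * \<bar>1 - r s w\<bar>) \<longlongrightarrow> 0) at_top" by simp
    qed
    have "\<forall>\<^sub>F s in at_top. x0 \<le> exp (s::real)" using exp_at_top by (auto simp: filterlim_at_top)
    then show "\<forall>\<^sub>F s in at_top. AE w in \<kappa>. norm (h (s - w) * (1 - r s w)) \<le> K * (1 + C) * E w"
    proof eventually_elim
      case (elim s)
      show ?case
      proof (rule AE_I2)
        fix w
        have "\<bar>1 - r s w\<bar> \<le> 1 + r s w" using r0[of s w] by linarith
        also have "\<dots> \<le> E w + C * E w" by (intro add_mono E1 r_le elim)
        finally have "\<bar>h (s - w)\<bar> * \<bar>1 - r s w\<bar> \<le> K * (E w + C * E w)"
          using h[of "s - w"] K by (intro mult_mono) auto
        also have "\<dots> = K * (1 + C) * E w" by (simp add: algebra_simps)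
        finally show "norm (h (s - w) * (1 - r s w)) \<le> K * (1 + C) * E w"
          by (simp only: real_norm_def abs_mult)
      qed
    qed
  qed measurable
  moreover have "((\<lambda>s. \<integral>w. h (s - w) * r s w \<partial>\<kappa>) \<longlongrightarrow> c) at_top"
  proof -
    have eq: "h (s - w) * r s w = exp (- (\<alpha> * w)) * F (exp s / exp w) / G (exp s)" for s w
      using pos[of "exp s / exp w"] by (simp add: h_def r_def exp_diff)
    show ?thesis
      using filterlim_compose[OF lim exp_at_top] unfolding eq by simp
  qed
  ultimately have "((\<lambda>s. (\<integral>w. h (s - w) * (1 - r s w) \<partial>\<kappa>) + (\<integral>w. h (s - w) * r s w \<partial>\<kappa>)) \<longlongrightarrow> 0 + c) at_top"
    by (intro tendsto_add) auto
  moreover have "\<forall>\<^sub>F s in at_top. (\<integral>w. h (s - w) * (1 - r s w) \<partial>\<kappa>) + (\<integral>w. h (s - w) * r s w \<partial>\<kappa>) = (\<integral>w. h (s - w) \<partial>\<kappa>)"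
  proof -
    have "\<forall>\<^sub>F s in at_top. x0 \<le> exp (s::real)" using exp_at_top by (auto simp: filterlim_at_top)
    then show ?thesis
    proof eventually_elim
      case (elim s)
      have i1: "integrable \<kappa> (\<lambda>w. h (s - w))"
        using h by (intro \<kappa>.integrable_const_bound[where B=K]) auto
      have i2: "integrable \<kappa> (\<lambda>w. h (s - w) * r s w)"
      proof (rule Bochner_Integration.integrable_bound[OF integrable_mult_right[OF int_E, of "K * C"]])
        show "AE w in \<kappa>. norm (h (s - w) * r s w) \<le> norm (K * C * E w)"
        proof (rule AE_I2)
          fix w
          have "h (s - w) * r s w \<le> K * (C * E w)" using h r0 K by (intro mult_mono r_le elim) auto
          moreover have "0 \<le> h (s - w) * r s w" using h r0 by simp
          ultimately show "norm (h (s - w) * r s w) \<le> norm (K * C * E w)" by (simp add: mult.assoc)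
        qed
      qed measurable
      have i3: "integrable \<kappa> (\<lambda>w. h (s - w) * (1 - r s w))"
        using Bochner_Integration.integrable_diff[OF i1 i2] by (simp add: algebra_simps)
      show ?case
        by (subst Bochner_Integration.integral_add[OF i3 i2, symmetric]) (simp add: algebra_simps)
    qed
  qed
  ultimately have "((\<lambda>s. \<integral>w. h (s - w) \<partial>\<kappa>) \<longlongrightarrow> 0 + c) at_top"
    by (rule Lim_transform_eventually)
  then show ?thesis by (simp add: h_def)
qed

text \<open>
  Wiener_Pitt is applied to h(s) = F(e^s)/G(e^s). Slow growth of h: F does not increase, so for 0
  \<le> x \<le> \<delta> the quotient h(s+x)/h(s) is at most G(e^s)/G(e^(s+\<delta>)), which tends
  to exp(\<alpha>\<delta>). With \<delta> = ln \<rho>/(2\<alpha>) this limit is the square root of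
  \<rho>.
\<close>

theorem tail_ratio_tendsto:
  assumes \<epsilon>: "0 < \<epsilon>" "\<epsilon> < \<alpha>"
    and "finite_borel_measure \<kappa>" and int: "integrable \<kappa> (\<lambda>w. exp (\<epsilon> * w) + exp (- (\<epsilon> * w)))"
    and int4: "integrable \<kappa> (\<lambda>w. w ^ 4)" and nz: "\<And>\<xi>. char \<kappa> \<xi> \<noteq> 0"
    and F: "F \<in> borel_measurable borel" and F0: "\<And>y. 0 \<le> F y" and dom: "\<And>y. F y \<le> K * G y" and K: "0 < K"
    and F_antimono: "\<And>x y. x \<le> y \<Longrightarrow> F y \<le> F x"
    and lim: "((\<lambda>x. (\<integral>w. exp (- (\<alpha> * w)) * F (x / exp w) \<partial>\<kappa>) / G x) \<longlongrightarrow> 1) at_top"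
  shows "((\<lambda>x. F x / G x) \<longlongrightarrow> 1 / measure \<kappa> UNIV) at_top"
proof -
  interpret \<kappa>: finite_borel_measure \<kappa> by fact
  have \<alpha>: "0 < \<alpha>" using \<epsilon> by simp
  define h where "h s = F (exp s) / G (exp s)" for s
  obtain C x0 where "0 < C" "0 < x0"
    and Potter: "\<And>x v. x0 \<le> x \<Longrightarrow> 0 < v \<Longrightarrow> G (x / v) \<le> C * (v powr (\<alpha> + \<epsilon>) + v powr (\<alpha> - \<epsilon>)) * G x"
    using Potter_bound[OF \<epsilon>] by blast
  from normalized_convolution_tendsto[OF \<open>finite_borel_measure \<kappa>\<close> int F F0 dom K Potter lim]
  have conv: "((\<lambda>s. \<integral>w. h (s - w) \<partial>\<kappa>) \<longlongrightarrow> 1) at_top" by (simp add: h_def)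
  have "(h \<longlongrightarrow> 1 / measure \<kappa> UNIV) at_top"
  proof (rule \<kappa>.Wiener_Pitt[OF int4 nz _ _ _ _ conv])
    show "h \<in> borel_measurable borel" unfolding h_def[abs_def] using F by measurable
    show "0 \<le> h s" "h s \<le> K" for s
      using F0 dom[of "exp s"] pos[of "exp s"] by (auto simp: h_def pos_divide_le_eq less_imp_le)
    fix \<rho> :: real assume \<rho>: "1 < \<rho>"
    define \<delta> where "\<delta> = ln \<rho> / (2 * \<alpha>)"
    have \<delta>: "0 < \<delta>" using \<rho> \<alpha> by (simp add: \<delta>_def)
    have "1 / \<rho> < exp \<delta> powr (- \<alpha>)"
    proof -
      have "exp \<delta> powr (- \<alpha>) = exp (- (ln \<rho> / 2))" using \<alpha> by (simp add: powr_def \<delta>_def)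
      moreover have "1 / \<rho> = exp (- ln \<rho>)" using \<rho> by (simp add: exp_minus inverse_eq_divide)
      ultimately show ?thesis using \<rho> by simp
    qed
    from order_tendstoD(1)[OF ratio this] have "\<forall>\<^sub>F x in at_top. 1 / \<rho> < G (exp \<delta> * x) / G x" by simp
    from eventually_compose_filterlim[OF this exp_at_top]
    have "\<forall>\<^sub>F s in at_top. \<forall>x\<in>{0..\<delta>}. h (s + x) \<le> \<rho> * h s"
    proof eventually_elim
      case (elim s)
      show ?case
      proof
        fix x assume x: "x \<in> {0..\<delta>}"
        have "exp (s + x) \<le> exp \<delta> * exp s" using x by (simp add: exp_add[symmetric])
        then have "G (exp \<delta> * exp s) \<le> G (exp (s + x))" by (rule antimono)
        moreover have "G (exp s) < \<rho> * G (exp \<delta> * exp s)"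
          using elim \<rho> pos[of "exp s"] by (simp add: field_simps)
        ultimately have G: "G (exp s) \<le> \<rho> * G (exp (s + x))"
          using \<rho> by (meson less_imp_le mult_left_mono order_trans zero_less_one)
        have "F (exp (s + x)) * G (exp s) \<le> F (exp s) * (\<rho> * G (exp (s + x)))"
          using x by (intro mult_mono F_antimono G F0) (auto simp: pos less_imp_le)
        then show "h (s + x) \<le> \<rho> * h s"
          using pos[of "exp s"] pos[of "exp (s + x)"] by (simp add: h_def field_simps)
      qed
    qed
    with \<delta> show "\<exists>\<delta>>0. \<forall>\<^sub>F s in at_top. \<forall>x\<in>{0..\<delta>}. h (s + x) \<le> \<rho> * h s" by blast
  qed
  from filterlim_compose[OF this ln_at_top]
  have "((\<lambda>x. h (ln x)) \<longlongrightarrow> 1 / measure \<kappa> UNIV) at_top" .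
  then show ?thesis
    by (rule Lim_transform_eventually)
       (use eventually_gt_at_top[of 0] in eventually_elim, simp add: h_def)
qed

end


section \<open>The inverse problem for randomly weighted sums\<close>

lemma (in prob_space) powr_moment_shrink:
  fixes V :: "'a \<Rightarrow> real"
  assumes [measurable]: "V \<in> borel_measurable M" and pos: "AE \<omega> in M. 0 < V \<omega>"
    and \<epsilon>: "0 \<le> \<epsilon>" "\<epsilon> \<le> \<epsilon>'"
    and int: "integrable M (\<lambda>\<omega>. V \<omega> powr (\<alpha> + \<epsilon>') + V \<omega> powr (\<alpha> - \<epsilon>'))"
  shows "integrable M (\<lambda>\<omega>. V \<omega> powr (\<alpha> + \<epsilon>) + V \<omega> powr (\<alpha> - \<epsilon>))"
    and "(\<integral>\<omega>. V \<omega> powr (\<alpha> + \<epsilon>) + V \<omega> powr (\<alpha> - \<epsilon>) \<partial>M)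
      \<le> 2 * (\<integral>\<omega>. V \<omega> powr (\<alpha> + \<epsilon>') + V \<omega> powr (\<alpha> - \<epsilon>') \<partial>M)"
proof -
  have le: "AE \<omega> in M. V \<omega> powr (\<alpha> + \<epsilon>) + V \<omega> powr (\<alpha> - \<epsilon>)
      \<le> 2 * (V \<omega> powr (\<alpha> + \<epsilon>') + V \<omega> powr (\<alpha> - \<epsilon>'))"
    using pos
  proof eventually_elim
    case (elim \<omega>)
    have *: "V \<omega> powr c \<le> V \<omega> powr (\<alpha> + \<epsilon>') + V \<omega> powr (\<alpha> - \<epsilon>')" if "\<alpha> - \<epsilon>' \<le> c" "c \<le> \<alpha> + \<epsilon>'" for c
    proof (cases "1 \<le> V \<omega>")
      case True
      then have "V \<omega> powr c \<le> V \<omega> powr (\<alpha> + \<epsilon>')" using that by (intro powr_mono) auto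
      then show ?thesis by (simp add: add_increasing2)
    next
      case False
      then have "V \<omega> powr c \<le> V \<omega> powr (\<alpha> - \<epsilon>')" using that elim by (intro powr_mono') auto
      then show ?thesis by (simp add: add_increasing)
    qed
    show ?case using *[of "\<alpha> + \<epsilon>"] *[of "\<alpha> - \<epsilon>"] \<epsilon> by simp
  qed
  show int': "integrable M (\<lambda>\<omega>. V \<omega> powr (\<alpha> + \<epsilon>) + V \<omega> powr (\<alpha> - \<epsilon>))"
    by (rule Bochner_Integration.integrable_bound[OF integrable_mult_right[OF int, of 2]])
       (use le in \<open>auto elim!: eventually_mono\<close>)
  show "(\<integral>\<omega>. V \<omega> powr (\<alpha> + \<epsilon>) + V \<omega> powr (\<alpha> - \<epsilon>) \<partial>M)
      \<le> 2 * (\<integral>\<omega>. V \<omega> powr (\<alpha> + \<epsilon>') + V \<omega> powr (\<alpha> - \<epsilon>') \<partial>M)"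
    using integral_mono_AE[OF int' integrable_mult_right[OF int, of 2] le]
    by (simp only: integral_mult_right_zero)
qed

text \<open>
  Both moment conditions have the same form once an exponent p \<ge> 1 is introduced: p = 1 for
  \<alpha> < 1 and p = \<alpha> + \<epsilon> otherwise. Decreasing \<epsilon> afterwards costs a
  factor 2 in the moments and leaves room between \<alpha> + \<epsilon> and p, which
  truncated_moment_le needs.
\<close>

lemma (in prob_space) RW_common_exponents:
  fixes \<Theta> :: "nat \<Rightarrow> 'a \<Rightarrow> real"
  assumes meas: "\<And>t. t \<ge> 1 \<Longrightarrow> \<Theta> t \<in> borel_measurable M"
    and pos: "\<And>t. t \<ge> 1 \<Longrightarrow> AE \<omega> in M. \<Theta> t \<omega> > 0"
    and RW1: "\<alpha> < 1 \<Longrightarrow> RW1 M \<alpha> \<Theta>" and RW2: "\<alpha> \<ge> 1 \<Longrightarrow> RW2 M \<alpha> \<Theta>"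
  obtains \<epsilon> p where "0 < \<epsilon>" "\<epsilon> < \<alpha>" "1 \<le> p" "\<alpha> + \<epsilon> < p"
    "\<And>t. integrable M (\<lambda>\<omega>. \<Theta> (Suc t) \<omega> powr (\<alpha> + \<epsilon>) + \<Theta> (Suc t) \<omega> powr (\<alpha> - \<epsilon>))"
    "summable (\<lambda>t. (\<integral>\<omega>. \<Theta> (Suc t) \<omega> powr (\<alpha> + \<epsilon>) + \<Theta> (Suc t) \<omega> powr (\<alpha> - \<epsilon>) \<partial>M) powr (1 / p))"
proof -
  define a where "a \<epsilon> t = (\<integral>\<omega>. \<Theta> (Suc t) \<omega> powr (\<alpha> + \<epsilon>) + \<Theta> (Suc t) \<omega> powr (\<alpha> - \<epsilon>) \<partial>M)" for \<epsilon> t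
  have a0: "0 \<le> a \<epsilon> t" for \<epsilon> t unfolding a_def by (intro Bochner_Integration.integral_nonneg) auto
  obtain \<epsilon>' p where \<epsilon>': "0 < \<epsilon>'" "\<epsilon>' < \<alpha>" and p: "1 \<le> p" "\<alpha> < p"
    and int: "\<And>t. integrable M (\<lambda>\<omega>. \<Theta> (Suc t) \<omega> powr (\<alpha> + \<epsilon>') + \<Theta> (Suc t) \<omega> powr (\<alpha> - \<epsilon>'))"
    and sum: "summable (\<lambda>t. a \<epsilon>' t powr (1 / p))"
  proof (cases "\<alpha> < 1")
    case True
    from RW1[OF True] obtain \<epsilon>' where *: "0 < \<epsilon>'" "\<epsilon>' < \<alpha>"
      "\<And>t. integrable M (\<lambda>\<omega>. \<Theta> (Suc t) \<omega> powr (\<alpha> + \<epsilon>') + \<Theta> (Suc t) \<omega> powr (\<alpha> - \<epsilon>'))" "summable (a \<epsilon>')"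
      unfolding RW1_def a_def by auto
    moreover have "(\<lambda>t. a \<epsilon>' t powr (1 / 1)) = a \<epsilon>'" using a0 by (simp add: fun_eq_iff)
    ultimately show ?thesis using that[of \<epsilon>' 1] True by simp
  next
    case False
    with RW2 obtain \<epsilon>' where *: "0 < \<epsilon>'" "\<epsilon>' < \<alpha>"
      "\<And>t. integrable M (\<lambda>\<omega>. \<Theta> (Suc t) \<omega> powr (\<alpha> + \<epsilon>') + \<Theta> (Suc t) \<omega> powr (\<alpha> - \<epsilon>'))"
      "summable (\<lambda>t. a \<epsilon>' t powr (1 / (\<alpha> + \<epsilon>')))"
      unfolding RW2_def a_def by auto
    then show ?thesis using that[of \<epsilon>' "\<alpha> + \<epsilon>'"] False by simp
  qed
  define \<epsilon> where "\<epsilon> = min \<epsilon>' ((p - \<alpha>) / 2)"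
  have \<epsilon>: "0 < \<epsilon>" "\<epsilon> < \<alpha>" "\<epsilon> \<le> \<epsilon>'" "\<alpha> + \<epsilon> < p" using \<epsilon>' p by (auto simp: \<epsilon>_def min_def field_simps)
  show thesis
  proof (rule that[OF \<epsilon>(1,2) p(1) \<epsilon>(4)])
    show "integrable M (\<lambda>\<omega>. \<Theta> (Suc t) \<omega> powr (\<alpha> + \<epsilon>) + \<Theta> (Suc t) \<omega> powr (\<alpha> - \<epsilon>))" for t
      by (rule powr_moment_shrink(1)[OF meas pos _ \<epsilon>(3) int]) (use \<epsilon> in auto)
    have "a \<epsilon> t \<le> 2 * a \<epsilon>' t" for t
      unfolding a_def by (rule powr_moment_shrink(2)[OF meas pos _ \<epsilon>(3) int]) (use \<epsilon> in auto)
    then have "a \<epsilon> t powr (1 / p) \<le> 2 powr (1 / p) * a \<epsilon>' t powr (1 / p)" for t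
      using p a0 by (subst powr_mult[symmetric]) (auto intro!: powr_mono2)
    then have "summable (\<lambda>t. a \<epsilon> t powr (1 / p))"
      by (intro summable_comparison_test[OF _ summable_mult[OF sum, of "2 powr (1 / p)"]]) auto
    then show "summable (\<lambda>t. (\<integral>\<omega>. \<Theta> (Suc t) \<omega> powr (\<alpha> + \<epsilon>) + \<Theta> (Suc t) \<omega> powr (\<alpha> - \<epsilon>) \<partial>M) powr (1 / p))"
      by (simp only: a_def)
  qed
qed

lemma summable_of_summable_root:
  fixes a :: "nat \<Rightarrow> real"
  assumes a: "\<And>t. 0 \<le> a t" and p: "1 \<le> p" and sum: "summable (\<lambda>t. a t powr (1 / p))"
  shows "summable a"
proof (rule summable_comparison_test_ev[OF _ sum])
  have "\<forall>\<^sub>F t in sequentially. a t powr (1 / p) < 1"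
    by (rule order_tendstoD(2)[OF summable_LIMSEQ_zero[OF sum]]) simp
  then show "\<forall>\<^sub>F t in sequentially. norm (a t) \<le> a t powr (1 / p)"
  proof eventually_elim
    case (elim t)
    have "a t = (a t powr (1 / p)) powr p" using a[of t] p by (simp add: powr_powr)
    also have "\<dots> \<le> (a t powr (1 / p)) powr 1"
      using elim p by (intro powr_mono') auto
    finally show ?case using a[of t] by simp
  qed
qed

lemma asymp_equiv_tendsto_ratio:
  fixes f g :: "real \<Rightarrow> real"
  assumes "f \<sim>[F] (\<lambda>x. c * g x)" and c: "c \<noteq> 0" and g: "\<And>x. g x \<noteq> 0"
  shows "((\<lambda>x. f x / g x) \<longlongrightarrow> c) F"
proof -
  have "((\<lambda>x. f x / (c * g x)) \<longlongrightarrow> 1) F"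
    using assms(1) c g unfolding asymp_equiv_def by simp
  from tendsto_mult[OF tendsto_const[of c] this] show ?thesis using c by simp
qed

theorem theorem4p2:
  fixes M :: "'a measure" and \<alpha> :: real and X \<Theta> :: "nat \<Rightarrow> 'a \<Rightarrow> real"
  assumes prob: "prob_space M"
    and alpha: "\<alpha> > 0"
    and X_meas: "\<And>t. t \<ge> 1 \<Longrightarrow> X t \<in> borel_measurable M"
    and Theta_meas: "\<And>t. t \<ge> 1 \<Longrightarrow> \<Theta> t \<in> borel_measurable M"
    and X_pos: "\<And>t. t \<ge> 1 \<Longrightarrow> AE \<omega> in M. X t \<omega> > 0"
    and Theta_pos: "\<And>t. t \<ge> 1 \<Longrightarrow> AE \<omega> in M. \<Theta> t \<omega> > 0"
    and X_ident: "\<And>t. t \<ge> 1 \<Longrightarrow> distr M borel (X t) = distr M borel (X 1)"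
    and X_asymp_indep:
      "\<And>s t. s \<ge> 1 \<Longrightarrow> t \<ge> 1 \<Longrightarrow> s \<noteq> t \<Longrightarrow> asymptotically_independent M (X s) (X t)"
    and Theta_X_indep:
      "prob_space.indep_var M
         (PiM {1..} (\<lambda>_. borel)) (\<lambda>\<omega>. \<lambda>t\<in>{1..}. \<Theta> t \<omega>)
         (PiM {1..} (\<lambda>_. borel)) (\<lambda>\<omega>. \<lambda>t\<in>{1..}. X t \<omega>)"
    and sum_finite: "AE \<omega> in M. summable (\<lambda>t. \<Theta> (Suc t) \<omega> * X (Suc t) \<omega>)"
    and sum_rv: "regularly_varying_tail M \<alpha> (weighted_sum \<Theta> X)"
    and RW1: "\<alpha> < 1 \<Longrightarrow> RW1 M \<alpha> \<Theta>"
    and RW2: "\<alpha> \<ge> 1 \<Longrightarrow> RW2 M \<alpha> \<Theta>"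
    and nonzero:
      "\<And>\<beta>::real. (\<Sum>t. \<integral>\<omega>. complex_of_real (\<Theta> (Suc t) \<omega>) powr Complex \<alpha> \<beta> \<partial>M) \<noteq> 0"
  shows "regularly_varying_tail M \<alpha> (X 1) \<and>
    (\<lambda>x. \<P>(\<omega> in M. weighted_sum \<Theta> X \<omega> > x)) \<sim>[at_top]
      (\<lambda>x. \<P>(\<omega> in M. X 1 \<omega> > x) * (\<Sum>t. \<integral>\<omega>. \<Theta> (Suc t) \<omega> powr \<alpha> \<partial>M))"
proof -
  interpret prob_space M by (rule prob)
  define V where "V t = \<Theta> (Suc t)" for t
  define Y where "Y t = X (Suc t)" for t
  define W where "W = weighted_sum \<Theta> X"
  define G where "G = tail_prob M W"
  define F where "F = tail_prob M (X 1)"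
  have V_meas[measurable]: "V t \<in> borel_measurable M" and V_pos: "AE \<omega> in M. 0 < V t \<omega>" for t
    using Theta_meas[of "Suc t"] Theta_pos[of "Suc t"] by (auto simp: V_def)
  have Y_meas[measurable]: "Y t \<in> borel_measurable M" and Y_pos: "AE \<omega> in M. 0 < Y t \<omega>" for t
    using X_meas[of "Suc t"] X_pos[of "Suc t"] by (auto simp: Y_def)
  have W: "W \<omega> = (\<Sum>t. V t \<omega> * Y t \<omega>)" for \<omega> by (simp add: W_def weighted_sum_def V_def Y_def)
  have [measurable]: "W \<in> borel_measurable M" unfolding W[abs_def] by measurable
  have W_sums: "AE \<omega> in M. (\<lambda>t. V t \<omega> * Y t \<omega>) sums W \<omega>"
    using sum_finite by eventually_elim (simp add: W V_def Y_def summable_sums)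
  have tail_Y: "tail_prob M (Y t) = F" for t
  proof
    fix x
    have "tail_prob M (Y t) x = measure (distr M borel (X (Suc t))) {x<..}"
      by (subst measure_distr) (use X_meas in \<open>auto simp: tail_prob_def Y_def intro!: arg_cong[where f=prob]\<close>)
    also have "\<dots> = measure (distr M borel (X 1)) {x<..}" by (subst X_ident) auto
    also have "\<dots> = F x"
      by (subst measure_distr) (use X_meas in \<open>auto simp: tail_prob_def F_def intro!: arg_cong[where f=prob]\<close>)
    finally show "tail_prob M (Y t) x = F x" .
  qed
  have F_meas[measurable]: "F \<in> borel_measurable borel" using X_meas[of 1] by (simp add: F_def)
  have F_antimono: "x \<le> y \<Longrightarrow> F y \<le> F x" for x y
    unfolding F_def by (rule tail_prob_antimono) (use X_meas in auto)
  have F0: "0 \<le> F y" for y by (simp add: F_def tail_prob_nonneg)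
  have asym: "0 < x \<Longrightarrow> 0 < F x" "((\<lambda>x. prob {\<omega>\<in>space M. Y s \<omega> > x \<and> Y t \<omega> > x} / F x) \<longlongrightarrow> 0) at_top"
    if "s \<noteq> t" for s t x
    using X_asymp_indep[of "Suc s" "Suc t"] that tail_Y[of s]
    by (auto simp: asymptotically_independent_def tail_prob_def fun_eq_iff Y_def)
  have F_pos: "0 < F x" for x
  proof -
    have "0 < F (max x 1)" by (rule asym(1)[of 0 1 "max x 1"]) auto
    then show ?thesis using F_antimono[of x "max x 1"] by simp
  qed
  have G_pos: "0 < G x" for x
    using sum_rv unfolding regularly_varying_tail_def G_def tail_prob_def W_def by blast
  interpret regularly_varying_prob M G \<alpha>
  proof unfold_locales
    show "x \<le> y \<Longrightarrow> G y \<le> G x" for x y unfolding G_def by (rule tail_prob_antimono) auto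
    show "0 < G x" for x by (rule G_pos)
    show "G x \<le> 1" for x by (simp add: G_def tail_prob_le_1)
    fix u :: real assume u: "0 < u"
    then have "(\<lambda>x. G (u * x)) \<sim>[at_top] (\<lambda>x. u powr (- \<alpha>) * G x)"
      using sum_rv by (simp add: regularly_varying_tail_def G_def tail_prob_def W_def)
    then show "((\<lambda>x. G (u * x) / G x) \<longlongrightarrow> u powr (- \<alpha>)) at_top"
      by (rule asymp_equiv_tendsto_ratio) (use u G_pos in \<open>auto simp: less_imp_neq[THEN not_sym]\<close>)
  qed
  obtain \<epsilon> p where \<epsilon>: "0 < \<epsilon>" "\<epsilon> < \<alpha>" and p: "1 \<le> p" "\<alpha> + \<epsilon> < p"
    and int: "\<And>t. integrable M (\<lambda>\<omega>. V t \<omega> powr (\<alpha> + \<epsilon>) + V t \<omega> powr (\<alpha> - \<epsilon>))"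
    and root: "summable (\<lambda>t. (\<integral>\<omega>. V t \<omega> powr (\<alpha> + \<epsilon>) + V t \<omega> powr (\<alpha> - \<epsilon>) \<partial>M) powr (1 / p))"
  proof (rule RW_common_exponents[of \<Theta> \<alpha>])
    fix \<epsilon> p
    assume "0 < \<epsilon>" "\<epsilon> < \<alpha>" "1 \<le> p" "\<alpha> + \<epsilon> < p"
      "\<And>t. integrable M (\<lambda>\<omega>. \<Theta> (Suc t) \<omega> powr (\<alpha> + \<epsilon>) + \<Theta> (Suc t) \<omega> powr (\<alpha> - \<epsilon>))"
      "summable (\<lambda>t. (\<integral>\<omega>. \<Theta> (Suc t) \<omega> powr (\<alpha> + \<epsilon>) + \<Theta> (Suc t) \<omega> powr (\<alpha> - \<epsilon>) \<partial>M) powr (1 / p))"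
    then show thesis unfolding V_def[symmetric] by (rule that)
  qed (use Theta_meas Theta_pos RW1 RW2 in auto)
  define a where "a t = (\<integral>\<omega>. V t \<omega> powr (\<alpha> + \<epsilon>) + V t \<omega> powr (\<alpha> - \<epsilon>) \<partial>M)" for t
  have sum_a: "summable (\<lambda>t. \<integral>\<omega>. V t \<omega> powr (\<alpha> + \<epsilon>) + V t \<omega> powr (\<alpha> - \<epsilon>) \<partial>M)"
    by (rule summable_of_summable_root[OF _ p(1) root]) (auto intro!: Bochner_Integration.integral_nonneg)
  obtain C x0 where C: "0 < C" and x0: "0 < x0"
    and Potter: "\<And>x v. x0 \<le> x \<Longrightarrow> 0 < v \<Longrightarrow> G (x / v) \<le> C * (v powr (\<alpha> + \<epsilon>) + v powr (\<alpha> - \<epsilon>)) * G x"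
    using Potter_bound[OF \<epsilon>] by blast

  have coord: "indep_var borel (\<lambda>\<omega>. f (\<lambda>t\<in>{1..}. \<Theta> t \<omega>)) borel (\<lambda>\<omega>. g (\<lambda>t\<in>{1..}. X t \<omega>))"
    if "f \<in> borel_measurable (PiM {1..} (\<lambda>_. borel))" "g \<in> borel_measurable (PiM {1..} (\<lambda>_. borel))"
    for f g :: "(nat \<Rightarrow> real) \<Rightarrow> real"
    using indep_var_compose[OF Theta_X_indep that] by (simp add: o_def)
  have comp[measurable]: "(\<lambda>v. v (Suc t)) \<in> borel_measurable (PiM {1..} (\<lambda>_. borel :: real measure))" for t
    by (rule measurable_component_singleton) simp
  have ind: "indep_var borel (V t) borel (Y t)" for t
    using coord[OF comp comp, of t t] by (simp add: V_def Y_def)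
  have ind_pair: "indep_var borel (\<lambda>\<omega>. max (V s \<omega>) (V t \<omega>)) borel (\<lambda>\<omega>. min (Y s \<omega>) (Y t \<omega>))" for s t
    using coord[OF borel_measurable_max[OF comp comp] borel_measurable_min[OF comp comp], of s t s t]
    by (simp add: V_def Y_def)

  have Z_pos: "AE \<omega> in M. 0 < V t \<omega> * Y t \<omega>" for t
    using V_pos[of t] Y_pos[of t] by eventually_elim simp
  have "AE \<omega> in M. V 0 \<omega> * Y 0 \<omega> \<le> W \<omega>"
  proof -
    have "AE \<omega> in M. \<forall>t. 0 < V t \<omega> * Y t \<omega>" using Z_pos by (simp add: AE_all_countable)
    with W_sums show ?thesis
    proof eventually_elim
      case (elim \<omega>)
      then show ?case using sum_le_suminf[of "\<lambda>t. V t \<omega> * Y t \<omega>" "{0}"] by (auto simp: sums_iff less_imp_le)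
    qed
  qed
  then obtain K where K: "0 < K" and dom: "\<And>y. F y \<le> K * G y"
    using factor_tail_dominated[OF ind V_pos _ G_def] unfolding tail_Y by (metis \<open>W \<in> borel_measurable M\<close>)
  have jump: "((\<lambda>x. (\<Sum>t. tail_prob M (\<lambda>\<omega>. V t \<omega> * Y t \<omega>) x) / G x) \<longlongrightarrow> 1) at_top"
  proof (rule single_big_jump[where W=W and b="\<lambda>t. K * C * a t" and ?x1.0=x0])
    show "((\<lambda>x. prob {\<omega>\<in>space M. V s \<omega> * Y s \<omega> > x \<and> V t \<omega> * Y t \<omega> > x} / G x) \<longlongrightarrow> 0) at_top"
      if "s < t" for s t
      by (rule product_pair_negligible[OF V_meas V_meas Y_meas Y_meas ind_pair V_pos Y_pos Y_pos int int _ K _ Potter])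
         (use asym[of s t] that dom F_pos in \<open>auto simp: tail_Y\<close>)
    show "summable (\<lambda>t. K * C * a t)" unfolding a_def by (intro summable_mult sum_a)
    show "tail_prob M (\<lambda>\<omega>. V t \<omega> * Y t \<omega>) x \<le> K * C * a t * G x" if "x0 \<le> x" for x t
      unfolding a_def
      by (rule product_tail_le[OF ind V_pos int]) (use K dom Potter[OF that] in \<open>auto simp: tail_Y\<close>)
    show "\<exists>n. \<forall>\<^sub>F x in at_top. tail_prob M (\<lambda>\<omega>. W \<omega> - (\<Sum>t<n. V t \<omega> * Y t \<omega>)) x \<le> \<eta> * G x"
      if "0 < \<eta>" for \<eta>
      by (rule sum_tail_uniformly_small[OF ind V_pos Y_pos _ W_sums int _ K C x0 Potter p \<epsilon> root that])
         (auto simp: tail_Y dom)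
  qed (use Z_pos W_sums in \<open>auto simp: G_def\<close>)

  define \<kappa> where "\<kappa> = log_mixture M \<alpha> V"
  have \<kappa>: "finite_borel_measure \<kappa>"
    unfolding \<kappa>_def by (rule finite_borel_measure_log_mixture[OF V_meas V_pos int sum_a])
  interpret \<kappa>: finite_borel_measure \<kappa> by (rule \<kappa>)
  have int_\<kappa>: "integrable \<kappa> g" if "g \<in> borel_measurable borel" "\<And>w. norm (g w) \<le> B * (exp (\<epsilon> * w) + exp (- (\<epsilon> * w)))"
    for g :: "real \<Rightarrow> real" and B
    unfolding \<kappa>_def by (rule integrable_log_mixture[OF V_meas V_pos int sum_a that])
  have conv: "((\<lambda>x. (\<integral>w. exp (- (\<alpha> * w)) * F (x / exp w) \<partial>\<kappa>) / G x) \<longlongrightarrow> 1) at_top"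
  proof (rule Lim_transform_eventually[OF jump])
    show "\<forall>\<^sub>F x in at_top. (\<Sum>t. tail_prob M (\<lambda>\<omega>. V t \<omega> * Y t \<omega>) x) / G x
        = (\<integral>w. exp (- (\<alpha> * w)) * F (x / exp w) \<partial>\<kappa>) / G x"
      using eventually_ge_at_top[of x0]
    proof eventually_elim
      case (elim x)
      have "integrable \<kappa> (\<lambda>w. exp (- (\<alpha> * w)) * F (x / exp w))"
      proof (rule int_\<kappa>)
        show "norm (exp (- (\<alpha> * w)) * F (x / exp w)) \<le> (K * C * G x) * (exp (\<epsilon> * w) + exp (- (\<epsilon> * w)))" for w
        proof -
          have "F (x / exp w) \<le> K * G (x / exp w)" by (rule dom)
          also have "\<dots> \<le> K * (C * (exp w powr (\<alpha> + \<epsilon>) + exp w powr (\<alpha> - \<epsilon>)) * G x)"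
            using K by (intro mult_left_mono Potter elim) auto
          finally have "exp (- (\<alpha> * w)) * F (x / exp w)
              \<le> exp (- (\<alpha> * w)) * (K * (C * (exp w powr (\<alpha> + \<epsilon>) + exp w powr (\<alpha> - \<epsilon>)) * G x))"
            by (rule mult_left_mono) simp
          also have "\<dots> = (K * C * G x) * (exp (\<epsilon> * w) + exp (- (\<epsilon> * w)))"
            by (simp add: powr_def exp_add[symmetric] algebra_simps)
          finally show ?thesis using F0 by (simp add: abs_mult)
        qed
      qed measurable
      from sums_integral_log_mixture[OF V_meas this[unfolded \<kappa>_def]]
      have "(\<integral>w. exp (- (\<alpha> * w)) * F (x / exp w) \<partial>\<kappa>)
          = (\<Sum>t. \<integral>\<omega>. V t \<omega> powr \<alpha> * (exp (- (\<alpha> * ln (V t \<omega>))) * F (x / exp (ln (V t \<omega>)))) \<partial>M)"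
        by (simp add: \<kappa>_def sums_iff)
      also have "\<dots> = (\<Sum>t. tail_prob M (\<lambda>\<omega>. V t \<omega> * Y t \<omega>) x)"
      proof (intro suminf_cong)
        fix t
        have "(\<integral>\<omega>. V t \<omega> powr \<alpha> * (exp (- (\<alpha> * ln (V t \<omega>))) * F (x / exp (ln (V t \<omega>)))) \<partial>M) = (\<integral>\<omega>. F (x / V t \<omega>) \<partial>M)"
        proof (rule integral_cong_AE)
          show "AE \<omega> in M. V t \<omega> powr \<alpha> * (exp (- (\<alpha> * ln (V t \<omega>))) * F (x / exp (ln (V t \<omega>)))) = F (x / V t \<omega>)"
            using V_pos[of t]
          proof eventually_elim
            case (elim \<omega>)
            then show ?case by (simp add: powr_def exp_minus)
          qed
        qed measurable
        also have "\<dots> = tail_prob M (\<lambda>\<omega>. V t \<omega> * Y t \<omega>) x"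
          using tail_prob_product[OF ind[of t] V_pos[of t], of x] by (simp add: tail_Y)
        finally show "(\<integral>\<omega>. V t \<omega> powr \<alpha> * (exp (- (\<alpha> * ln (V t \<omega>))) * F (x / exp (ln (V t \<omega>)))) \<partial>M)
            = tail_prob M (\<lambda>\<omega>. V t \<omega> * Y t \<omega>) x" .
      qed
      finally show ?case by simp
    qed
  qed
  have char_nz: "char \<kappa> \<xi> \<noteq> 0" for \<xi>
  proof -
    have "char \<kappa> \<xi> = (\<Sum>t. \<integral>\<omega>. complex_of_real (V t \<omega>) powr Complex \<alpha> \<xi> \<partial>M)"
      unfolding \<kappa>_def by (rule char_log_mixture[OF V_meas V_pos \<kappa>[unfolded \<kappa>_def]])
    then show ?thesis using nonzero[of \<xi>] by (simp add: V_def)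
  qed
  define m where "m = measure \<kappa> UNIV"
  have m: "m = (\<Sum>t. \<integral>\<omega>. \<Theta> (Suc t) \<omega> powr \<alpha> \<partial>M)"
    using sums_integral_log_mixture[OF V_meas \<kappa>.integrable_const[of "1 :: real", unfolded \<kappa>_def]] \<kappa>.space_eq_UNIV
    by (simp add: m_def sums_iff \<kappa>_def[symmetric] V_def)
  have "m \<noteq> 0" using char_nz[of 0] by (simp add: char_def m_def \<kappa>.space_eq_UNIV)
  then have m_pos: "0 < m" by (simp add: m_def zero_less_measure_iff)
  have ratio_F: "((\<lambda>x. F x / G x) \<longlongrightarrow> 1 / m) at_top"
    unfolding m_def
  proof (rule tail_ratio_tendsto[OF \<epsilon> \<kappa> _ _ char_nz F_meas F0 dom K F_antimono conv])
    show "integrable \<kappa> (\<lambda>w. exp (\<epsilon> * w) + exp (- (\<epsilon> * w)))" by (rule int_\<kappa>[of _ 1]) auto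
    show "integrable \<kappa> (\<lambda>w. w ^ 4)"
      unfolding \<kappa>_def by (rule integrable_power_log_mixture[OF V_meas V_pos int sum_a \<epsilon>(1)])
  qed
  have ratio_G: "((\<lambda>x. G x / F x) \<longlongrightarrow> m) at_top"
    using tendsto_inverse[OF ratio_F] m_pos by (simp add: inverse_eq_divide)

  have "(\<lambda>x. F (u * x)) \<sim>[at_top] (\<lambda>x. u powr (- \<alpha>) * F x)" if u: "0 < u" for u
  proof -
    have lim: "filterlim (\<lambda>x. u * x) at_top at_top"
      using filterlim_tendsto_pos_mult_at_top[OF tendsto_const[of u] u filterlim_ident] by simp
    have "((\<lambda>x. (F (u * x) / G (u * x)) * (G (u * x) / G x) * (G x / F x)) \<longlongrightarrow> 1 / m * u powr (- \<alpha>) * m) at_top"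
      by (intro tendsto_mult filterlim_compose[OF ratio_F lim] ratio u ratio_G)
    then have "((\<lambda>x. F (u * x) / F x) \<longlongrightarrow> u powr (- \<alpha>)) at_top"
      using m_pos G_pos by (simp add: less_imp_neq[THEN not_sym])
    from tendsto_mult[OF tendsto_const[of "inverse (u powr (- \<alpha>))"] this]
    have "((\<lambda>x. F (u * x) / (u powr (- \<alpha>) * F x)) \<longlongrightarrow> 1) at_top"
      using u by (simp add: field_simps)
    then show ?thesis by (rule asymp_equivI')
  qed
  then have "regularly_varying_tail M \<alpha> (X 1)"
    using F_pos by (simp add: regularly_varying_tail_def F_def tail_prob_def)
  moreover have "G \<sim>[at_top] (\<lambda>x. F x * m)"
  proof (rule asymp_equivI')
    from tendsto_mult[OF tendsto_const[of "inverse m"] ratio_G]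
    show "((\<lambda>x. G x / (F x * m)) \<longlongrightarrow> 1) at_top" using m_pos by (simp add: field_simps)
  qed
  ultimately show ?thesis
    unfolding m by (simp add: G_def F_def tail_prob_def[abs_def] W_def)
qed


end
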